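(* Let $(a_k)_{k\ge 0}$ be functions in $W$, and let $f_0\in X$. For $T>0$ and $i\in\mathbb{N}$, $i\ge 1$, put $h_i=T/i$ and let $u_i$ be the implicit-explicit iteration of size $h_i$ beginning at $f_0$, considered on $t\in[0,T]$. Then, for all sufficiently small $T>0$, the sequence $\{u_i(t)\}_{i=1}^\infty$ converges pointwise in $t$ (that is, for each $t\in[0,T]$ the sequence $u_i(t)$ converges in $L^2(\mathbb{R})$) to a function $u(t)$, and the limit function $u$ is piecewise differentiable in $t$.
   Context: The spatial domain is $\mathbb{R}$ and $\Delta=d^2/dx^2$. $W$ is the set of $f\in L^1(\mathbb{R})\cap L^\infty(\mathbb{R})\cap C^\infty(\mathbb{R})$ with bounded derivatives up to fourth order. The coefficients $a_k$, $k\ge0$, are functions of $x$ belonging to $W$. Define the power series $g_1(z)=\sum_{k=0}^\infty \|a_k\|_1 z^k$ and $g_\infty(z)=\sum_{k=0}^\infty \|a_k\|_\infty z^k$, and $X=\{f\in W : g_1(\|f\|_1)<\infty \text{ and } g_\infty(\|f\|_\infty)<\infty\}$. Let $G(u)=\sum_{k=0}^\infty a_k u^k$. The operator $(I-h\Delta)^{-1}$, for $h>0$, is given by $\left((I-h\Delta)^{-1}f\right)(x)=\frac{1}{2\sqrt{h}}\int_{\mathbb{R}} f(y)e^{-|y-x|/\sqrt{h}}\,dy$. Given $f_0$ and $h>0$, put $f_{n+1}=(I-h\Delta)^{-1}(f_n+hG(f_n))$ for $n\ge0$. The function $u(t)=\left(1-\left(\frac{t}{h}-n(t)\right)\right)f_{n(t)}+\left(\frac{t}{h}-n(t)\right)f_{n(t)+1}$,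 where $n(t)=\lfloor t/h\rfloor$, is called the implicit-explicit iteration of size $h$ beginning at $f_0$. These are time-discrete approximations to the equation $\partial_t u=\Delta u+\sum_{k\ge 0} a_k u^k$ with initial value $f_0$.
   Formalization: The formal theorem also assumes that g_∞(r) < ∞ for some r > ‖f_0‖_∞; without this the iteration may be undefined (e.g. a_k = k!·φ with φ ≥ 0 a bump and f_0 = 0, where G(f_1) diverges). *)

theory Defs
  imports "HOL-Analysis.Analysis" "HOL-Probability.Essential_Supremum"
begin

section \<open>Norms and function spaces on the real line\<close>

definition L1_norm :: "(real \<Rightarrow> real) \<Rightarrow> real" where
  "L1_norm f = (LBINT x. \<bar>f x\<bar>)"

definition Linf_norm :: "(real \<Rightarrow> real) \<Rightarrow> real" where
  "Linf_norm f = real_of_ereal (esssup lborel (\<lambda>x. ereal \<bar>f x\<bar>))"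

definition L1 :: "(real \<Rightarrow> real) set" where
  "L1 = {f. integrable lborel f}"

definition Linf :: "(real \<Rightarrow> real) set" where
  "Linf = {f \<in> borel_measurable lborel. esssup lborel (\<lambda>x. ereal \<bar>f x\<bar>) < \<infinity>}"

definition smooth :: "(real \<Rightarrow> real) set" where
  "smooth = {f. \<forall>m. (deriv ^^ m) f differentiable_on UNIV}"

definition W :: "(real \<Rightarrow> real) set" where
  "W = {f \<in> L1 \<inter> Linf \<inter> smooth. \<forall>m\<in>{1..4}. bounded (range ((deriv ^^ m) f))}"

text \<open>
  The series have nonnegative terms (at \<open>z \<ge> 0\<close>) and are summed in the extended
  nonnegative reals, so that finiteness of the value is convergence of the series.
\<close>

definition g_one :: "(nat \<Rightarrow> real \<Rightarrow> real) \<Rightarrow> real \<Rightarrow> ennreal" where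
  "g_one a z = (\<Sum>k. ennreal (L1_norm (a k) * z ^ k))"

definition g_inf :: "(nat \<Rightarrow> real \<Rightarrow> real) \<Rightarrow> real \<Rightarrow> ennreal" where
  "g_inf a z = (\<Sum>k. ennreal (Linf_norm (a k) * z ^ k))"

definition X :: "(nat \<Rightarrow> real \<Rightarrow> real) \<Rightarrow> (real \<Rightarrow> real) set" where
  "X a = {f \<in> W. g_one a (L1_norm f) < \<infinity> \<and> g_inf a (Linf_norm f) < \<infinity>}"


section \<open>The implicit-explicit iteration\<close>

definition G :: "(nat \<Rightarrow> real \<Rightarrow> real) \<Rightarrow> (real \<Rightarrow> real) \<Rightarrow> real \<Rightarrow> real" where
  "G a u x = (\<Sum>k. a k x * u x ^ k)"

text \<open>The operator \<open>(I - h \<Delta>)\<^sup>-\<^sup>1\<close>.\<close>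

definition resolvent :: "real \<Rightarrow> (real \<Rightarrow> real) \<Rightarrow> real \<Rightarrow> real" where
  "resolvent h f x = 1 / (2 * sqrt h) * (LBINT y. f y * exp (- \<bar>y - x\<bar> / sqrt h))"

primrec imex_step ::
  "(nat \<Rightarrow> real \<Rightarrow> real) \<Rightarrow> real \<Rightarrow> (real \<Rightarrow> real) \<Rightarrow> nat \<Rightarrow> real \<Rightarrow> real" where
  "imex_step a h f0 0 = f0"
| "imex_step a h f0 (Suc n) =
     resolvent h (\<lambda>x. imex_step a h f0 n x + h * G a (imex_step a h f0 n) x)"

definition imex_iteration ::
  "(nat \<Rightarrow> real \<Rightarrow> real) \<Rightarrow> real \<Rightarrow> (real \<Rightarrow> real) \<Rightarrow> real \<Rightarrow> real \<Rightarrow> real" where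
  "imex_iteration a h f0 t x =
     (let n = nat \<lfloor>t / h\<rfloor> in
       (1 - (t / h - real n)) * imex_step a h f0 n x
       + (t / h - real n) * imex_step a h f0 (Suc n) x)"


section \<open>Calculus for functions of time with values in $L^2$\<close>

text \<open>
  Elements of $L^2$ are given by Borel representatives; everything below depends only on the
  almost-everywhere class, because it refers to functions only through \<open>L2\<close> and \<open>L2_norm\<close>.
\<close>

definition L2 :: "(real \<Rightarrow> real) set" where
  "L2 = {f \<in> borel_measurable lborel. integrable lborel (\<lambda>x. (f x)\<^sup>2)}"

definition L2_norm :: "(real \<Rightarrow> real) \<Rightarrow> real" where
  "L2_norm f = sqrt (LBINT x. (f x)\<^sup>2)"

definition L2_tendsto :: "('i \<Rightarrow> real \<Rightarrow> real) \<Rightarrow> (real \<Rightarrow> real) \<Rightarrow> 'i filter \<Rightarrow> bool" where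
  "L2_tendsto v l F \<longleftrightarrow>
     l \<in> L2 \<and> (\<forall>\<^sub>F s in F. v s \<in> L2) \<and> ((\<lambda>s. L2_norm (\<lambda>x. v s x - l x)) \<longlongrightarrow> 0) F"

definition L2_continuous_on :: "real set \<Rightarrow> (real \<Rightarrow> real \<Rightarrow> real) \<Rightarrow> bool" where
  "L2_continuous_on S u \<longleftrightarrow> (\<forall>t\<in>S. L2_tendsto u (u t) (at t within S))"

definition L2_differentiable :: "(real \<Rightarrow> real \<Rightarrow> real) \<Rightarrow> real \<Rightarrow> real set \<Rightarrow> bool" where
  "L2_differentiable u t S \<longleftrightarrow>
     (\<exists>v. L2_tendsto (\<lambda>s x. (u s x - u t x) / (s - t)) v (at t within S))"

text \<open>The $L^2$-valued analogue of \<open>piecewise_differentiable_on\<close>.\<close>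

definition L2_piecewise_differentiable_on :: "(real \<Rightarrow> real \<Rightarrow> real) \<Rightarrow> real set \<Rightarrow> bool" where
  "L2_piecewise_differentiable_on u S \<longleftrightarrow>
     L2_continuous_on S u \<and>
     (\<exists>S'. finite S' \<and> (\<forall>t\<in>S - S'. L2_differentiable u t S))"

end

theory Submission
  imports Defs "HOL-Real_Asymp.Real_Asymp"
begin

text \<open>
  Work in the Banach space \<open>E\<close> of bounded continuous functions in $L^2$, with the sum of the
  supremum norm and the $L^2$ norm. The resolvents of \<open>\<Delta>\<close> are contractions of \<open>E\<close> that satisfy the
  resolvent identity, and \<open>G\<close> is continuously differentiable on supremum balls of radius below
  \<open>r\<close>, with a Lipschitz derivative; controlling \<open>G'\<close> is why the supremum norm is needed.
  Both the iterates \<open>x\<^sub>n\<close> and the difference quotients \<open>v\<^sub>n = (x\<^sub>n\<^sub>+\<^sub>1 - x\<^sub>n) / h\<close> satisfy a recursion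
  \<open>y\<^sub>n\<^sub>+\<^sub>1 = R\<^sub>h (y\<^sub>n + h g\<^sub>n)\<close>. For two step sizes \<open>h\<close>, \<open>\<mu>\<close>, writing both resolvents in terms of
  the one with parameter \<open>h \<mu> / (h + \<mu>)\<close> gives a recurrence in two indices for
  \<open>\<parallel>x\<^sub>n - x'\<^sub>m\<parallel> + \<parallel>v\<^sub>n - v'\<^sub>m\<parallel>\<close>, as in the theorem of Crandall and Liggett, and a quadratic supersolution
  shows that this quantity is small whenever \<open>h\<close>, \<open>\<mu>\<close> and \<open>n h - m \<mu>\<close> are. Hence
  the iterates and the difference quotients both converge, and the limit of the latter is the time
  derivative of the limit of the former. The recursion for \<open>v\<^sub>n\<close> starts at an element of \<open>E\<close>
  close to \<open>f\<^sub>0'' + G(f\<^sub>0)\<close>; that \<open>f\<^sub>0''\<close> is in $L^2$ uses the bound on the fourth derivative of \<open>f\<^sub>0\<close>.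
\<close>

section \<open>A Banach space of continuous square-integrable functions\<close>

text \<open>Bounded difference quotients alone would only make the limit Lipschitz in
  \<open>t\<close>. To get a derivative at every \<open>t\<close>, the quotients are followed as a
  second sequence. Their forcing is a difference quotient of \<open>G\<close>; replacing it by the
  derivative of \<open>G\<close> applied to the current quotient costs O(h), but couples it to the
  iterates, so only the sum of the two gaps obeys a closed recurrence. The delicate point is the
  start. The first quotient is the resolvent of \<open>v0 = f0'' + G(f0)\<close>, and
  \<open>v0\<close> is not known to lie in the domain of the Laplacian, so no rate of convergence to
  \<open>v0\<close> is at hand. Convergence itself is not automatic either: elements of the domain
  have bounded derivative, so they are uniformly continuous and not dense in the space. Hence
  uniform continuity of \<open>v0\<close> is proved, and \<open>v0\<close> is replaced by a nearby
  resolvent value \<open>w\<close>, which does lie in the domain. The price is an error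
  \<open>e\<close> independent of the step sizes and a constant depending on \<open>e\<close>; the
  remaining constants are chosen after \<open>e\<close>, and the result is a Cauchy property without
  a rate.\<close>

lemma L2_norm_nonneg [simp]: "0 \<le> L2_norm f"
  by (simp add: L2_norm_def)

lemma L2_norm_power2: "(L2_norm f)\<^sup>2 = (LBINT x. (f x)\<^sup>2)"
  by (simp add: L2_norm_def)

lemma L2_scale: "f \<in> L2 \<Longrightarrow> (\<lambda>x. c * f x) \<in> L2"
  by (auto simp: L2_def power_mult_distrib)

lemma L2_norm_scale: "L2_norm (\<lambda>x. c * f x) = \<bar>c\<bar> * L2_norm f"
  by (simp add: L2_norm_def power_mult_distrib real_sqrt_mult)

lemma L2_dominated:
  assumes "f \<in> L2" "g \<in> borel_measurable lborel" "\<And>x. \<bar>g x\<bar> \<le> C * \<bar>f x\<bar>"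
  shows "g \<in> L2" "C \<ge> 0 \<Longrightarrow> L2_norm g \<le> C * L2_norm f"
proof -
  have sq: "(g x)\<^sup>2 \<le> C\<^sup>2 * (f x)\<^sup>2" for x
    using power_mono[OF assms(3)[of x] abs_ge_zero, of 2] by (simp add: power_mult_distrib)
  have int: "integrable lborel (\<lambda>x. C\<^sup>2 * (f x)\<^sup>2)" using assms(1) by (auto simp: L2_def)
  have g: "integrable lborel (\<lambda>x. (g x)\<^sup>2)"
    by (rule Bochner_Integration.integrable_bound[OF int]) (use assms(2) sq in auto)
  then show "g \<in> L2" using assms(2) by (simp add: L2_def)
  show "L2_norm g \<le> C * L2_norm f" if "C \<ge> 0"
  proof -
    have "(LBINT x. (g x)\<^sup>2) \<le> (LBINT x. C\<^sup>2 * (f x)\<^sup>2)"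
      by (rule integral_mono[OF g int sq])
    then have "L2_norm g \<le> sqrt (C\<^sup>2 * (LBINT x. (f x)\<^sup>2))" by (simp add: L2_norm_def)
    then show ?thesis using that by (simp add: L2_norm_def real_sqrt_mult)
  qed
qed

text \<open>Minkowski's inequality from a pointwise weighted Young inequality. With the ratio
  \<open>b / a\<close> of the two norms as weight, the integrated bound collapses to
  \<open>(a + b)\<^sup>2\<close>.\<close>

lemma L2_add:
  assumes "f \<in> L2" "g \<in> L2"
  shows "(\<lambda>x. f x + g x) \<in> L2" "L2_norm (\<lambda>x. f x + g x) \<le> L2_norm f + L2_norm g"
proof -
  have m [measurable]: "f \<in> borel_measurable borel" "g \<in> borel_measurable borel"
    and i: "integrable lborel (\<lambda>x. (f x)\<^sup>2)" "integrable lborel (\<lambda>x. (g x)\<^sup>2)"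
    using assms by (auto simp: L2_def)
  have young: "(f x + g x)\<^sup>2 \<le> (1 + s) * (f x)\<^sup>2 + (1 + 1 / s) * (g x)\<^sup>2" if s: "s > 0" for s x
  proof -
    have "(s * f x - g x)\<^sup>2 \<ge> 0" by simp
    then have "0 \<le> (s * f x - g x)\<^sup>2 / s" using s by simp
    also have "(s * f x - g x)\<^sup>2 / s = s * (f x)\<^sup>2 - 2 * f x * g x + (g x)\<^sup>2 / s"
      using s by (simp add: field_simps power2_eq_square)
    finally show ?thesis by (simp add: power2_sum algebra_simps)
  qed
  have int: "integrable lborel (\<lambda>x. (1 + s) * (f x)\<^sup>2 + (1 + 1 / s) * (g x)\<^sup>2)" for s
    using i by auto
  have fg: "integrable lborel (\<lambda>x. (f x + g x)\<^sup>2)"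
    by (rule Bochner_Integration.integrable_bound[OF int[of 1]]) (use young[of 1] in \<open>auto intro: order_trans\<close>)
  then show "(\<lambda>x. f x + g x) \<in> L2" using m by (simp add: L2_def)
  show "L2_norm (\<lambda>x. f x + g x) \<le> L2_norm f + L2_norm g"
  proof (rule field_le_epsilon)
    fix e :: real assume e: "e > 0"
    \<comment> \<open>The shift by \<open>e / 2\<close> keeps the ratio \<open>b / a\<close>
      meaningful when a norm vanishes.\<close>
    define a where "a = L2_norm f + e / 2"
    define b where "b = L2_norm g + e / 2"
    have ab: "a > 0" "b > 0" using e by (simp_all add: a_def b_def add_nonneg_pos)
    have "(LBINT x. (f x + g x)\<^sup>2) \<le> (LBINT x. (1 + b / a) * (f x)\<^sup>2 + (1 + 1 / (b / a)) * (g x)\<^sup>2)"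
      by (rule integral_mono[OF fg int young]) (use ab in simp)
    also have "\<dots> = (1 + b / a) * (L2_norm f)\<^sup>2 + (1 + a / b) * (L2_norm g)\<^sup>2"
      using i by (simp add: L2_norm_power2)
    also have "\<dots> \<le> (1 + b / a) * a\<^sup>2 + (1 + a / b) * b\<^sup>2"
      using ab e by (intro add_mono mult_left_mono power_mono) (auto simp: a_def b_def)
    also have "\<dots> = (a + b)\<^sup>2" using ab by (simp add: field_simps power2_eq_square)
    finally have "L2_norm (\<lambda>x. f x + g x) \<le> sqrt ((a + b)\<^sup>2)" unfolding L2_norm_def by (rule real_sqrt_le_mono)
    then show "L2_norm (\<lambda>x. f x + g x) \<le> L2_norm f + L2_norm g + e"
      using ab by (simp add: a_def b_def)
  qed
qed

lemma L2_diff: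
  assumes "f \<in> L2" "g \<in> L2"
  shows "(\<lambda>x. f x - g x) \<in> L2" "L2_norm (\<lambda>x. f x - g x) \<le> L2_norm f + L2_norm g"
  using L2_add[OF assms(1) L2_scale[OF assms(2), of "-1"]] L2_norm_scale[of "-1" g] by simp_all

text \<open>Integrability of the limit is part of the claim, hence Fatou for nonnegative integrals.
  It gives completeness of \<open>cl2\<close> and, through truncations, square-integrability of
  second derivatives.\<close>

lemma L2_Fatou:
  assumes f: "\<And>n. f n \<in> L2" and C: "\<And>n. L2_norm (f n) \<le> C" and lim: "\<And>x. (\<lambda>n. f n x) \<longlonglongrightarrow> g x"
  shows "g \<in> L2" "L2_norm g \<le> C"
proof -
  have m [measurable]: "f n \<in> borel_measurable lborel" for n using f by (simp add: L2_def)
  have mg [measurable]: "g \<in> borel_measurable lborel"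
    by (rule borel_measurable_LIMSEQ_real[OF lim m])
  have C0: "C \<ge> 0" using C[of 0] L2_norm_nonneg[of "f 0"] by linarith
  have int: "(\<integral>\<^sup>+x. ennreal ((f n x)\<^sup>2) \<partial>lborel) \<le> ennreal (C\<^sup>2)" for n
  proof -
    have "(\<integral>\<^sup>+x. ennreal ((f n x)\<^sup>2) \<partial>lborel) = ennreal ((L2_norm (f n))\<^sup>2)"
      unfolding L2_norm_power2 using f by (intro nn_integral_eq_integral) (auto simp: L2_def)
    also have "\<dots> \<le> ennreal (C\<^sup>2)" using C by (intro ennreal_leI power_mono) auto
    finally show ?thesis .
  qed
  have "ennreal ((g x)\<^sup>2) = liminf (\<lambda>n. ennreal ((f n x)\<^sup>2))" for x
    by (intro lim_imp_Liminf[symmetric] tendsto_intros tendsto_ennrealI lim) auto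
  then have "(\<integral>\<^sup>+x. ennreal ((g x)\<^sup>2) \<partial>lborel) = (\<integral>\<^sup>+x. liminf (\<lambda>n. ennreal ((f n x)\<^sup>2)) \<partial>lborel)"
    by simp
  also have "\<dots> \<le> liminf (\<lambda>n. \<integral>\<^sup>+x. ennreal ((f n x)\<^sup>2) \<partial>lborel)"
    by (rule nn_integral_liminf) simp
  also have "\<dots> \<le> ennreal (C\<^sup>2)"
    by (rule order_trans[OF Liminf_le_Limsup[OF sequentially_bot] Limsup_bounded]) (simp add: int)
  finally have le: "(\<integral>\<^sup>+x. ennreal ((g x)\<^sup>2) \<partial>lborel) \<le> ennreal (C\<^sup>2)" .
  then have i: "integrable lborel (\<lambda>x. (g x)\<^sup>2)"
    by (intro integrableI_nonneg) (auto simp: top_unique less_top[symmetric])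
  then show "g \<in> L2" using mg by (simp add: L2_def)
  have "ennreal ((L2_norm g)\<^sup>2) \<le> ennreal (C\<^sup>2)"
    using le nn_integral_eq_integral[OF i] unfolding L2_norm_power2 by simp
  then show "L2_norm g \<le> C" using C0 by (simp add: ennreal_le_iff)
qed

text \<open>Elements are honest functions instead of classes modulo null sets: equality is pointwise
  (\<open>fn_eqI\<close>), and a pointwise estimate bounds both summands of the norm at once
  (\<open>norm_cl2_dominated\<close>).\<close>

typedef cl2 = "{f :: real \<Rightarrow>\<^sub>C real. apply_bcontfun f \<in> L2}"
  morphisms bc Abs_cl2
  by (rule exI[of _ 0]) (simp add: L2_def)

setup_lifting type_definition_cl2

definition fn :: "cl2 \<Rightarrow> real \<Rightarrow> real" where "fn f = apply_bcontfun (bc f)"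

instantiation cl2 :: real_vector
begin

lift_definition zero_cl2 :: cl2 is 0 by (simp add: L2_def)
lift_definition plus_cl2 :: "cl2 \<Rightarrow> cl2 \<Rightarrow> cl2" is "(+)" using L2_add(1) by (simp add: plus_bcontfun.rep_eq)
lift_definition minus_cl2 :: "cl2 \<Rightarrow> cl2 \<Rightarrow> cl2" is "(-)" using L2_diff(1) by (simp add: minus_bcontfun.rep_eq)
lift_definition uminus_cl2 :: "cl2 \<Rightarrow> cl2" is uminus
  using L2_scale[of _ "-1"] by (simp add: uminus_bcontfun.rep_eq)
lift_definition scaleR_cl2 :: "real \<Rightarrow> cl2 \<Rightarrow> cl2" is scaleR
  using L2_scale by (simp add: scaleR_bcontfun.rep_eq)

instance
  by standard (transfer, simp add: algebra_simps)+

end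

lemma bc_simps [simp]: "bc 0 = 0" "bc (f + g) = bc f + bc g" "bc (f - g) = bc f - bc g"
  "bc (- f) = - bc f" "bc (c *\<^sub>R f) = c *\<^sub>R bc f"
  by (transfer, simp)+

lemma fn_simps [simp]: "fn 0 x = 0" "fn (f + g) x = fn f x + fn g x" "fn (f - g) x = fn f x - fn g x"
  "fn (- f) x = - fn f x" "fn (c *\<^sub>R f) x = c * fn f x"
  by (simp_all add: fn_def)

lemma fn_L2: "fn f \<in> L2" using bc[of f] by (simp add: fn_def)

lemma fn_eqI: "(\<And>x. fn f x = fn g x) \<Longrightarrow> f = g"
  unfolding fn_def by (metis bc_inject bcontfun_eqI)

instantiation cl2 :: real_normed_vector
begin

definition norm_cl2 :: "cl2 \<Rightarrow> real" where "norm_cl2 f = norm (bc f) + L2_norm (fn f)"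
definition dist_cl2 :: "cl2 \<Rightarrow> cl2 \<Rightarrow> real" where "dist_cl2 f g = norm (f - g)"
definition sgn_cl2 :: "cl2 \<Rightarrow> cl2" where "sgn_cl2 f = f /\<^sub>R norm f"
definition uniformity_cl2 :: "(cl2 \<times> cl2) filter" where
  "uniformity_cl2 = (INF e\<in>{0 <..}. principal {(x, y). dist x y < e})"
definition open_cl2 :: "cl2 set \<Rightarrow> bool" where
  "open_cl2 S = (\<forall>x\<in>S. \<forall>\<^sub>F (x', y) in uniformity. x' = x \<longrightarrow> y \<in> S)"

instance
proof
  fix f g :: cl2 and c :: real
  show "(norm f = 0) = (f = 0)"
  proof
    assume "norm f = 0"
    then have "norm (bc f) = 0"
      using norm_ge_zero[of "bc f"] L2_norm_nonneg[of "fn f"] unfolding norm_cl2_def by linarith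
    then show "f = 0" using bc_inject[of f 0] by simp
  next
    assume "f = 0"
    then show "norm f = 0"
      by (simp add: norm_cl2_def L2_norm_def)
  qed
  have "fn (f + g) = (\<lambda>x. fn f x + fn g x)" by auto
  then show "norm (f + g) \<le> norm f + norm g"
    using L2_add(2)[OF fn_L2[of f] fn_L2[of g]] norm_triangle_ineq[of "bc f" "bc g"] by (simp add: norm_cl2_def)
  have "fn (c *\<^sub>R f) = (\<lambda>x. c * fn f x)" by auto
  then show "norm (c *\<^sub>R f) = \<bar>c\<bar> * norm f"
    using L2_norm_scale[of c "fn f"] by (simp add: norm_cl2_def distrib_left)
qed (auto simp: dist_cl2_def sgn_cl2_def uniformity_cl2_def open_cl2_def)

end

lemma norm_bc_le: "norm (bc f) \<le> norm f" and L2_norm_fn_le: "L2_norm (fn f) \<le> norm f"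
  by (simp_all add: norm_cl2_def)

lemma abs_fn_le: "\<bar>fn f x\<bar> \<le> norm (bc f)"
  unfolding fn_def using norm_bounded[of "bc f" x] by simp

lemma fn_cont: "continuous_on S (fn f)"
  by (simp add: fn_def)

lemma fn_meas [measurable]: "fn f \<in> borel_measurable borel"
  using fn_L2 by (auto simp: L2_def)

lemma mk_cl2:
  assumes "continuous_on UNIV f" "\<And>x. \<bar>f x\<bar> \<le> C" "f \<in> L2"
  obtains F where "fn F = f" "norm (bc F) \<le> C"
proof -
  have "f \<in> bcontfun" using assms by (intro bcontfun_normI[where b = C]) auto
  then have *: "apply_bcontfun (Bcontfun f) = f" by (rule Bcontfun_inverse)
  then have "bc (Abs_cl2 (Bcontfun f)) = Bcontfun f"
    using assms by (intro Abs_cl2_inverse) simp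
  then show thesis
    using that[of "Abs_cl2 (Bcontfun f)"] * assms(2) norm_bound[of "Bcontfun f" C] by (simp add: fn_def)
qed

instance cl2 :: banach
proof
  fix X :: "nat \<Rightarrow> cl2" assume X: "Cauchy X"
  have "Cauchy (\<lambda>n. bc (X n))"
    unfolding Cauchy_iff
  proof (intro allI impI)
    fix e :: real assume "e > 0"
    then obtain M where "\<forall>m\<ge>M. \<forall>n\<ge>M. norm (X m - X n) < e" using X unfolding Cauchy_iff by blast
    then show "\<exists>M. \<forall>m\<ge>M. \<forall>n\<ge>M. norm (bc (X m) - bc (X n)) < e"
      by (intro exI[of _ M]) (metis bc_simps(3) norm_bc_le le_less_trans)
  qed
  then obtain g where g: "(\<lambda>n. bc (X n)) \<longlonglongrightarrow> g" by (auto simp: Cauchy_convergent_iff convergent_def)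
  have lim: "(\<lambda>n. fn (X n) x) \<longlonglongrightarrow> apply_bcontfun g x" for x
    unfolding fn_def using tendsto_bcontfun_uniform_limit[OF g] by (rule tendsto_uniform_limitI) simp
  obtain B where B: "\<And>n. norm (X n) \<le> B"
    using cauchy_imp_bounded[OF X] unfolding bounded_iff by auto
  have "apply_bcontfun g \<in> L2"
    by (rule L2_Fatou(1)[OF fn_L2 order_trans[OF L2_norm_fn_le B] lim])
  then have gb: "bc (Abs_cl2 g) = g" by (intro Abs_cl2_inverse) simp
  have "X \<longlonglongrightarrow> Abs_cl2 g"
    unfolding LIMSEQ_iff
  proof (intro allI impI)
    fix e :: real assume e: "e > 0"
    then obtain M where M: "\<And>m n. m \<ge> M \<Longrightarrow> n \<ge> M \<Longrightarrow> norm (X m - X n) < e / 3"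
      using X unfolding Cauchy_iff by (metis divide_pos_pos zero_less_numeral)
    have "(\<lambda>n. norm (bc (X n) - g)) \<longlonglongrightarrow> 0"
      using g by (simp add: LIM_zero tendsto_norm_zero)
    then have "eventually (\<lambda>n. norm (bc (X n) - g) < e / 3) sequentially"
      using e by (intro order_tendstoD(2)[where y = 0]) auto
    then obtain N where N: "\<And>n. n \<ge> N \<Longrightarrow> norm (bc (X n) - g) < e / 3"
      by (auto simp: eventually_sequentially)
    show "\<exists>no. \<forall>n\<ge>no. norm (X n - Abs_cl2 g) < e"
    proof (intro exI[of _ "max M N"] allI impI)
      fix n assume n: "n \<ge> max M N"
      \<comment> \<open>The \<open>L2\<close> part of the distance comes from Fatou in the second
        index of the Cauchy condition, shifted by \<open>M\<close> so that the bound holds for every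
        \<open>m\<close>.\<close>
      have "L2_norm (fn (X n - Abs_cl2 g)) \<le> e / 3"
      proof (rule L2_Fatou(2)[where f = "\<lambda>m. fn (X n - X (m + M))"])
        show "L2_norm (fn (X n - X (m + M))) \<le> e / 3" for m
          using M[of n "m + M"] L2_norm_fn_le[of "X n - X (m + M)"] n by simp
        show "(\<lambda>m. fn (X n - X (m + M)) x) \<longlonglongrightarrow> fn (X n - Abs_cl2 g) x" for x
          unfolding fn_simps using LIMSEQ_ignore_initial_segment[OF lim[of x], of M]
          by (intro tendsto_intros) (simp add: fn_def[of "Abs_cl2 g"] gb)
      qed (rule fn_L2)
      then show "norm (X n - Abs_cl2 g) < e"
        using N[of n] n e unfolding norm_cl2_def by (simp add: gb)
    qed
  qed
  then show "convergent X" by (auto simp: convergent_def)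
qed

section \<open>The resolvent of the Laplacian\<close>

lemma has_bochner_integral_exp_abs:
  fixes s x :: real
  assumes s: "s > 0"
  shows "has_bochner_integral lborel (\<lambda>y. exp (- \<bar>y - x\<bar> / s)) (2 * s)"
proof -
  have "(\<integral>\<^sup>+y. ennreal (exp (- y / s)) * indicator {0..} y \<partial>lborel) = ennreal (0 - (- s * exp (- 0 / s)))"
  proof (rule nn_integral_FTC_atLeast)
    show "((\<lambda>y. - s * exp (- y / s)) \<longlongrightarrow> 0) at_top" using s by real_asymp
    show "((\<lambda>y. - s * exp (- y / s)) has_real_derivative exp (- y / s)) (at y)" for y
      using s by (auto intro!: derivative_eq_intros)
  qed auto
  moreover have "ennreal (exp (- y / s)) * indicator {0..} y = ennreal (indicator {0..} y * exp (- \<bar>y\<bar> / s))" for y :: real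
    by (auto simp: indicator_def)
  ultimately have "has_bochner_integral lborel (\<lambda>y. indicator {0..} y * exp (- \<bar>y\<bar> / s)) s"
    using s by (intro has_bochner_integral_nn_integral) auto
  then have "has_bochner_integral lborel (\<lambda>y. exp (- \<bar>y\<bar> / s)) (2 * s)"
    using has_bochner_integral_even_function[of "\<lambda>y. exp (- \<bar>y\<bar> / s)" s] by simp
  then show ?thesis
    using lborel_has_bochner_integral_real_affine_iff[of 1 "\<lambda>y. exp (- \<bar>y\<bar> / s)" "2 * s" "- x"]
    by simp
qed

lemma integrable_exp_abs: "s > 0 \<Longrightarrow> integrable lborel (\<lambda>y. exp (- \<bar>y - x\<bar> / s))"
  and integral_exp_abs: "s > 0 \<Longrightarrow> (LBINT y. exp (- \<bar>y - x\<bar> / s)) = 2 * s"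
  for s x :: real
  using has_bochner_integral_exp_abs has_bochner_integral_iff by blast+

lemma integrable_bounded_exp_abs:
  fixes s x C :: real
  assumes s: "s > 0" and f [measurable]: "f \<in> borel_measurable borel" and C: "\<And>y. \<bar>f y\<bar> \<le> C"
  shows "integrable lborel (\<lambda>y. f y * exp (- \<bar>y - x\<bar> / s))"
proof (rule Bochner_Integration.integrable_bound)
  show "integrable lborel (\<lambda>y. C * exp (- \<bar>y - x\<bar> / s))"
    using integrable_exp_abs[OF s] by simp
  have "C \<ge> 0" using C[of 0] by linarith
  then show "AE y in lborel. norm (f y * exp (- \<bar>y - x\<bar> / s)) \<le> norm (C * exp (- \<bar>y - x\<bar> / s))"
    using C by (auto simp: abs_mult intro!: mult_right_mono)
qed simp

lemma exp_abs_split: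
  fixes s x y :: real
  shows "y \<le> x \<Longrightarrow> exp (- \<bar>y - x\<bar> / s) = exp (- x / s) * exp (y / s)"
    and "x \<le> y \<Longrightarrow> exp (- \<bar>y - x\<bar> / s) = exp (x / s) * exp (- y / s)"
    and "y \<le> x \<Longrightarrow> exp (y / s) = exp (x / s) * exp (- \<bar>y - x\<bar> / s)"
    and "x \<le> y \<Longrightarrow> exp (- y / s) = exp (- x / s) * exp (- \<bar>y - x\<bar> / s)"
  unfolding mult_exp_exp by (simp_all add: diff_divide_distrib)

lemma exp_cancel: "exp (- x / s) * (exp (x / s) * z) = z" "exp (x / s) * (exp (- x / s) * z) = z" for x s z :: real
  by (simp_all add: mult.assoc[symmetric] mult_exp_exp)

lemma set_integrable_bounded_exp:
  fixes s C :: real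
  assumes s: "s > 0" and f [measurable]: "f \<in> borel_measurable borel" and C: "\<And>y. \<bar>f y\<bar> \<le> C"
  shows "set_integrable lborel {..<b} (\<lambda>y. f y * exp (y / s))"
    and "set_integrable lborel {b<..} (\<lambda>y. f y * exp (- y / s))"
proof -
  have *: "integrable lborel (\<lambda>y. c * (indicat_real A y * (f y * exp (- \<bar>y - b\<bar> / s))))" if [measurable]: "A \<in> sets borel" for A c
    using integrable_mult_indicator[OF _ integrable_bounded_exp_abs[OF s f C, of b], of A] that by auto
  have gen: "i *\<^sub>R (a * e) = c * (i * (a * e'))" if "e = c * e'" for i a e c e' :: real
    by (simp add: that)
  have left: "indicat_real {..<b} y *\<^sub>R (f y * exp (y / s)) = exp (b / s) * (indicat_real {..<b} y * (f y * exp (- \<bar>y - b\<bar> / s)))" for y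
    by (cases "y < b") (rule gen, rule exp_abs_split(3), simp_all)
  show "set_integrable lborel {..<b} (\<lambda>y. f y * exp (y / s))"
    unfolding set_integrable_def left by (rule *) simp
  have right: "indicat_real {b<..} y *\<^sub>R (f y * exp (- y / s)) = exp (- b / s) * (indicat_real {b<..} y * (f y * exp (- \<bar>y - b\<bar> / s)))" for y
    by (cases "y > b") (rule gen, rule exp_abs_split(4), simp_all)
  show "set_integrable lborel {b<..} (\<lambda>y. f y * exp (- y / s))"
    unfolding set_integrable_def right by (rule *) simp
qed

text \<open>Splitting at the fixed point \<open>x\<close> leaves only an integral over a bounded
  interval depending on \<open>u\<close>, where the fundamental theorem of calculus applies.\<close>

lemma DERIV_integral_halfline:
  fixes g :: "real \<Rightarrow> real"
  assumes g: "continuous_on UNIV g"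
  shows "(\<And>b. set_integrable lborel {..<b} g) \<Longrightarrow>
      ((\<lambda>u. LBINT y=-\<infinity>..ereal u. g y) has_real_derivative g x) (at x)"
    and "(\<And>b. set_integrable lborel {b<..} g) \<Longrightarrow>
      ((\<lambda>u. LBINT y=ereal u..\<infinity>. g y) has_real_derivative - g x) (at x)"
proof -
  have "((\<lambda>u. LBINT y=x..u. g y) has_vector_derivative g x) (at x within {x - 1..x + 1})"
    by (rule interval_integral_FTC2) (use g continuous_on_subset in auto)
  then have D: "((\<lambda>u. LBINT y=x..u. g y) has_real_derivative g x) (at x)"
    by (simp add: has_real_derivative_iff_has_vector_derivative at_within_Icc_at)
  {
    assume i: "\<And>b. set_integrable lborel {..<b} g"
    have "(LBINT y=-\<infinity>..ereal u. g y) = (LBINT y=-\<infinity>..ereal x. g y) + (LBINT y=x..u. g y)" for u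
    proof (rule interval_integral_sum[symmetric])
      have "min (- \<infinity>) (min (ereal x) (ereal u)) = - \<infinity>" "max (- \<infinity>) (max (ereal x) (ereal u)) = ereal (max x u)"
        by (auto simp: max_def)
      then show "interval_lebesgue_integrable lborel (min (- \<infinity>) (min (ereal x) (ereal u))) (max (- \<infinity>) (max (ereal x) (ereal u))) g"
        unfolding interval_lebesgue_integrable_def using i[of "max x u"] by (simp only: einterval_eq) simp
    qed
    then have eq: "(\<lambda>u. LBINT y=-\<infinity>..ereal u. g y) = (\<lambda>u. (LBINT y=-\<infinity>..ereal x. g y) + (LBINT y=x..u. g y))"
      by (rule ext)
    show "((\<lambda>u. LBINT y=-\<infinity>..ereal u. g y) has_real_derivative g x) (at x)"
      by (subst eq) (auto intro!: derivative_eq_intros D)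
  }
  {
    assume i: "\<And>b. set_integrable lborel {b<..} g"
    have "(LBINT y=x..u. g y) + (LBINT y=ereal u..\<infinity>. g y) = (LBINT y=ereal x..\<infinity>. g y)" for u
    proof (rule interval_integral_sum)
      have "min (ereal x) (min (ereal u) \<infinity>) = ereal (min x u)" "max (ereal x) (max (ereal u) \<infinity>) = \<infinity>"
        by (auto simp: min_def max_def)
      then show "interval_lebesgue_integrable lborel (min (ereal x) (min (ereal u) \<infinity>)) (max (ereal x) (max (ereal u) \<infinity>)) g"
        unfolding interval_lebesgue_integrable_def using i[of "min x u"] by (simp only: einterval_eq) simp
    qed
    then have eq: "(\<lambda>u. LBINT y=ereal u..\<infinity>. g y) = (\<lambda>u. (LBINT y=ereal x..\<infinity>. g y) - (LBINT y=x..u. g y))"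
      by (intro ext) (simp only: eq_diff_eq add.commute)
    show "((\<lambda>u. LBINT y=ereal u..\<infinity>. g y) has_real_derivative - g x) (at x)"
      by (subst eq) (auto intro!: derivative_eq_intros D)
  }
qed

text \<open>Cutting the kernel at \<open>x\<close> removes \<open>x\<close> from the integrands. It
  survives only in explicit exponentials and in the limits of integration, which makes the formula
  differentiable in \<open>x\<close> and computable from antiderivatives.\<close>

lemma resolvent_eq_halfline:
  assumes h: "h > 0" and f [measurable]: "f \<in> borel_measurable borel" and C: "\<And>y. \<bar>f y\<bar> \<le> C"
  shows "resolvent h f x = 1 / (2 * sqrt h) * (exp (- x / sqrt h) * (LBINT y=-\<infinity>..ereal x. f y * exp (y / sqrt h))
      + exp (x / sqrt h) * (LBINT y=ereal x..\<infinity>. f y * exp (- y / sqrt h)))"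
proof -
  define s where "s = sqrt h"
  have s: "s > 0" using h by (simp add: s_def)
  let ?g = "\<lambda>y. f y * exp (- \<bar>y - x\<bar> / s)"
  have UN: "einterval (- \<infinity>) \<infinity> = UNIV" by (auto simp: einterval_def)
  have "(LBINT y. ?g y) = (LBINT y=-\<infinity>..\<infinity>. ?g y)"
    by (simp add: interval_lebesgue_integral_le_eq UN set_lebesgue_integral_def)
  also have "\<dots> = (LBINT y=-\<infinity>..ereal x. ?g y) + (LBINT y=ereal x..\<infinity>. ?g y)"
    by (rule interval_integral_sum[symmetric])
      (use integrable_bounded_exp_abs[OF s f C, of x] in \<open>simp add: interval_lebesgue_integrable_def set_integrable_def\<close>)
  also have "(LBINT y=-\<infinity>..ereal x. ?g y) = (LBINT y=-\<infinity>..ereal x. exp (- x / s) * (f y * exp (y / s)))"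
  proof (rule interval_integral_cong)
    fix y assume "y \<in> einterval (min (- \<infinity>) (ereal x)) (max (- \<infinity>) (ereal x))"
    then have "y \<le> x" by (auto simp: einterval_def)
    show "?g y = exp (- x / s) * (f y * exp (y / s))"
      unfolding exp_abs_split(1)[OF \<open>y \<le> x\<close>] by (rule mult.left_commute)
  qed
  also have "(LBINT y=ereal x..\<infinity>. ?g y) = (LBINT y=ereal x..\<infinity>. exp (x / s) * (f y * exp (- y / s)))"
  proof (rule interval_integral_cong)
    fix y assume "y \<in> einterval (min (ereal x) \<infinity>) (max (ereal x) \<infinity>)"
    then have "x \<le> y" by (auto simp: einterval_def)
    show "?g y = exp (x / s) * (f y * exp (- y / s))"
      unfolding exp_abs_split(2)[OF \<open>x \<le> y\<close>] by (rule mult.left_commute)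
  qed
  finally show ?thesis by (simp add: resolvent_def s_def)
qed

lemma resolvent_const: "h > 0 \<Longrightarrow> resolvent h (\<lambda>_. c) x = c"
  using integral_exp_abs[of "sqrt h" x] by (simp add: resolvent_def)

lemma resolvent_add:
  assumes h: "h > 0" and f: "f \<in> borel_measurable borel" "\<And>y. \<bar>f y\<bar> \<le> C" and g: "g \<in> borel_measurable borel" "\<And>y. \<bar>g y\<bar> \<le> C'"
  shows "resolvent h (\<lambda>y. f y + g y) x = resolvent h f x + resolvent h g x"
  using integrable_bounded_exp_abs[OF _ f, of "sqrt h" x] integrable_bounded_exp_abs[OF _ g, of "sqrt h" x] h
  by (simp add: resolvent_def distrib_right add_divide_distrib)

lemma resolvent_scale: "resolvent h (\<lambda>y. c * f y) x = c * resolvent h f x"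
  by (simp add: resolvent_def mult.assoc)

lemma resolvent_mono:
  assumes h: "h > 0" and f: "f \<in> borel_measurable borel" "\<And>y. \<bar>f y\<bar> \<le> C" and g: "g \<in> borel_measurable borel" "\<And>y. \<bar>g y\<bar> \<le> C'"
    and le: "\<And>y. f y \<le> g y"
  shows "resolvent h f x \<le> resolvent h g x"
  unfolding resolvent_def
  using integrable_bounded_exp_abs[OF _ f, of "sqrt h" x] integrable_bounded_exp_abs[OF _ g, of "sqrt h" x] h le
  by (intro mult_left_mono integral_mono mult_right_mono) auto

lemma resolvent_abs_le:
  assumes h: "h > 0" and f: "f \<in> borel_measurable borel" "\<And>y. \<bar>f y\<bar> \<le> C"
  shows "\<bar>resolvent h f x\<bar> \<le> resolvent h (\<lambda>y. \<bar>f y\<bar>) x" "\<bar>resolvent h f x\<bar> \<le> C"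
proof -
  have m: "(\<lambda>y. \<bar>f y\<bar>) \<in> borel_measurable borel" "(\<lambda>y. - f y) \<in> borel_measurable borel" using f by auto
  have "resolvent h f x \<le> resolvent h (\<lambda>y. \<bar>f y\<bar>) x"
    by (rule resolvent_mono[where C = C and C' = C]) (use h f m in auto)
  moreover have "resolvent h (\<lambda>y. (-1) * f y) x \<le> resolvent h (\<lambda>y. \<bar>f y\<bar>) x"
    by (rule resolvent_mono[where C = C and C' = C]) (use h f m in auto)
  ultimately show 1: "\<bar>resolvent h f x\<bar> \<le> resolvent h (\<lambda>y. \<bar>f y\<bar>) x"
    unfolding resolvent_scale by linarith
  have "resolvent h (\<lambda>y. \<bar>f y\<bar>) x \<le> resolvent h (\<lambda>_. C) x"
    by (rule resolvent_mono[where C = C and C' = "\<bar>C\<bar>"]) (use h f m in auto)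
  with 1 show "\<bar>resolvent h f x\<bar> \<le> C" using resolvent_const[OF h] by simp
qed

text \<open>The function \<open>u = resolvent h f\<close> solves \<open>u - h u'' = f\<close>. The
  bound on \<open>u'\<close> allows \<open>u\<close> itself to be fed into
  \<open>resolvent_inverse\<close>.\<close>

lemma resolvent_ode:
  assumes h: "h > 0" and f: "continuous_on UNIV f" and C: "\<And>y. \<bar>f y\<bar> \<le> C"
  obtains u' where
    "\<And>x. (resolvent h f has_real_derivative u' x) (at x)"
    "\<And>x. (u' has_real_derivative (resolvent h f x - f x) / h) (at x)"
    "\<And>x. \<bar>u' x\<bar> \<le> C / sqrt h"
proof -
  define s where "s = sqrt h"
  have s: "s > 0" and hs: "h = s * s" using h by (simp_all add: s_def)
  have m [measurable]: "f \<in> borel_measurable borel" using f by (rule borel_measurable_continuous_onI)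
  define J where "J x = (LBINT y=-\<infinity>..ereal x. f y * exp (y / s))" for x
  define Q where "Q x = (LBINT y=ereal x..\<infinity>. f y * exp (- y / s))" for x
  have dJ: "(J has_real_derivative f x * exp (x / s)) (at x)" for x
    unfolding J_def by (rule DERIV_integral_halfline(1))
      (use s in \<open>auto intro!: continuous_intros f set_integrable_bounded_exp(1)[OF s m C]\<close>)
  have dQ: "(Q has_real_derivative - (f x * exp (- x / s))) (at x)" for x
    unfolding Q_def
  proof (rule DERIV_integral_halfline(2)[where g = "\<lambda>y. f y * exp (- y / s)"])
    show "continuous_on UNIV (\<lambda>y. f y * exp (- y / s))" using s by (auto intro!: continuous_intros f)
  qed (rule set_integrable_bounded_exp(2)[OF s m C])
  have u: "resolvent h f = (\<lambda>x. 1 / (2 * s) * (exp (- x / s) * J x + exp (x / s) * Q x))"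
    unfolding J_def Q_def s_def by (rule ext, rule resolvent_eq_halfline[OF h m C])
  define u' where "u' x = 1 / (2 * s * s) * (exp (x / s) * Q x - exp (- x / s) * J x)" for x
  have ex: "exp (x / s) * exp (- x / s) = 1" for x by (simp flip: exp_add)
  have "(resolvent h f has_real_derivative 1 / (2 * s) *
       ((- 1 / s * exp (- x / s) * J x + exp (- x / s) * (f x * exp (x / s))) +
        (1 / s * exp (x / s) * Q x + exp (x / s) * (- (f x * exp (- x / s)))))) (at x)" for x
    unfolding u using s by (auto intro!: derivative_eq_intros dJ dQ simp: field_simps)
  \<comment> \<open>Differentiating the limits of integration contributes \<open>f x\<close> and
    \<open>- f x\<close>, which cancel here; in the second derivative they add up to the term
    \<open>- f x / h\<close>.\<close>
  moreover have "1 / (2 * s) *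
       ((- 1 / s * exp (- x / s) * J x + exp (- x / s) * (f x * exp (x / s))) +
        (1 / s * exp (x / s) * Q x + exp (x / s) * (- (f x * exp (- x / s))))) = u' x" for x
    unfolding u'_def using s by (simp add: field_simps)
  ultimately have 1: "(resolvent h f has_real_derivative u' x) (at x)" for x by simp
  have "(u' has_real_derivative 1 / (2 * s * s) *
       ((1 / s * exp (x / s) * Q x + exp (x / s) * (- (f x * exp (- x / s)))) -
        (- 1 / s * exp (- x / s) * J x + exp (- x / s) * (f x * exp (x / s))))) (at x)" for x
    unfolding u'_def using s by (auto intro!: derivative_eq_intros dJ dQ simp: field_simps)
  moreover have "1 / (2 * s * s) *
       ((1 / s * exp (x / s) * Q x + exp (x / s) * (- (f x * exp (- x / s)))) -
        (- 1 / s * exp (- x / s) * J x + exp (- x / s) * (f x * exp (x / s)))) = (resolvent h f x - f x) / h" for x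
  proof -
    have "exp (x / s) * (- (f x * exp (- x / s))) = - f x" "exp (- x / s) * (f x * exp (x / s)) = f x"
      using ex[of x] by (simp_all add: mult_ac)
    moreover have "1 / (2 * s * s) * ((1 / s * a * q + (- z)) - (- 1 / s * b * j + z)) = (1 / (2 * s) * (b * j + a * q) - z) / (s * s)"
      for a b q j z
      using s by (simp add: field_simps)
    ultimately show ?thesis unfolding fun_cong[OF u] by (simp only: hs)
  qed
  ultimately have 2: "(u' has_real_derivative (resolvent h f x - f x) / h) (at x)" for x by simp
  have 3: "\<bar>u' x\<bar> \<le> C / sqrt h" for x
  proof -
    \<comment> \<open>Up to the factor \<open>1 / s\<close>, \<open>u'\<close> is the resolvent of \<open>f\<close> with its sign changed to the left of \<open>x\<close>.\<close>
    define fx where "fx y = (if y < x then - f y else f y)" for y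
    have fx: "fx \<in> borel_measurable borel" "\<bar>fx y\<bar> \<le> C" for y using C by (auto simp: fx_def[abs_def])
    have "(LBINT y=-\<infinity>..ereal x. fx y * exp (y / s)) = (LBINT y=-\<infinity>..ereal x. - (f y * exp (y / s)))"
      "(LBINT y=ereal x..\<infinity>. fx y * exp (- y / s)) = (LBINT y=ereal x..\<infinity>. f y * exp (- y / s))"
      by (rule interval_integral_cong, auto simp: einterval_def fx_def)+
    then have "resolvent h fx x = 1 / (2 * s) * (exp (- x / s) * (- J x) + exp (x / s) * Q x)"
      using resolvent_eq_halfline[OF h fx, of x]
      unfolding J_def Q_def s_def interval_lebesgue_integral_uminus by simp
    then have "u' x = resolvent h fx x / s" using s by (simp add: u'_def)
    then show ?thesis using resolvent_abs_le(2)[OF h fx, of x] s by (simp add: s_def divide_right_mono)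
  qed
  from 1 2 3 show thesis by (rule that)
qed

text \<open>The half-line integrands have the antiderivatives
  \<open>exp (y / s) * (s * g y - h * g' y)\<close> and
  \<open>- exp (- y / s) * (s * g y + h * g' y)\<close>, which vanish at infinity because
  \<open>g\<close> and \<open>g'\<close> are bounded; in the sum the terms with \<open>g'\<close>
  cancel. It is applied to the initial value and, for the resolvent identity, to values of the
  resolvent.\<close>

lemma resolvent_inverse:
  assumes h: "h > 0" and g1: "\<And>x. (g has_real_derivative g' x) (at x)" and g2: "\<And>x. (g' has_real_derivative g'' x) (at x)"
    and cont: "continuous_on UNIV g''" and bd: "\<And>x. \<bar>g x\<bar> \<le> C" "\<And>x. \<bar>g' x\<bar> \<le> C'" "\<And>x. \<bar>g'' x\<bar> \<le> C''"
  shows "resolvent h (\<lambda>x. g x - h * g'' x) x = g x"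
proof -
  define s where "s = sqrt h"
  have s: "s > 0" and hs: "h = s * s" using h by (simp_all add: s_def)
  have cg: "continuous_on UNIV g" using g1 by (auto intro!: DERIV_continuous_on)
  define f where "f x = g x - h * g'' x" for x
  have cf: "continuous_on UNIV f" unfolding f_def by (intro continuous_intros cg cont)
  have m: "f \<in> borel_measurable borel" using cf by (rule borel_measurable_continuous_onI)
  have fC: "\<bar>f x\<bar> \<le> C + h * C''" for x
  proof -
    have "\<bar>f x\<bar> \<le> \<bar>g x\<bar> + h * \<bar>g'' x\<bar>" unfolding f_def using h abs_triangle_ineq4[of "g x" "h * g'' x"] by (simp add: abs_mult)
    also have "\<dots> \<le> C + h * C''" using h bd by (intro add_mono mult_left_mono) auto
    finally show ?thesis .
  qed
  have bd': "\<bar>s * g x + c * g' x\<bar> \<le> s * C + \<bar>c\<bar> * C'" for c x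
  proof -
    have "\<bar>s * g x + c * g' x\<bar> \<le> s * \<bar>g x\<bar> + \<bar>c\<bar> * \<bar>g' x\<bar>"
      using s abs_triangle_ineq[of "s * g x" "c * g' x"] by (simp add: abs_mult)
    also have "\<dots> \<le> s * C + \<bar>c\<bar> * C'" using s bd by (intro add_mono mult_left_mono) auto
    finally show ?thesis .
  qed
  have isC: "isCont F x" if "continuous_on UNIV F" for F :: "real \<Rightarrow> real" and x
    using that by (simp add: continuous_on_eq_continuous_at)
  have dl: "((\<lambda>y. exp (y / s) * (s * g y + (- h) * g' y)) has_real_derivative f y * exp (y / s)) (at y)" for y
    unfolding f_def hs using s by (auto intro!: derivative_eq_intros g1 g2 simp: field_simps)
  have dr: "((\<lambda>y. exp (- y / s) * (- (s * g y + h * g' y))) has_real_derivative f y * exp (- y / s)) (at y)" for y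
    unfolding f_def hs using s by (auto intro!: derivative_eq_intros g1 g2 simp: field_simps)
  have left: "(LBINT y=-\<infinity>..ereal x. f y * exp (y / s)) = exp (x / s) * (s * g x + (- h) * g' x) - 0"
  proof (rule interval_integral_FTC_integrable[where F = "\<lambda>y. exp (y / s) * (s * g y + (- h) * g' y)"])
    show "((\<lambda>y. exp (y / s) * (s * g y + (- h) * g' y)) has_vector_derivative f y * exp (y / s)) (at y)" for y
      using dl by (simp add: has_real_derivative_iff_has_vector_derivative)
    show "isCont (\<lambda>y. f y * exp (y / s)) y" for y
      by (intro isC continuous_intros cf) (use s in auto)
    show "set_integrable lborel (einterval (- \<infinity>) (ereal x)) (\<lambda>y. f y * exp (y / s))"
      unfolding einterval_eq by (rule set_integrable_bounded_exp[OF s m fC])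
    show "(((\<lambda>y. exp (y / s) * (s * g y + - h * g' y)) \<circ> real_of_ereal) \<longlongrightarrow> 0) (at_right (- \<infinity>))"
      unfolding ereal_tendsto_simps
    proof (rule Lim_null_comparison)
      show "((\<lambda>y. exp (y / s) * (s * C + h * C')) \<longlongrightarrow> 0) at_bot"
        by (rule tendsto_mult_left_zero) (use s in real_asymp)
      show "eventually (\<lambda>y. norm (exp (y / s) * (s * g y + - h * g' y)) \<le> exp (y / s) * (s * C + h * C')) at_bot"
        unfolding real_norm_def abs_mult abs_exp_cancel
        using bd'[of _ "- h"] h by (intro always_eventually allI mult_left_mono) auto
    qed
    show "(((\<lambda>y. exp (y / s) * (s * g y + - h * g' y)) \<circ> real_of_ereal) \<longlongrightarrow> exp (x / s) * (s * g x + - h * g' x)) (at_left (ereal x))"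
      unfolding ereal_tendsto_simps
      using DERIV_isCont[OF dl, of x] by (simp add: isCont_def filterlim_at_split)
  qed auto
  have right: "(LBINT y=ereal x..\<infinity>. f y * exp (- y / s)) = 0 - exp (- x / s) * (- (s * g x + h * g' x))"
  proof (rule interval_integral_FTC_integrable[where F = "\<lambda>y. exp (- y / s) * (- (s * g y + h * g' y))"])
    show "((\<lambda>y. exp (- y / s) * (- (s * g y + h * g' y))) has_vector_derivative f y * exp (- y / s)) (at y)" for y
      using dr by (simp add: has_real_derivative_iff_has_vector_derivative)
    show "isCont (\<lambda>y. f y * exp (- y / s)) y" for y
      by (intro isC continuous_intros cf) (use s in auto)
    show "set_integrable lborel (einterval (ereal x) \<infinity>) (\<lambda>y. f y * exp (- y / s))"
      unfolding einterval_eq by (rule set_integrable_bounded_exp[OF s m fC])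
    show "(((\<lambda>y. exp (- y / s) * (- (s * g y + h * g' y))) \<circ> real_of_ereal) \<longlongrightarrow> 0) (at_left \<infinity>)"
      unfolding ereal_tendsto_simps
    proof (rule Lim_null_comparison)
      show "((\<lambda>y. exp (- y / s) * (s * C + h * C')) \<longlongrightarrow> 0) at_top"
        by (rule tendsto_mult_left_zero) (use s in real_asymp)
      show "eventually (\<lambda>y. norm (exp (- y / s) * (- (s * g y + h * g' y))) \<le> exp (- y / s) * (s * C + h * C')) at_top"
        unfolding real_norm_def abs_mult abs_exp_cancel abs_minus_cancel
        using bd'[of _ h] h by (intro always_eventually allI mult_left_mono) auto
    qed
    show "(((\<lambda>y. exp (- y / s) * (- (s * g y + h * g' y))) \<circ> real_of_ereal) \<longlongrightarrow> exp (- x / s) * (- (s * g x + h * g' x))) (at_right (ereal x))"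
      unfolding ereal_tendsto_simps
      using DERIV_isCont[OF dr, of x] by (simp add: isCont_def filterlim_at_split)
  qed auto
  have "resolvent h f x = 1 / (2 * s) * ((s * g x + (- h) * g' x) + (s * g x + h * g' x))"
    using resolvent_eq_halfline[OF h m fC, of x] unfolding s_def[symmetric] left right diff_0_right diff_0 mult_minus_right minus_minus exp_cancel .
  also have "\<dots> = g x" using s by simp
  finally show ?thesis by (simp add: f_def[abs_def])
qed

lemma continuous_resolvent:
  assumes "h > 0" "continuous_on UNIV f" "\<And>y. \<bar>f y\<bar> \<le> C"
  shows "continuous_on UNIV (resolvent h f)"
proof -
  obtain u' where "\<And>x. (resolvent h f has_real_derivative u' x) (at x)"
    using resolvent_ode[OF assms] by metis
  then show ?thesis by (auto intro!: DERIV_continuous_on)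
qed

text \<open>The kernel is a probability density: expand the resolvent of
  \<open>(f y - c)\<^sup>2\<close>, which is nonnegative, with the constant
  \<open>c = resolvent h f x\<close>.\<close>

lemma resolvent_jensen:
  assumes h: "h > 0" and f: "f \<in> borel_measurable borel" "\<And>y. \<bar>f y\<bar> \<le> C"
  shows "(resolvent h f x)\<^sup>2 \<le> resolvent h (\<lambda>y. (f y)\<^sup>2) x"
proof -
  define c where "c = resolvent h f x"
  have m [measurable]: "f \<in> borel_measurable borel" using f by simp
  have C: "\<bar>(f y)\<^sup>2\<bar> \<le> C\<^sup>2" for y using power_mono[OF f(2)[of y] abs_ge_zero, of 2] by simp
  have 1: "\<bar>(- 2 * c) * f y\<bar> \<le> \<bar>2 * c\<bar> * C" for y
    unfolding abs_mult abs_minus_cancel using f(2) by (intro mult_left_mono) auto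
  have 2: "\<bar>(- 2 * c) * f y + c\<^sup>2\<bar> \<le> \<bar>2 * c\<bar> * C + c\<^sup>2" for y
    using 1[of y] abs_triangle_ineq[of "(- 2 * c) * f y" "c\<^sup>2"] by simp
  have 3: "\<bar>(f y)\<^sup>2 + ((- 2 * c) * f y + c\<^sup>2)\<bar> \<le> C\<^sup>2 + (\<bar>2 * c\<bar> * C + c\<^sup>2)" for y
    using C[of y] 2[of y] abs_triangle_ineq[of "(f y)\<^sup>2" "(- 2 * c) * f y + c\<^sup>2"] by linarith
  have sq: "(f y)\<^sup>2 + ((- 2 * c) * f y + c\<^sup>2) = (f y - c)\<^sup>2" for y by (simp add: power2_diff)
  have "resolvent h (\<lambda>_. 0) x \<le> resolvent h (\<lambda>y. (f y)\<^sup>2 + ((- 2 * c) * f y + c\<^sup>2)) x"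
  proof (rule resolvent_mono[OF h _ _ _ 3, where C = 0])
    show "0 \<le> (f y)\<^sup>2 + ((- 2 * c) * f y + c\<^sup>2)" for y unfolding sq by simp
  qed auto
  also have "\<dots> = resolvent h (\<lambda>y. (f y)\<^sup>2) x + resolvent h (\<lambda>y. (- 2 * c) * f y + c\<^sup>2) x"
    by (rule resolvent_add[OF h _ C _ 2]) auto
  also have "resolvent h (\<lambda>y. (- 2 * c) * f y + c\<^sup>2) x = resolvent h (\<lambda>y. (- 2 * c) * f y) x + resolvent h (\<lambda>y. c\<^sup>2) x"
    by (rule resolvent_add[OF h _ 1, where C' = "c\<^sup>2"]) auto
  also have "\<dots> = - (c\<^sup>2)" unfolding resolvent_scale resolvent_const[OF h] c_def by (simp add: power2_eq_square)
  finally show ?thesis unfolding resolvent_const[OF h] by (simp add: c_def)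
qed

text \<open>After Jensen, Tonelli's theorem and the symmetry of the kernel, whose mass is 1, return
  the integral of the square of \<open>f\<close>.\<close>

lemma resolvent_L2:
  assumes h: "h > 0" and f: "continuous_on UNIV f" "\<And>y. \<bar>f y\<bar> \<le> C" and L2: "f \<in> L2"
  shows "resolvent h f \<in> L2" "L2_norm (resolvent h f) \<le> L2_norm f"
proof -
  define s where "s = sqrt h"
  have s: "s > 0" using h by (simp add: s_def)
  have m [measurable]: "f \<in> borel_measurable borel" using f(1) by (rule borel_measurable_continuous_onI)
  have mR [measurable]: "resolvent h f \<in> borel_measurable borel"
    using continuous_resolvent[OF h f] by (rule borel_measurable_continuous_onI)
  have i2: "integrable lborel (\<lambda>x. (f x)\<^sup>2)" using L2 by (simp add: L2_def)
  have C2: "\<bar>(f y)\<^sup>2\<bar> \<le> C\<^sup>2" for y using power_mono[OF f(2)[of y] abs_ge_zero, of 2] by simp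
  let ?k = "\<lambda>x y. ennreal (1 / (2 * s) * ((f y)\<^sup>2 * exp (- \<bar>y - x\<bar> / s)))"
  have "(\<integral>\<^sup>+x. ennreal ((resolvent h f x)\<^sup>2) \<partial>lborel) \<le> (\<integral>\<^sup>+x. ennreal (resolvent h (\<lambda>y. (f y)\<^sup>2) x) \<partial>lborel)"
    by (intro nn_integral_mono ennreal_leI resolvent_jensen[OF h m f(2)])
  also have "\<dots> = (\<integral>\<^sup>+x. (\<integral>\<^sup>+y. ?k x y \<partial>lborel) \<partial>lborel)"
  proof (rule nn_integral_cong)
    fix x
    have "integrable lborel (\<lambda>y. 1 / (2 * s) * ((f y)\<^sup>2 * exp (- \<bar>y - x\<bar> / s)))"
      by (rule integrable_mult_right, rule integrable_bounded_exp_abs[OF s _ C2]) simp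
    from nn_integral_eq_integral[OF this]
    show "ennreal (resolvent h (\<lambda>y. (f y)\<^sup>2) x) = (\<integral>\<^sup>+y. ?k x y \<partial>lborel)"
      using s by (simp add: resolvent_def s_def[symmetric])
  qed
  also have "\<dots> = (\<integral>\<^sup>+y. (\<integral>\<^sup>+x. ?k x y \<partial>lborel) \<partial>lborel)"
    by (rule lborel_pair.Fubini') simp
  also have "\<dots> = (\<integral>\<^sup>+y. ennreal ((f y)\<^sup>2) \<partial>lborel)"
  proof (rule nn_integral_cong)
    fix y :: real
    have sw: "\<bar>y - x\<bar> = \<bar>x - y\<bar>" for x by (rule abs_minus_commute)
    have "integrable lborel (\<lambda>x. ((f y)\<^sup>2 / (2 * s)) * exp (- \<bar>x - y\<bar> / s))"
      using integrable_exp_abs[OF s] by (intro integrable_mult_right)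
    from nn_integral_eq_integral[OF this]
    have "(\<integral>\<^sup>+x. ennreal (((f y)\<^sup>2 / (2 * s)) * exp (- \<bar>x - y\<bar> / s)) \<partial>lborel) = ennreal ((f y)\<^sup>2 / (2 * s) * (2 * s))"
      using s unfolding integral_mult_right_zero integral_exp_abs[OF s] by simp
    then show "(\<integral>\<^sup>+x. ?k x y \<partial>lborel) = ennreal ((f y)\<^sup>2)"
      unfolding sw using s by simp
  qed
  also have "\<dots> = ennreal ((L2_norm f)\<^sup>2)"
    unfolding L2_norm_power2 by (rule nn_integral_eq_integral[OF i2]) simp
  finally have le: "(\<integral>\<^sup>+x. ennreal ((resolvent h f x)\<^sup>2) \<partial>lborel) \<le> ennreal ((L2_norm f)\<^sup>2)" .
  then have i: "integrable lborel (\<lambda>x. (resolvent h f x)\<^sup>2)"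
    by (intro integrableI_nonneg) (auto simp: top_unique less_top[symmetric])
  then show "resolvent h f \<in> L2" by (simp add: L2_def)
  have "ennreal ((L2_norm (resolvent h f))\<^sup>2) \<le> ennreal ((L2_norm f)\<^sup>2)"
    using le nn_integral_eq_integral[OF i] unfolding L2_norm_power2 by simp
  then show "L2_norm (resolvent h f) \<le> L2_norm f"
    by (simp add: ennreal_le_iff)
qed

text \<open>The choice is unambiguous because \<open>fn\<close> is injective, and for
  \<open>h > 0\<close> a suitable element exists (\<open>fn_Rc\<close>).\<close>

definition Rc :: "real \<Rightarrow> cl2 \<Rightarrow> cl2" where
  "Rc h F = (SOME H. fn H = resolvent h (fn F))"

lemma
  assumes h: "h > 0"
  shows fn_Rc: "fn (Rc h F) = resolvent h (fn F)"
    and norm_bc_Rc_le: "norm (bc (Rc h F)) \<le> norm (bc F)"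
    and norm_Rc_le: "norm (Rc h F) \<le> norm F"
proof -
  note fF = fn_cont[of UNIV F] abs_fn_le[of F]
  have L: "resolvent h (fn F) \<in> L2" "L2_norm (resolvent h (fn F)) \<le> L2_norm (fn F)"
    by (rule resolvent_L2[OF h fF fn_L2])+
  obtain H where H: "fn H = resolvent h (fn F)" "norm (bc H) \<le> norm (bc F)"
    by (rule mk_cl2[OF continuous_resolvent[OF h fF] resolvent_abs_le(2)[OF h fn_meas abs_fn_le] L(1)])
  show 1: "fn (Rc h F) = resolvent h (fn F)"
    unfolding Rc_def by (rule someI[where P = "\<lambda>H. fn H = resolvent h (fn F)", OF H(1)])
  have "Rc h F = H" by (rule fn_eqI) (simp add: 1 H(1))
  then show 2: "norm (bc (Rc h F)) \<le> norm (bc F)" using H(2) by simp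
  show "norm (Rc h F) \<le> norm F" using 2 L(2) by (simp add: norm_cl2_def 1)
qed

lemma linear_Rc: assumes h: "h > 0" shows "linear (Rc h)"
proof
  have eq: "fn (F + H) = (\<lambda>x. fn F x + fn H x)" "fn (c *\<^sub>R F) = (\<lambda>x. c * fn F x)" for F H c by auto
  show "Rc h (F + H) = Rc h F + Rc h H" for F H
    by (rule fn_eqI) (simp add: fn_Rc[OF h] eq(1) resolvent_add[OF h fn_meas abs_fn_le fn_meas abs_fn_le])
  show "Rc h (c *\<^sub>R F) = c *\<^sub>R Rc h F" for c F
    by (rule fn_eqI) (simp add: fn_Rc[OF h] eq(2) resolvent_scale)
qed

text \<open>With \<open>u = Rc h F\<close> one has \<open>F = u - h u''\<close>, so the argument on
  the right is \<open>u - m u''\<close>, and \<open>resolvent_inverse\<close> with parameter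
  \<open>m\<close> gives back \<open>u\<close>.\<close>

lemma Rc_identity:
  assumes h: "h > 0" and m: "m > 0"
  shows "Rc h F = Rc m ((m / h) *\<^sub>R F + (1 - m / h) *\<^sub>R Rc h F)"
proof (rule fn_eqI)
  fix x
  obtain u' where u: "\<And>x. (resolvent h (fn F) has_real_derivative u' x) (at x)"
    "\<And>x. (u' has_real_derivative (resolvent h (fn F) x - fn F x) / h) (at x)" "\<And>x. \<bar>u' x\<bar> \<le> norm (bc F) / sqrt h"
    using resolvent_ode[OF h fn_cont abs_fn_le[of F]] by metis
  let ?g'' = "\<lambda>x. (resolvent h (fn F) x - fn F x) / h"
  have b: "\<bar>resolvent h (fn F) x\<bar> \<le> norm (bc F)" for x by (rule resolvent_abs_le[OF h fn_meas abs_fn_le])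
  have b2: "\<bar>?g'' x\<bar> \<le> 2 * norm (bc F) / h" for x
    unfolding abs_divide using b[of x] abs_fn_le[of F x] h by (intro frac_le) auto
  have cg: "continuous_on UNIV ?g''"
    using h by (intro continuous_intros continuous_resolvent[OF h fn_cont abs_fn_le] fn_cont) auto
  have eq: "fn ((m / h) *\<^sub>R F + (1 - m / h) *\<^sub>R Rc h F) = (\<lambda>x. resolvent h (fn F) x - m * ?g'' x)"
    using h by (auto simp: fn_Rc[OF h] field_simps)
  show "fn (Rc h F) x = fn (Rc m ((m / h) *\<^sub>R F + (1 - m / h) *\<^sub>R Rc h F)) x"
    unfolding fn_Rc[OF h] fn_Rc[OF m] eq by (rule resolvent_inverse[OF m u(1,2) cg b u(3) b2, symmetric])
qed

text \<open>Near \<open>x\<close> uniform continuity makes the integrand small. Away from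
  \<open>x\<close> one half of the exponent yields the vanishing factor
  \<open>exp (- d / (2 * sqrt h))\<close>, while the other half keeps the majorant
  integrable.\<close>

lemma resolvent_approx_uniform:
  assumes v: "uniformly_continuous_on UNIV v" and C: "\<And>y. \<bar>v y\<bar> \<le> C" and e: "e > 0"
  shows "eventually (\<lambda>h. \<forall>x. \<bar>resolvent h v x - v x\<bar> \<le> e) (at_right 0)"
proof -
  obtain d where d: "d > 0" and vd: "\<And>x y. \<bar>y - x\<bar> < d \<Longrightarrow> \<bar>v y - v x\<bar> \<le> e / 2"
    using v e unfolding uniformly_continuous_on_def dist_real_def
    by (metis UNIV_I half_gt_zero less_imp_le)
  have C0: "C \<ge> 0" using C[of 0] by linarith
  have m [measurable]: "v \<in> borel_measurable borel"
    using v uniformly_continuous_imp_continuous borel_measurable_continuous_onI by blast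
  have "((\<lambda>h. 4 * C * exp (- d / (2 * sqrt h))) \<longlongrightarrow> 4 * C * 0) (at_right 0)"
    by (intro tendsto_mult tendsto_const) (use d in real_asymp)
  then have "eventually (\<lambda>h. 4 * C * exp (- d / (2 * sqrt h)) < e / 2) (at_right 0)"
    using e by (intro order_tendstoD(2)[where y = "4 * C * 0"]) auto
  moreover have "eventually (\<lambda>h::real. h > 0) (at_right 0)" by (simp add: eventually_at_right_less)
  ultimately show ?thesis
  proof eventually_elim
    case (elim h)
    define s where "s = sqrt h"
    have s: "s > 0" "2 * s > 0" using elim by (simp_all add: s_def)
    show ?case
    proof
      fix x
      let ?E = "\<lambda>y. e / 2 * exp (- \<bar>y - x\<bar> / s) + 2 * C * exp (- d / (2 * s)) * exp (- \<bar>y - x\<bar> / (2 * s))"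
      have w: "\<bar>v y - v x\<bar> \<le> 2 * C" "\<bar>\<bar>v y - v x\<bar>\<bar> \<le> 2 * C" for y using C[of x] C[of y] by linarith+
      have le: "\<bar>v y - v x\<bar> * exp (- \<bar>y - x\<bar> / s) \<le> ?E y" for y
      proof (cases "\<bar>y - x\<bar> < d")
        case True
        then have "\<bar>v y - v x\<bar> * exp (- \<bar>y - x\<bar> / s) \<le> e / 2 * exp (- \<bar>y - x\<bar> / s)"
          using vd by (intro mult_right_mono) auto
        then show ?thesis using C0 by (simp add: add_increasing2)
      next
        case False
        then have "- \<bar>y - x\<bar> / s \<le> - d / (2 * s) + - \<bar>y - x\<bar> / (2 * s)" using s by (simp add: field_simps)
        then have "exp (- \<bar>y - x\<bar> / s) \<le> exp (- d / (2 * s)) * exp (- \<bar>y - x\<bar> / (2 * s))"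
          unfolding mult_exp_exp by simp
        then have "\<bar>v y - v x\<bar> * exp (- \<bar>y - x\<bar> / s) \<le> 2 * C * (exp (- d / (2 * s)) * exp (- \<bar>y - x\<bar> / (2 * s)))"
          using w C0 by (intro mult_mono) auto
        then show ?thesis using e by (simp add: add_increasing mult.assoc)
      qed
      have iE: "integrable lborel ?E" using s by (intro Bochner_Integration.integrable_add integrable_mult_right integrable_exp_abs)
      have "resolvent h (\<lambda>y. v y + (- v x)) x = resolvent h v x + resolvent h (\<lambda>_. - v x) x"
        by (rule resolvent_add[where C = C and C' = C]) (use elim C in auto)
      then have "\<bar>resolvent h v x - v x\<bar> = \<bar>resolvent h (\<lambda>y. v y - v x) x\<bar>"
        using resolvent_const[of h "- v x" x] elim by simp
      also have "\<dots> \<le> resolvent h (\<lambda>y. \<bar>v y - v x\<bar>) x"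
        by (rule resolvent_abs_le(1)[OF _ _ w(1)]) (use elim in auto)
      also have "\<dots> \<le> 1 / (2 * s) * (LBINT y. ?E y)"
        unfolding resolvent_def s_def[symmetric]
        by (intro mult_left_mono integral_mono le iE integrable_bounded_exp_abs[OF s(1) _ w(2)]) (use s in auto)
      also have "(LBINT y. ?E y) = (LBINT y. e / 2 * exp (- \<bar>y - x\<bar> / s)) +
          (LBINT y. 2 * C * exp (- d / (2 * s)) * exp (- \<bar>y - x\<bar> / (2 * s)))"
        by (intro Bochner_Integration.integral_add integrable_mult_right integrable_exp_abs s)
      also have "\<dots> = e / 2 * (2 * s) + 2 * C * exp (- d / (2 * s)) * (2 * (2 * s))"
        by (simp only: integral_mult_right_zero integral_exp_abs[OF s(1)] integral_exp_abs[OF s(2)])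
      also have "1 / (2 * s) * \<dots> = e / 2 + 4 * C * exp (- d / (2 * s))"
        using s by (simp add: field_simps)
      also have "\<dots> \<le> e" using elim by (simp add: s_def)
      finally show "\<bar>resolvent h v x - v x\<bar> \<le> e" .
    qed
  qed
qed

text \<open>The supremum part is uniform convergence. For the \<open>L2\<close> part, pointwise
  convergence together with the contraction property forces norm convergence, an instance of the
  Radon-Riesz property, obtained from Scheffe's lemma and the parallelogram law.\<close>

lemma Rc_approx:
  assumes v: "uniformly_continuous_on UNIV (fn v)" and e: "e > 0"
  shows "\<exists>h>0. norm (Rc h v - v) \<le> e"
proof -
  define hn where "hn n = 1 / real (Suc n)" for n
  have hn: "hn n > 0" for n by (simp add: hn_def)
  have "filterlim hn (at_right 0) sequentially"
    unfolding hn_def by real_asymp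
  then have sup: "eventually (\<lambda>n. \<forall>x. \<bar>fn (Rc (hn n) v) x - fn v x\<bar> \<le> d) sequentially" if "d > 0" for d
    using eventually_compose_filterlim[OF resolvent_approx_uniform[OF v abs_fn_le that]] by (simp add: fn_Rc hn)
  have lim: "(\<lambda>n. fn (Rc (hn n) v) x) \<longlonglongrightarrow> fn v x" for x
    unfolding tendsto_iff
  proof (intro allI impI)
    fix d :: real assume "d > 0"
    then have "eventually (\<lambda>n. \<forall>x. \<bar>fn (Rc (hn n) v) x - fn v x\<bar> \<le> d / 2) sequentially" by (intro sup) simp
    then show "eventually (\<lambda>n. dist (fn (Rc (hn n) v) x) (fn v x) < d) sequentially"
    proof eventually_elim
      case (elim n)
      then show ?case using elim[rule_format, of x] \<open>d > 0\<close> unfolding dist_real_def by linarith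
    qed
  qed
  have nR: "L2_norm (fn (Rc (hn n) v)) \<le> L2_norm (fn v)" for n
    using resolvent_L2(2)[OF hn fn_cont abs_fn_le fn_L2] by (simp add: fn_Rc hn)
  \<comment> \<open>Scheffe's lemma is applied to the squares of \<open>Rc (hn n) v + v\<close> and
    of its limit \<open>2 v\<close>; contractivity supplies the limsup condition.\<close>
  let ?F = "\<lambda>n x. (fn (Rc (hn n) v + v) x)\<^sup>2"
  let ?f = "\<lambda>x. (fn (2 *\<^sub>R v) x)\<^sup>2"
  have i: "integrable lborel (\<lambda>x. (fn u x)\<^sup>2)" for u using fn_L2[of u] by (simp add: L2_def)
  have nn: "(\<integral>\<^sup>+x. norm ((fn u x)\<^sup>2) \<partial>lborel) = ennreal ((L2_norm (fn u))\<^sup>2)" for u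
    unfolding L2_norm_power2 using nn_integral_eq_integral[OF i[of u]] by simp
  have n2: "L2_norm (fn (2 *\<^sub>R v)) = 2 * L2_norm (fn v)"
    using L2_norm_scale[of 2 "fn v"] by (simp add: fn_simps(5)[abs_def])
  have "(\<lambda>n. \<integral>\<^sup>+x. norm (?F n x - ?f x) \<partial>lborel) \<longlonglongrightarrow> 0"
  proof (rule Scheffe_lemma1)
    show "AE x in lborel. (\<lambda>n. ?F n x) \<longlonglongrightarrow> ?f x"
    proof (rule AE_I2)
      fix x
      have "(\<lambda>n. ?F n x) \<longlonglongrightarrow> (fn v x + fn v x)\<^sup>2" unfolding fn_simps by (intro tendsto_intros lim)
      then show "(\<lambda>n. ?F n x) \<longlonglongrightarrow> ?f x" by simp
    qed
    have "L2_norm (fn (Rc (hn n) v + v)) \<le> L2_norm (fn (2 *\<^sub>R v))" for n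
      using L2_add(2)[OF fn_L2[of "Rc (hn n) v"] fn_L2[of v]] nR[of n] unfolding n2
      by (simp add: fn_simps(2)[abs_def])
    then show "limsup (\<lambda>n. \<integral>\<^sup>+x. norm (?F n x) \<partial>lborel) \<le> (\<integral>\<^sup>+x. norm (?f x) \<partial>lborel)"
      unfolding nn by (intro Limsup_bounded always_eventually allI ennreal_leI power_mono) auto
  qed (rule i)+
  then have "eventually (\<lambda>n. (\<integral>\<^sup>+x. norm (?F n x - ?f x) \<partial>lborel) < ennreal ((e / 2)\<^sup>2)) sequentially"
    using e by (intro order_tendstoD(2)[where y = 0]) auto
  with sup[OF half_gt_zero[OF e]] have "eventually (\<lambda>n. (\<forall>x. \<bar>fn (Rc (hn n) v) x - fn v x\<bar> \<le> e / 2) \<and>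
     (\<integral>\<^sup>+x. norm (?F n x - ?f x) \<partial>lborel) < ennreal ((e / 2)\<^sup>2)) sequentially"
    by (rule eventually_conj)
  then obtain n where n: "\<And>x. \<bar>fn (Rc (hn n) v) x - fn v x\<bar> \<le> e / 2"
    "(\<integral>\<^sup>+x. norm (?F n x - ?f x) \<partial>lborel) < ennreal ((e / 2)\<^sup>2)"
    by (auto simp: eventually_sequentially)
  define w where "w = Rc (hn n) v"
  have id: "integrable lborel (\<lambda>x. ?F n x - ?f x)" by (intro Bochner_Integration.integrable_diff i)
  have "\<bar>LBINT x. ?F n x - ?f x\<bar> \<le> (LBINT x. norm (?F n x - ?f x))"
    using integral_norm_bound[of lborel "\<lambda>x. ?F n x - ?f x"] by simp
  also have "\<dots> < (e / 2)\<^sup>2"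
    using n(2) nn_integral_eq_integral[OF integrable_norm[OF id]] e by (simp add: ennreal_less_iff)
  finally have d: "(L2_norm (fn (2 *\<^sub>R v)))\<^sup>2 - (L2_norm (fn (w + v)))\<^sup>2 \<le> (e / 2)\<^sup>2"
    using Bochner_Integration.integral_diff[OF i[of "w + v"] i[of "2 *\<^sub>R v"]] unfolding L2_norm_power2 w_def by linarith
  \<comment> \<open>Parallelogram law: since the norm of \<open>w\<close> is at most that of
    \<open>v\<close>, the squared distance is at most the squared norm of \<open>2 v\<close> minus
    that of \<open>w + v\<close>, which \<open>d\<close> makes small.\<close>
  have "(L2_norm (fn (w - v)))\<^sup>2 + (L2_norm (fn (w + v)))\<^sup>2 = (LBINT x. (fn (w - v) x)\<^sup>2 + (fn (w + v) x)\<^sup>2)"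
    unfolding L2_norm_power2 by (rule Bochner_Integration.integral_add[OF i i, symmetric])
  also have "\<dots> = (LBINT x. 2 * (fn w x)\<^sup>2 + 2 * (fn v x)\<^sup>2)"
    by (rule Bochner_Integration.integral_cong) (auto simp: power2_eq_square algebra_simps)
  also have "\<dots> = 2 * (L2_norm (fn w))\<^sup>2 + 2 * (L2_norm (fn v))\<^sup>2"
    unfolding L2_norm_power2 by (simp add: i)
  also have "\<dots> \<le> (L2_norm (fn (2 *\<^sub>R v)))\<^sup>2"
    using power_mono[OF nR[of n] L2_norm_nonneg, of 2] unfolding n2 w_def by (simp add: power_mult_distrib)
  finally have "(L2_norm (fn (w - v)))\<^sup>2 \<le> (e / 2)\<^sup>2" using d by linarith
  then have "L2_norm (fn (w - v)) \<le> e / 2" by (rule power2_le_imp_le) (use e in simp)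
  moreover have "norm (bc (w - v)) \<le> e / 2"
    by (rule norm_bound) (use n(1) in \<open>simp add: fn_def w_def\<close>)
  ultimately have "norm (w - v) \<le> e" by (simp add: norm_cl2_def)
  then show ?thesis using hn[of n] unfolding w_def by blast
qed

section \<open>The nonlinearity\<close>

lemma norm_cl2_dominated:
  assumes "\<And>x. \<bar>fn F x\<bar> \<le> C * \<bar>fn V x\<bar>" "C \<ge> 0"
  shows "norm F \<le> C * norm V"
proof -
  have "norm (bc F) \<le> C * norm (bc V)"
    by (rule norm_bound) (use assms(1) mult_left_mono[OF abs_fn_le assms(2), of V] in \<open>force simp: fn_def intro: order_trans\<close>)
  moreover have "L2_norm (fn F) \<le> C * L2_norm (fn V)"
    by (rule L2_dominated(2)[OF fn_L2 _ assms]) simp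
  ultimately show ?thesis by (simp add: norm_cl2_def distrib_left)
qed

section \<open>Real power series with a fixed majorant\<close>

lemma diffs_dominated:
  fixes c A :: "nat \<Rightarrow> real"
  assumes c: "\<And>k. \<bar>c k\<bar> \<le> A k"
  shows "\<bar>diffs c k\<bar> \<le> diffs A k"
  using c[of "Suc k"] by (simp add: diffs_def abs_mult del: of_nat_Suc)

lemma diffs_summable:
  fixes A :: "nat \<Rightarrow> real"
  assumes A: "\<forall>z. \<bar>z\<bar> < r \<longrightarrow> summable (\<lambda>k. A k * z ^ k)"
  shows "\<forall>z. \<bar>z\<bar> < r \<longrightarrow> summable (\<lambda>k. diffs A k * z ^ k)"
  using A by (auto intro!: termdiff_converges[where K = r])

lemma powser_dominated:
  fixes c A :: "nat \<Rightarrow> real"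
  assumes c: "\<And>k. \<bar>c k\<bar> \<le> A k" and A: "\<forall>z. \<bar>z\<bar> < r \<longrightarrow> summable (\<lambda>k. A k * z ^ k)"
    and \<rho>: "0 \<le> \<rho>" "\<rho> < r" and z: "\<bar>z\<bar> \<le> \<rho>"
  shows "summable (\<lambda>k. \<bar>c k * z ^ k\<bar>)" "\<bar>\<Sum>k. c k * z ^ k\<bar> \<le> (\<Sum>k. A k * \<rho> ^ k)"
proof -
  have le: "norm (c k * z ^ k) \<le> A k * \<rho> ^ k" for k
    using c[of k] power_mono[OF z abs_ge_zero, of k]
    by (auto simp: abs_mult power_abs intro!: mult_mono order_trans[OF abs_ge_zero c])
  have s: "summable (\<lambda>k. A k * \<rho> ^ k)" using \<rho> A by simp
  show "summable (\<lambda>k. \<bar>c k * z ^ k\<bar>)" "\<bar>\<Sum>k. c k * z ^ k\<bar> \<le> (\<Sum>k. A k * \<rho> ^ k)"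
    using summable_norm_comparison_test[of "\<lambda>k. c k * z ^ k" "\<lambda>k. A k * \<rho> ^ k"] le s
      norm_suminf_le[OF le s] by auto
qed

lemma powser_derivative:
  fixes c A :: "nat \<Rightarrow> real"
  assumes c: "\<And>k. \<bar>c k\<bar> \<le> A k" and A: "\<forall>z. \<bar>z\<bar> < r \<longrightarrow> summable (\<lambda>k. A k * z ^ k)"
    and z: "\<bar>z\<bar> < r"
  shows "((\<lambda>z. \<Sum>k. c k * z ^ k) has_real_derivative (\<Sum>k. diffs c k * z ^ k)) (at z)"
proof (rule termdiffs_strong'[where K = r])
  fix y :: real assume "norm y < r"
  then show "summable (\<lambda>k. c k * y ^ k)"
    using powser_dominated(1)[OF c A, of "\<bar>y\<bar>" y] by (auto intro: summable_rabs_cancel)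
qed (use z in simp)

lemma powser_lipschitz:
  fixes c A :: "nat \<Rightarrow> real"
  assumes c: "\<And>k. \<bar>c k\<bar> \<le> A k" and A: "\<forall>z. \<bar>z\<bar> < r \<longrightarrow> summable (\<lambda>k. A k * z ^ k)"
    and \<rho>: "0 \<le> \<rho>" "\<rho> < r" and yz: "\<bar>y\<bar> \<le> \<rho>" "\<bar>z\<bar> \<le> \<rho>"
  shows "\<bar>(\<Sum>k. c k * y ^ k) - (\<Sum>k. c k * z ^ k)\<bar> \<le> (\<Sum>k. diffs A k * \<rho> ^ k) * \<bar>y - z\<bar>"
proof -
  have "norm ((\<Sum>k. c k * y ^ k) - (\<Sum>k. c k * z ^ k)) \<le> (\<Sum>k. diffs A k * \<rho> ^ k) * norm (y - z)"
  proof (rule field_differentiable_bound[where S = "{- \<rho>..\<rho>}"])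
    fix t assume t: "t \<in> {- \<rho>..\<rho>}"
    show "((\<lambda>z. \<Sum>k. c k * z ^ k) has_field_derivative (\<Sum>k. diffs c k * t ^ k)) (at t within {- \<rho>..\<rho>})"
      by (rule has_field_derivative_at_within, rule powser_derivative[OF c A]) (use t \<rho> in auto)
    show "norm (\<Sum>k. diffs c k * t ^ k) \<le> (\<Sum>k. diffs A k * \<rho> ^ k)"
      using powser_dominated(2)[OF diffs_dominated[OF c] diffs_summable[OF A] \<rho>, where z = t] t by auto
  qed (use yz in auto)
  then show ?thesis by simp
qed

text \<open>Mean value inequality for \<open>P t - P' z * t\<close> on the segment from
  \<open>z\<close> to \<open>y\<close>, whose derivative \<open>P' t - P' z\<close> is controlled by
  the Lipschitz bound for \<open>P'\<close>.\<close>

lemma powser_taylor: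
  fixes c A :: "nat \<Rightarrow> real"
  assumes c: "\<And>k. \<bar>c k\<bar> \<le> A k" and A: "\<forall>z. \<bar>z\<bar> < r \<longrightarrow> summable (\<lambda>k. A k * z ^ k)"
    and \<rho>: "0 \<le> \<rho>" "\<rho> < r" and yz: "\<bar>y\<bar> \<le> \<rho>" "\<bar>z\<bar> \<le> \<rho>"
  shows "\<bar>(\<Sum>k. c k * y ^ k) - (\<Sum>k. c k * z ^ k) - (\<Sum>k. diffs c k * z ^ k) * (y - z)\<bar> \<le>
    (\<Sum>k. diffs (diffs A) k * \<rho> ^ k) * (y - z)\<^sup>2"
proof -
  define P where "P t = (\<Sum>k. c k * t ^ k)" for t
  define P' where "P' t = (\<Sum>k. diffs c k * t ^ k)" for t
  define M where "M = (\<Sum>k. diffs (diffs A) k * \<rho> ^ k)"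
  have lip: "\<bar>P' t - P' z\<bar> \<le> M * \<bar>t - z\<bar>" if "\<bar>t\<bar> \<le> \<rho>" for t
    unfolding P'_def M_def by (rule powser_lipschitz[OF diffs_dominated[OF c] diffs_summable[OF A] \<rho> that yz(2)])
  have M0: "M \<ge> 0"
    using powser_dominated(2)[OF diffs_dominated[OF diffs_dominated[OF c]]
      diffs_summable[OF diffs_summable[OF A]] \<rho>, where z = 0] \<rho>
    unfolding M_def by (auto intro: order_trans[OF abs_ge_zero])
  have "norm ((P y - P' z * y) - (P z - P' z * z)) \<le> (M * \<bar>y - z\<bar>) * norm (y - z)"
  proof (rule field_differentiable_bound[where S = "closed_segment z y"])
    fix t assume t: "t \<in> closed_segment z y"
    have t': "\<bar>t\<bar> \<le> \<rho>" "\<bar>t - z\<bar> \<le> \<bar>y - z\<bar>"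
      using t yz by (auto simp: closed_segment_eq_real_ivl split: if_splits)
    have "(P has_real_derivative P' t) (at t)"
      unfolding P_def P'_def using t' \<rho> by (intro powser_derivative[OF c A]) auto
    then show "((\<lambda>t. P t - P' z * t) has_field_derivative (P' t - P' z)) (at t within closed_segment z y)"
      by (rule has_field_derivative_at_within[OF DERIV_diff]) (auto intro!: derivative_eq_intros)
    show "norm (P' t - P' z) \<le> M * \<bar>y - z\<bar>"
      using lip[OF t'(1)] mult_left_mono[OF t'(2) M0] by simp
  qed auto
  moreover have "(P y - P' z * y) - (P z - P' z * z) = P y - P z - P' z * (y - z)"
    by (simp add: algebra_simps)
  moreover have "\<bar>y - z\<bar> * \<bar>y - z\<bar> = (y - z)\<^sup>2" by (simp add: power2_eq_square)
  ultimately show ?thesis unfolding P_def P'_def M_def by (simp add: mult.assoc)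
qed

section \<open>The superposition operator defined by \<open>G\<close>\<close>

lemma G_uniform_limit:
  assumes c: "\<And>k x. \<bar>c k x\<bar> \<le> A k" and A: "\<forall>z. \<bar>z\<bar> < r \<longrightarrow> summable (\<lambda>k. A k * z ^ k)"
    and \<rho>: "0 \<le> \<rho>" "\<rho> < r" and u: "\<And>x. \<bar>u x\<bar> \<le> \<rho>"
  shows "uniform_limit UNIV (\<lambda>n x. \<Sum>k<n. c k x * u x ^ k) (G c u) sequentially"
  unfolding G_def[abs_def]
proof (rule Weierstrass_m_test)
  show "norm (c k x * u x ^ k) \<le> A k * \<rho> ^ k" for k x
    using c[of k x] power_mono[OF u[of x] abs_ge_zero, of k]
    by (auto simp: abs_mult power_abs intro!: mult_mono order_trans[OF abs_ge_zero c])
  show "summable (\<lambda>k. A k * \<rho> ^ k)" using \<rho> A by simp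
qed

lemma continuous_G:
  assumes "\<And>k x. \<bar>c k x\<bar> \<le> A k" "\<forall>z. \<bar>z\<bar> < r \<longrightarrow> summable (\<lambda>k. A k * z ^ k)"
    and "0 \<le> \<rho>" "\<rho> < r" "\<And>x. \<bar>u x\<bar> \<le> \<rho>"
    and "\<And>k. continuous_on UNIV (c k)" "continuous_on UNIV u"
  shows "continuous_on UNIV (G c u)"
  by (rule uniform_limit_theorem[OF _ G_uniform_limit[OF assms(1-5)]])
    (auto intro!: always_eventually continuous_intros assms)

text \<open>The majorant \<open>A\<close> does not depend on \<open>x\<close>, so all estimates are
  uniform in \<open>x\<close>; \<open>\<rho>\<close> lies strictly inside \<open>r\<close> so that
  the differentiated series converge at \<open>\<rho>\<close> too. At the zero function
  \<open>G\<close> equals \<open>a 0\<close>, so \<open>a0\<close> is what brings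
  \<open>G(u)\<close> into \<open>L2\<close>: the rest is at most \<open>M1\<close> times the
  modulus of \<open>u\<close>.\<close>

locale power_nonlinearity =
  fixes a :: "nat \<Rightarrow> real \<Rightarrow> real" and A :: "nat \<Rightarrow> real" and r \<rho> :: real
  assumes cont_a: "continuous_on UNIV (a k)"
    and a_le: "\<bar>a k x\<bar> \<le> A k"
    and A: "\<forall>z. \<bar>z\<bar> < r \<longrightarrow> summable (\<lambda>k. A k * z ^ k)"
    and \<rho>: "0 \<le> \<rho>" "\<rho> < r"
    and a0: "a 0 \<in> L2"
begin

definition da :: "nat \<Rightarrow> real \<Rightarrow> real" where "da k x = diffs (\<lambda>k. a k x) k"
text \<open>For arguments with values in the interval of radius \<open>\<rho>\<close>:
  \<open>M\<close> bounds \<open>G\<close>, \<open>M1\<close> bounds its derivative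
  \<open>G da\<close>, and \<open>M2\<close> is a Lipschitz constant for that derivative.\<close>

definition M where "M = (\<Sum>k. A k * \<rho> ^ k)"
definition M1 where "M1 = (\<Sum>k. diffs A k * \<rho> ^ k)"
definition M2 where "M2 = (\<Sum>k. diffs (diffs A) k * \<rho> ^ k)"

lemma da_le: "\<bar>da k x\<bar> \<le> diffs A k"
  unfolding da_def by (rule diffs_dominated[OF a_le])

lemma dA: "\<forall>z. \<bar>z\<bar> < r \<longrightarrow> summable (\<lambda>k. diffs A k * z ^ k)"
  by (rule diffs_summable[OF A])

lemma G_le: "\<bar>u x\<bar> \<le> \<rho> \<Longrightarrow> \<bar>G a u x\<bar> \<le> M"
  using powser_dominated(2)[OF a_le A \<rho>, where z = "u x"] by (auto simp: G_def M_def)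

lemma dG_le: "\<bar>u x\<bar> \<le> \<rho> \<Longrightarrow> \<bar>G da u x\<bar> \<le> M1"
  using powser_dominated(2)[OF da_le dA \<rho>, where z = "u x"] by (auto simp: G_def M1_def)

lemma G_lip: "\<bar>u x\<bar> \<le> \<rho> \<Longrightarrow> \<bar>v x\<bar> \<le> \<rho> \<Longrightarrow> \<bar>G a u x - G a v x\<bar> \<le> M1 * \<bar>u x - v x\<bar>"
  using powser_lipschitz[OF a_le A \<rho>] by (auto simp: G_def M1_def)

lemma dG_lip: "\<bar>u x\<bar> \<le> \<rho> \<Longrightarrow> \<bar>v x\<bar> \<le> \<rho> \<Longrightarrow> \<bar>G da u x - G da v x\<bar> \<le> M2 * \<bar>u x - v x\<bar>"
  using powser_lipschitz[OF da_le dA \<rho>] by (auto simp: G_def M2_def)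

lemma G_taylor:
  assumes "\<bar>u x\<bar> \<le> \<rho>" "\<bar>v x\<bar> \<le> \<rho>"
  shows "\<bar>G a v x - G a u x - G da u x * (v x - u x)\<bar> \<le> M2 * (v x - u x)\<^sup>2"
  unfolding G_def M2_def da_def by (rule powser_taylor[OF a_le A \<rho> assms(2,1)])

lemma M_nonneg: "0 \<le> M" "0 \<le> M1" "0 \<le> M2"
proof -
  show "0 \<le> M" using G_le[of "\<lambda>_. 0" 0] \<rho> abs_ge_zero order_trans by (metis abs_zero)
  show "0 \<le> M1" using dG_le[of "\<lambda>_. 0" 0] \<rho> abs_ge_zero order_trans by (metis abs_zero)
  have "\<bar>\<Sum>k. diffs (\<lambda>k. da k 0) k * 0 ^ k\<bar> \<le> M2"
    unfolding M2_def using powser_dominated(2)[OF diffs_dominated[OF da_le] diffs_summable[OF dA] \<rho>, where z = 0] \<rho> by auto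
  then show "0 \<le> M2" by linarith
qed

lemma cont_da: "continuous_on UNIV (da k)"
  unfolding da_def[abs_def] diffs_def by (intro continuous_intros cont_a)

lemma cont_G: "continuous_on UNIV u \<Longrightarrow> (\<And>x. \<bar>u x\<bar> \<le> \<rho>) \<Longrightarrow> continuous_on UNIV (G a u)"
  by (rule continuous_G[OF a_le A \<rho> _ cont_a])

lemma cont_dG: "continuous_on UNIV u \<Longrightarrow> (\<And>x. \<bar>u x\<bar> \<le> \<rho>) \<Longrightarrow> continuous_on UNIV (G da u)"
  by (rule continuous_G[OF da_le dA \<rho> _ cont_da])

text \<open>Only the supremum norm is restricted, since the power series constrain nothing but the
  values of \<open>u\<close>. Staying in this set for a short time is then a matter of supremum
  bounds alone (\<open>euler_in_sup_ball\<close>).\<close>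

definition sup_ball :: "cl2 set" where "sup_ball = {F. norm (bc F) \<le> \<rho>}"

lemma sup_ballD: "F \<in> sup_ball \<Longrightarrow> \<bar>fn F x\<bar> \<le> \<rho>"
  using abs_fn_le[of F x] by (simp add: sup_ball_def)

definition Gc :: "cl2 \<Rightarrow> cl2" where "Gc F = (SOME H. fn H = G a (fn F))"
definition Dc :: "cl2 \<Rightarrow> cl2 \<Rightarrow> cl2" where "Dc F V = (SOME H. fn H = (\<lambda>x. G da (fn F) x * fn V x))"

lemma
  assumes F: "F \<in> sup_ball"
  shows fn_Gc: "fn (Gc F) = G a (fn F)" and norm_bc_Gc_le: "norm (bc (Gc F)) \<le> M"
proof -
  have cG: "continuous_on UNIV (G a (fn F))" by (intro cont_G fn_cont sup_ballD F)
  have mG: "G a (fn F) \<in> borel_measurable lborel"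
    using borel_measurable_continuous_onI[OF cG] by simp
  have ma: "a 0 \<in> borel_measurable borel" by (rule borel_measurable_continuous_onI[OF cont_a])
  have "(\<lambda>x. \<bar>a 0 x\<bar>) \<in> L2"
    by (rule L2_dominated(1)[OF a0, where C = 1]) (use ma in auto)
  moreover have "(\<lambda>x. \<bar>fn F x\<bar>) \<in> L2"
    by (rule L2_dominated(1)[OF fn_L2[of F], where C = 1]) auto
  ultimately have dom: "(\<lambda>x. \<bar>a 0 x\<bar> + M1 * \<bar>fn F x\<bar>) \<in> L2" by (intro L2_add L2_scale)
  have "\<bar>G a (fn F) x\<bar> \<le> 1 * \<bar>\<bar>a 0 x\<bar> + M1 * \<bar>fn F x\<bar>\<bar>" for x
  proof -
    have "G a (\<lambda>_. 0) x = a 0 x" by (simp add: G_def powser_zero)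
    then have "\<bar>G a (fn F) x - a 0 x\<bar> \<le> M1 * \<bar>fn F x\<bar>"
      using G_lip[of "fn F" x "\<lambda>_. 0"] sup_ballD[OF F] \<rho> by simp
    then show ?thesis unfolding mult_1 by linarith
  qed
  then have "G a (fn F) \<in> L2" by (rule L2_dominated(1)[OF dom mG])
  then obtain H where H: "fn H = G a (fn F)" "norm (bc H) \<le> M"
    by (rule mk_cl2[OF cG G_le[where u = "fn F", OF sup_ballD[OF F]]])
  show 1: "fn (Gc F) = G a (fn F)"
    unfolding Gc_def by (rule someI[where P = "\<lambda>H. fn H = G a (fn F)", OF H(1)])
  have "Gc F = H" by (rule fn_eqI) (simp add: 1 H(1))
  then show "norm (bc (Gc F)) \<le> M" using H(2) by simp
qed

lemma fn_Dc:
  assumes F: "F \<in> sup_ball"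
  shows "fn (Dc F V) = (\<lambda>x. G da (fn F) x * fn V x)"
proof -
  have cG: "continuous_on UNIV (\<lambda>x. G da (fn F) x * fn V x)"
    by (intro continuous_intros cont_dG fn_cont sup_ballD F)
  have le: "\<bar>G da (fn F) x * fn V x\<bar> \<le> M1 * \<bar>fn V x\<bar>" for x
    unfolding abs_mult by (intro mult_right_mono dG_le sup_ballD F) auto
  have le2: "\<bar>G da (fn F) x * fn V x\<bar> \<le> M1 * norm (bc V)" for x
    using le[of x] mult_left_mono[OF abs_fn_le M_nonneg(2), of V x] by linarith
  have "(\<lambda>x. G da (fn F) x * fn V x) \<in> L2"
    by (rule L2_dominated(1)[OF fn_L2 _ le]) (use borel_measurable_continuous_onI[OF cG] in simp)
  then obtain H where H: "fn H = (\<lambda>x. G da (fn F) x * fn V x)"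
    by (rule mk_cl2[OF cG le2])
  show ?thesis
    unfolding Dc_def by (rule someI[where P = "\<lambda>H. fn H = (\<lambda>x. G da (fn F) x * fn V x)", OF H])
qed

lemma Gc_lipschitz:
  assumes "F \<in> sup_ball" "H \<in> sup_ball"
  shows "norm (Gc F - Gc H) \<le> M1 * norm (F - H)"
proof (rule norm_cl2_dominated[OF _ M_nonneg(2)])
  show "\<bar>fn (Gc F - Gc H) x\<bar> \<le> M1 * \<bar>fn (F - H) x\<bar>" for x
    unfolding fn_simps fn_Gc[OF assms(1)] fn_Gc[OF assms(2)] by (intro G_lip sup_ballD assms)
qed

lemma linear_Dc: "F \<in> sup_ball \<Longrightarrow> linear (Dc F)"
  by (intro linearI fn_eqI) (simp_all add: fn_Dc distrib_left)

lemma norm_Dc_le: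
  assumes "F \<in> sup_ball"
  shows "norm (Dc F V) \<le> M1 * norm V"
proof (rule norm_cl2_dominated[OF _ M_nonneg(2)])
  show "\<bar>fn (Dc F V) x\<bar> \<le> M1 * \<bar>fn V x\<bar>" for x
    unfolding fn_Dc[OF assms] abs_mult by (intro mult_right_mono dG_le sup_ballD assms abs_ge_zero)
qed

lemma fn_diff_le: "\<bar>fn F x - fn H x\<bar> \<le> norm (F - H)"
  using order_trans[OF abs_fn_le norm_bc_le, of "F - H" x] by simp

lemma Dc_lipschitz:
  assumes "F \<in> sup_ball" "H \<in> sup_ball"
  shows "norm (Dc F V - Dc H V) \<le> M2 * norm (F - H) * norm V"
proof (rule norm_cl2_dominated)
  fix x
  have "\<bar>G da (fn F) x - G da (fn H) x\<bar> \<le> M2 * \<bar>fn F x - fn H x\<bar>" by (intro dG_lip sup_ballD assms)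
  also have "\<dots> \<le> M2 * norm (F - H)" by (intro mult_left_mono fn_diff_le M_nonneg)
  finally have "\<bar>G da (fn F) x - G da (fn H) x\<bar> * \<bar>fn V x\<bar> \<le> M2 * norm (F - H) * \<bar>fn V x\<bar>"
    by (intro mult_right_mono) auto
  then show "\<bar>fn (Dc F V - Dc H V) x\<bar> \<le> M2 * norm (F - H) * \<bar>fn V x\<bar>"
    by (simp add: fn_Dc assms flip: left_diff_distrib abs_mult)
qed (simp add: M_nonneg)

lemma Dc_derivative:
  assumes "F \<in> sup_ball" "H \<in> sup_ball"
  shows "norm (Gc H - Gc F - Dc F (H - F)) \<le> M2 * (norm (H - F))\<^sup>2"
proof -
  have "norm (Gc H - Gc F - Dc F (H - F)) \<le> M2 * norm (H - F) * norm (H - F)"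
  proof (rule norm_cl2_dominated)
    fix x
    have "\<bar>fn (Gc H - Gc F - Dc F (H - F)) x\<bar> \<le> M2 * (fn H x - fn F x)\<^sup>2"
      using G_taylor[where u = "fn F" and v = "fn H", OF sup_ballD[OF assms(1)] sup_ballD[OF assms(2)], of x] by (simp add: fn_Gc fn_Dc assms)
    also have "\<dots> = M2 * \<bar>fn H x - fn F x\<bar> * \<bar>fn H x - fn F x\<bar>" by (simp add: power2_eq_square)
    \<comment> \<open>One factor of the square is estimated by its supremum; the other stays
      pointwise, so that its \<open>L2\<close> norm can still be taken.\<close>
    also have "\<dots> \<le> M2 * norm (H - F) * \<bar>fn H x - fn F x\<bar>"
      by (intro mult_left_mono mult_right_mono fn_diff_le M_nonneg) auto
    finally show "\<bar>fn (Gc H - Gc F - Dc F (H - F)) x\<bar> \<le> M2 * norm (H - F) * \<bar>fn (H - F) x\<bar>" by simp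
  qed (simp add: M_nonneg)
  then show ?thesis by (simp add: power2_eq_square mult.assoc)
qed

end

section \<open>Semilinear implicit-explicit schemes in a Banach space\<close>

text \<open>
  The quadratic polynomial in \<open>t = n * h\<close>, \<open>s = m * \<mu>\<close> on the right-hand side is invariant under
  the weighted average of its values at \<open>(t - h, s)\<close> and \<open>(t, s - \<mu>)\<close>, up to the term absorbed by
  \<open>\<eta>\<close>; it dominates \<open>\<bar>t - s\<bar>\<close> because \<open>\<delta> + r\<^sup>2 / \<delta> \<ge> \<bar>r\<bar>\<close>.
\<close>

lemma double_index_bound:
  fixes a :: "nat \<Rightarrow> nat \<Rightarrow> real"
  assumes pos: "h > 0" "\<mu> > 0" "\<delta> > 0" "C \<ge> 0" "\<epsilon> \<ge> 0" "L \<ge> 0" "\<eta> \<ge> 0"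
    and rec: "\<And>n m. n < N \<Longrightarrow> m < M \<Longrightarrow> a (Suc n) (Suc m) \<le>
       \<mu> / (h + \<mu>) * a n (Suc m) + h / (h + \<mu>) * a (Suc n) m + h * \<mu> / (h + \<mu>) * (L * a n m + \<eta>)"
    and left: "\<And>n. n \<le> N \<Longrightarrow> a n 0 \<le> \<epsilon> + C * (real n * h)"
    and bot: "\<And>m. m \<le> M \<Longrightarrow> a 0 m \<le> \<epsilon> + C * (real m * \<mu>)"
  shows "n \<le> N \<Longrightarrow> m \<le> M \<Longrightarrow> a n m \<le> (1 + 2 * \<mu> * L) ^ m *
     (\<epsilon> + C * (\<delta> + ((real n * h - real m * \<mu>)\<^sup>2 + (h + \<mu>) / 2 * (real n * h + real m * \<mu>)) / \<delta>)
       + (\<eta> + 2 * C * L * h\<^sup>2 / \<delta>) * (real m * \<mu>))"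
proof -
  \<comment> \<open>The slope \<open>e\<close> in the \<open>s\<close> direction pays for
    \<open>\<eta>\<close> and for \<open>L\<close> times the remainder in
    \<open>diag\<close>.\<close>
  define e where "e = \<eta> + 2 * C * L * h\<^sup>2 / \<delta>"
  define P where "P t s = \<epsilon> + C * (\<delta> + ((t - s)\<^sup>2 + (h + \<mu>) / 2 * (t + s)) / \<delta>) + e * s" for t s
  have e0: "e \<ge> 0" using pos by (simp add: e_def)
  have P_abs: "\<epsilon> + C * \<bar>t - s\<bar> \<le> P t s" if "t \<ge> 0" "s \<ge> 0" for t s
  proof -
    have "\<bar>t - s\<bar> * \<delta> \<le> \<delta>\<^sup>2 + (t - s)\<^sup>2"
      using sum_squares_bound[of "\<bar>t - s\<bar>" \<delta>] mult_nonneg_nonneg[of "\<bar>t - s\<bar>" \<delta>] pos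
      unfolding power2_abs by argo
    moreover have "0 \<le> (h + \<mu>) / 2 * (t + s)" using that pos by simp
    moreover have "(\<delta> + Z / \<delta>) * \<delta> = \<delta>\<^sup>2 + Z" for Z
      using pos by (simp add: distrib_right power2_eq_square)
    ultimately have "\<bar>t - s\<bar> * \<delta> \<le> (\<delta> + ((t - s)\<^sup>2 + (h + \<mu>) / 2 * (t + s)) / \<delta>) * \<delta>"
      by simp
    then have "\<bar>t - s\<bar> \<le> \<delta> + ((t - s)\<^sup>2 + (h + \<mu>) / 2 * (t + s)) / \<delta>"
      using pos by simp
    then have "C * \<bar>t - s\<bar> \<le> C * (\<delta> + ((t - s)\<^sup>2 + (h + \<mu>) / 2 * (t + s)) / \<delta>)"
      using pos by (intro mult_left_mono) auto
    moreover have "0 \<le> e * s" using e0 that by simp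
    ultimately show ?thesis by (simp add: P_def)
  qed
  have avg: "\<mu> / (h + \<mu>) * P (t - h) s + h / (h + \<mu>) * P t (s - \<mu>) = P t s - h * \<mu> / (h + \<mu>) * e" for t s
  proof -
    have "\<mu> * ((t - h - s)\<^sup>2 + (h + \<mu>) / 2 * (t - h + s)) + h * ((t - (s - \<mu>))\<^sup>2 + (h + \<mu>) / 2 * (t + (s - \<mu>)))
        = (h + \<mu>) * ((t - s)\<^sup>2 + (h + \<mu>) / 2 * (t + s))"
      by (simp add: power2_eq_square field_simps)
    then have eq: "(\<mu> * ((t - h - s)\<^sup>2 + (h + \<mu>) / 2 * (t - h + s)) + h * ((t - (s - \<mu>))\<^sup>2 + (h + \<mu>) / 2 * (t + (s - \<mu>)))) / \<delta>
        = (h + \<mu>) * (((t - s)\<^sup>2 + (h + \<mu>) / 2 * (t + s)) / \<delta>)"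
      by simp
    have "\<mu> * P (t - h) s + h * P t (s - \<mu>) = (h + \<mu>) * (\<epsilon> + C * \<delta>) +
       C * ((\<mu> * ((t - h - s)\<^sup>2 + (h + \<mu>) / 2 * (t - h + s)) + h * ((t - (s - \<mu>))\<^sup>2 + (h + \<mu>) / 2 * (t + (s - \<mu>)))) / \<delta>)
       + e * (\<mu> * s + h * (s - \<mu>))"
      unfolding P_def by (simp only: add_divide_distrib ring_distribs times_divide_eq_right) (simp add: algebra_simps)
    also have "\<dots> = (h + \<mu>) * P t s - h * \<mu> * e"
      unfolding eq P_def by (simp only: ring_distribs) (simp add: algebra_simps)
    finally have *: "\<mu> * P (t - h) s + h * P t (s - \<mu>) = (h + \<mu>) * P t s - h * \<mu> * e" .
    have "\<mu> / (h + \<mu>) * P (t - h) s + h / (h + \<mu>) * P t (s - \<mu>) = (\<mu> * P (t - h) s + h * P t (s - \<mu>)) / (h + \<mu>)"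
      by (simp add: add_divide_distrib)
    also have "\<dots> = P t s - h * \<mu> / (h + \<mu>) * e"
      unfolding * using pos by (simp add: diff_divide_distrib)
    finally show ?thesis .
  qed
  \<comment> \<open>The Lipschitz term of the recurrence sits at the diagonal index. Moving back by
    \<open>h\<close> at most doubles \<open>P\<close>, up to a remainder; this doubling is the
    origin of the 2 in \<open>1 + 2 * \<mu> * L\<close>.\<close>
  have diag: "P (t - h) s \<le> 2 * P t s + 2 * C * h\<^sup>2 / \<delta>" if "t \<ge> h" "s \<ge> 0" for t s
  proof -
    have "(t - h - s)\<^sup>2 \<le> 2 * (t - s)\<^sup>2 + 2 * h\<^sup>2"
      using zero_le_power2[of "t - s + h"] by (simp add: power2_eq_square algebra_simps)
    moreover have "(h + \<mu>) / 2 * (t - h + s) \<le> (h + \<mu>) / 2 * (2 * (t + s))"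
      using that pos by (intro mult_left_mono) auto
    ultimately have "(t - h - s)\<^sup>2 + (h + \<mu>) / 2 * (t - h + s) \<le> 2 * ((t - s)\<^sup>2 + (h + \<mu>) / 2 * (t + s)) + 2 * h\<^sup>2"
      by argo
    then have "((t - h - s)\<^sup>2 + (h + \<mu>) / 2 * (t - h + s)) / \<delta> \<le> (2 * ((t - s)\<^sup>2 + (h + \<mu>) / 2 * (t + s)) + 2 * h\<^sup>2) / \<delta>"
      using pos by (intro divide_right_mono) auto
    also have "\<dots> = 2 * (((t - s)\<^sup>2 + (h + \<mu>) / 2 * (t + s)) / \<delta>) + 2 * h\<^sup>2 / \<delta>"
      by (simp add: add_divide_distrib)
    finally have "\<delta> + ((t - h - s)\<^sup>2 + (h + \<mu>) / 2 * (t - h + s)) / \<delta> \<le>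
        2 * (\<delta> + ((t - s)\<^sup>2 + (h + \<mu>) / 2 * (t + s)) / \<delta>) + 2 * h\<^sup>2 / \<delta>" using pos by argo
    then have "C * (\<delta> + ((t - h - s)\<^sup>2 + (h + \<mu>) / 2 * (t - h + s)) / \<delta>) \<le>
        C * (2 * (\<delta> + ((t - s)\<^sup>2 + (h + \<mu>) / 2 * (t + s)) / \<delta>) + 2 * h\<^sup>2 / \<delta>)"
      using pos by (intro mult_left_mono) auto
    also have "\<dots> = 2 * (C * (\<delta> + ((t - s)\<^sup>2 + (h + \<mu>) / 2 * (t + s)) / \<delta>)) + 2 * C * h\<^sup>2 / \<delta>"
    proof -
      have "C * (2 * Y + 2 * h\<^sup>2 / \<delta>) = 2 * (C * Y) + 2 * C * h\<^sup>2 / \<delta>" for Y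
        by (simp add: distrib_left)
      then show ?thesis .
    qed
    finally show ?thesis unfolding P_def using pos e0 mult_nonneg_nonneg[OF e0 that(2)] by argo
  qed
  have main: "a n m \<le> (1 + 2 * \<mu> * L) ^ m * P (real n * h) (real m * \<mu>)" if "n \<le> N" "m \<le> M" for n m
    using that
  proof (induction "n + m" arbitrary: n m rule: less_induct)
    case less
    have E1: "1 \<le> (1 + 2 * \<mu> * L) ^ k" for k using pos by (intro one_le_power) auto
    show ?case
    proof (cases "n = 0 \<or> m = 0")
      case True
      have Pn: "\<epsilon> + C * \<bar>real n * h - real m * \<mu>\<bar> \<le> P (real n * h) (real m * \<mu>)"
        by (rule P_abs) (use pos in auto)
      have "a n m \<le> \<epsilon> + C * \<bar>real n * h - real m * \<mu>\<bar>"
        using True left[of n] bot[of m] less.prems pos by auto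
      also note Pn
      also have "P (real n * h) (real m * \<mu>) \<le> (1 + 2 * \<mu> * L) ^ m * P (real n * h) (real m * \<mu>)"
      proof -
        have "0 \<le> P (real n * h) (real m * \<mu>)"
          using Pn pos by (smt (verit) mult_nonneg_nonneg abs_ge_zero)
        then show ?thesis using mult_right_mono[OF E1[of m]] by simp
      qed
      finally show ?thesis .
    next
      case False
      then obtain i j where nm: "n = Suc i" "m = Suc j" by (meson not0_implies_Suc)
      define t where "t = real n * h"
      define s where "s = real m * \<mu>"
      have ti: "real i * h = t - h" and sj: "real j * \<mu> = s - \<mu>"
        by (simp_all add: t_def s_def nm algebra_simps)
      have th: "t \<ge> h" "s - \<mu> \<ge> 0" using pos by (simp_all add: t_def s_def nm algebra_simps)
      define E where "E = (1 + 2 * \<mu> * L) ^ j"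
      define l where "l = h * \<mu> / (h + \<mu>)"
      have l0: "l \<ge> 0" and E: "E \<ge> 1" using pos E1 by (auto simp: l_def E_def)
      have Em: "(1 + 2 * \<mu> * L) ^ m = E * (1 + 2 * \<mu> * L)" by (simp add: E_def nm)
      have 1: "a i m \<le> E * (1 + 2 * \<mu> * L) * P (t - h) s"
        using less.hyps[of i m] less.prems nm(1) unfolding ti Em s_def[symmetric] by simp
      have 2: "a n j \<le> E * P t (s - \<mu>)"
        using less.hyps[of n j] less.prems nm by (simp add: sj E_def t_def)
      have "a i j \<le> E * P (t - h) (s - \<mu>)"
        using less.hyps[of i j] less.prems nm by (simp add: sj ti E_def)
      also have "\<dots> \<le> E * (2 * P t (s - \<mu>) + 2 * C * h\<^sup>2 / \<delta>)"
        using diag[of t "s - \<mu>"] th E by (intro mult_left_mono) auto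
      finally have 3: "L * a i j \<le> L * (E * (2 * P t (s - \<mu>) + 2 * C * h\<^sup>2 / \<delta>))"
        using pos by (intro mult_left_mono) auto
      have 4: "L * a i j + \<eta> \<le> L * (E * (2 * P t (s - \<mu>) + 2 * C * h\<^sup>2 / \<delta>)) + E * \<eta>"
        using 3 mult_right_mono[OF E pos(7)] by simp
      have "a n m \<le> \<mu> / (h + \<mu>) * a i m + h / (h + \<mu>) * a n j + l * (L * a i j + \<eta>)"
        using rec[of i j] less.prems nm by (simp add: l_def)
      also have "\<dots> \<le> \<mu> / (h + \<mu>) * (E * (1 + 2 * \<mu> * L) * P (t - h) s) + h / (h + \<mu>) * (E * P t (s - \<mu>))
           + l * (L * (E * (2 * P t (s - \<mu>) + 2 * C * h\<^sup>2 / \<delta>)) + E * \<eta>)"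
        by (rule add_mono[OF add_mono[OF mult_left_mono[OF 1] mult_left_mono[OF 2]] mult_left_mono[OF 4]])
          (use pos l0 in auto)
      \<comment> \<open>Because \<open>l = h / (h + \<mu>) * \<mu>\<close>, the Lipschitz term
        merges with the summand containing \<open>P t (s - \<mu>)\<close> and raises its factor to
        \<open>1 + 2 * \<mu> * L\<close>, which the first summand already carries. The leftover
        \<open>E * (l * e)\<close> is then absorbed by \<open>avg\<close>.\<close>
      also have "\<dots> = E * (1 + 2 * \<mu> * L) * (\<mu> / (h + \<mu>) * P (t - h) s + h / (h + \<mu>) * P t (s - \<mu>)) + E * (l * e)"
      proof -
        have "p * (E * (1 + 2 * \<mu> * L) * x) + q * (E * y) + q * \<mu> * (L * (E * (2 * y + z)) + E * \<eta>)
            = E * (1 + 2 * \<mu> * L) * (p * x + q * y) + E * (q * \<mu> * (\<eta> + L * z))" for p q x y z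
          by (simp add: algebra_simps)
        moreover have "l = h / (h + \<mu>) * \<mu>" "e = \<eta> + L * (2 * C * h\<^sup>2 / \<delta>)"
          by (simp_all add: l_def e_def mult_ac)
        ultimately show ?thesis by (simp only:)
      qed
      also have "\<dots> = E * (1 + 2 * \<mu> * L) * P t s - 2 * \<mu> * L * E * (l * e)"
        unfolding avg l_def[symmetric] by (simp add: algebra_simps)
      also have "\<dots> \<le> E * (1 + 2 * \<mu> * L) * P t s"
        using pos l0 e0 E by simp
      finally show ?thesis unfolding Em t_def s_def .
    qed
  qed
  show "n \<le> N \<Longrightarrow> m \<le> M \<Longrightarrow> ?thesis"
    using main[of n m] unfolding P_def e_def .
qed

section \<open>The abstract scheme and its difference quotients\<close>

primrec euler :: "(real \<Rightarrow> 'a::real_normed_vector \<Rightarrow> 'a) \<Rightarrow> ('a \<Rightarrow> 'a) \<Rightarrow> 'a \<Rightarrow> real \<Rightarrow> nat \<Rightarrow> 'a" where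
  "euler R N x0 h 0 = x0"
| "euler R N x0 h (Suc n) = R h (euler R N x0 h n + h *\<^sub>R N (euler R N x0 h n))"

text \<open>\<open>Ax0\<close> stands for \<open>A x0\<close>, where \<open>A\<close> is the dissipative operator with resolvents \<open>R h\<close>.\<close>

locale semilinear =
  fixes R :: "real \<Rightarrow> 'a::banach \<Rightarrow> 'a" and G :: "'a \<Rightarrow> 'a" and D :: "'a \<Rightarrow> 'a \<Rightarrow> 'a"
    and B :: "'a set" and L L' :: real and x0 Ax0 :: 'a and T :: real
  assumes linear_R: "h > 0 \<Longrightarrow> linear (R h)"
    and norm_R_le: "h > 0 \<Longrightarrow> norm (R h x) \<le> norm x"
    and resolvent_identity: "h > 0 \<Longrightarrow> m > 0 \<Longrightarrow> R h x = R m ((m / h) *\<^sub>R x + (1 - m / h) *\<^sub>R R h x)"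
    and L: "L \<ge> 0" "L' \<ge> 0"
    and G_lipschitz: "x \<in> B \<Longrightarrow> y \<in> B \<Longrightarrow> norm (G x - G y) \<le> L * norm (x - y)"
    and linear_D: "x \<in> B \<Longrightarrow> linear (D x)"
    and norm_D_le: "x \<in> B \<Longrightarrow> norm (D x v) \<le> L * norm v"
    and D_lipschitz: "x \<in> B \<Longrightarrow> y \<in> B \<Longrightarrow> norm (D x v - D y v) \<le> L' * norm (x - y) * norm v"
    and D_derivative: "x \<in> B \<Longrightarrow> y \<in> B \<Longrightarrow> norm (G y - G x - D x (y - x)) \<le> L' * (norm (y - x))\<^sup>2"
    and x0_domain: "h > 0 \<Longrightarrow> x0 = R h (x0 - h *\<^sub>R Ax0)"
    and R_approx: "e > 0 \<Longrightarrow> \<exists>h>0. norm (R h (Ax0 + G x0) - (Ax0 + G x0)) \<le> e"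
    and T: "T > 0"
    and euler_in_B: "h > 0 \<Longrightarrow> real n * h \<le> T \<Longrightarrow> euler R G x0 h n \<in> B"
begin

abbreviation X where "X \<equiv> euler R G x0"

definition V :: "real \<Rightarrow> nat \<Rightarrow> 'a" where
  "V h n = (1 / h) *\<^sub>R (X h (Suc n) - X h n)"

definition v0 where "v0 = Ax0 + G x0"

definition K where "K = exp (L * T) * norm v0"

lemma R_diff: "h > 0 \<Longrightarrow> R h (x - y) = R h x - R h y"
  using linear_R linear_diff by blast

lemma R_scale: "h > 0 \<Longrightarrow> R h (c *\<^sub>R x) = c *\<^sub>R R h x"
  using linear_R linear_scale by blast

lemma X_Suc: "h > 0 \<Longrightarrow> X h (Suc n) = X h n + h *\<^sub>R V h n"
  by (simp add: V_def del: euler.simps)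

text \<open>Here the regularity of \<open>x0\<close> enters: writing \<open>x0\<close> itself as a
  resolvent value makes the first quotient bounded independently of \<open>h\<close>.\<close>

lemma V_0: assumes h: "h > 0" shows "V h 0 = R h v0"
proof -
  have "X h (Suc 0) - X h 0 = R h (x0 + h *\<^sub>R G x0) - R h (x0 - h *\<^sub>R Ax0)"
    using x0_domain[OF h] by simp
  also have "\<dots> = R h ((x0 + h *\<^sub>R G x0) - (x0 - h *\<^sub>R Ax0))"
    by (simp only: R_diff[OF h])
  also have "(x0 + h *\<^sub>R G x0) - (x0 - h *\<^sub>R Ax0) = h *\<^sub>R v0"
    by (simp add: v0_def algebra_simps)
  finally show ?thesis using h by (simp add: V_def R_scale del: euler.simps)
qed

definition g :: "real \<Rightarrow> nat \<Rightarrow> 'a" where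
  "g h n = (1 / h) *\<^sub>R (G (X h (Suc n)) - G (X h n))"

lemma V_Suc: assumes h: "h > 0" shows "V h (Suc n) = R h (V h n + h *\<^sub>R g h n)"
proof -
  have "X h (Suc (Suc n)) - X h (Suc n) =
      R h ((X h (Suc n) + h *\<^sub>R G (X h (Suc n))) - (X h n + h *\<^sub>R G (X h n)))"
    by (simp add: R_diff[OF h])
  also have "(X h (Suc n) + h *\<^sub>R G (X h (Suc n))) - (X h n + h *\<^sub>R G (X h n)) = h *\<^sub>R (V h n + h *\<^sub>R g h n)"
    using h by (simp add: V_def g_def algebra_simps del: euler.simps)
  finally show ?thesis using h by (simp add: V_def[of h "Suc n"] R_scale del: euler.simps)
qed

lemma step_in_B:
  assumes "h > 0" "real (Suc n) * h \<le> T"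
  shows "X h n \<in> B" "X h (Suc n) \<in> B"
proof -
  have "real n * h \<le> real (Suc n) * h" using assms by simp
  then show "X h n \<in> B" "X h (Suc n) \<in> B" using assms euler_in_B order_trans by blast+
qed

lemma norm_g_le:
  assumes "h > 0" "real (Suc n) * h \<le> T"
  shows "norm (g h n) \<le> L * norm (V h n)"
proof -
  have "norm (G (X h (Suc n)) - G (X h n)) \<le> L * norm (h *\<^sub>R V h n)"
    using G_lipschitz[OF step_in_B(2,1)[OF assms]] by (simp add: X_Suc assms del: euler.simps)
  then have "norm (G (X h (Suc n)) - G (X h n)) \<le> h * (L * norm (V h n))"
    using assms by (simp add: mult_ac)
  then show ?thesis using assms unfolding g_def norm_scaleR by (simp add: pos_divide_le_eq mult.commute del: euler.simps)
qed

text \<open>Discrete Gronwall: one step multiplies the norm by at most \<open>1 + L * h\<close>. The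
  end point \<open>X h (Suc n)\<close> of the last quotient may lie beyond time \<open>T\<close>; by
  \<open>V_Suc\<close> only iterates up to index \<open>n\<close> enter \<open>G\<close>.\<close>

lemma norm_V_le:
  assumes h: "h > 0" and n: "real n * h \<le> T"
  shows "norm (V h n) \<le> K"
proof -
  have "real n * h \<le> T \<Longrightarrow> norm (V h n) \<le> exp (L * (real n * h)) * norm v0"
  proof (induction n)
    case 0
    show ?case using norm_R_le[OF h] by (simp add: V_0 h)
  next
    case (Suc n)
    have "real n * h \<le> real (Suc n) * h" using h by simp
    then have IH: "norm (V h n) \<le> exp (L * (real n * h)) * norm v0" using Suc by linarith
    have "norm (V h (Suc n)) \<le> norm (V h n + h *\<^sub>R g h n)"
      unfolding V_Suc[OF h] by (rule norm_R_le[OF h])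
    also have "\<dots> \<le> norm (V h n) + h * norm (g h n)"
      using h by (metis norm_triangle_ineq norm_scaleR abs_of_pos)
    also have "\<dots> \<le> norm (V h n) + h * (L * norm (V h n))"
      using norm_g_le[OF h Suc.prems] h by simp
    also have "\<dots> = (1 + L * h) * norm (V h n)" by (simp add: algebra_simps)
    also have "\<dots> \<le> exp (L * h) * (exp (L * (real n * h)) * norm v0)"
      using IH L h by (intro mult_mono) auto
    also have "\<dots> = exp (L * (real (Suc n) * h)) * norm v0"
      by (simp add: algebra_simps exp_add)
    finally show ?case .
  qed
  also have "exp (L * (real n * h)) * norm v0 \<le> K"
    using n L by (auto simp: K_def intro!: mult_right_mono mult_left_mono)
  finally show ?thesis using n by blast
qed

lemma K_nonneg: "K \<ge> 0" by (simp add: K_def)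

text \<open>The forcing \<open>g\<close> involves two consecutive iterates. Up to O(h) it is
  replaced by an expression in \<open>X h n\<close> and \<open>V h n\<close> alone, which can be
  compared between different step sizes.\<close>

lemma g_approx:
  assumes h: "h > 0" and n: "real (Suc n) * h \<le> T"
  shows "norm (g h n - D (X h n) (V h n)) \<le> L' * K\<^sup>2 * h"
proof -
  have nB: "X h n \<in> B" using step_in_B assms by blast
  have V: "norm (V h n) \<le> K"
    by (rule norm_V_le[OF h]) (use n h in \<open>simp add: algebra_simps\<close>)
  have eq: "g h n - D (X h n) (V h n) = (1 / h) *\<^sub>R (G (X h (Suc n)) - G (X h n) - D (X h n) (X h (Suc n) - X h n))"
    using h linear_scale[OF linear_D[OF nB], of h "V h n"]
    by (simp add: g_def X_Suc algebra_simps del: euler.simps)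
  have "norm (g h n - D (X h n) (V h n)) \<le> (1 / h) * (L' * (norm (X h (Suc n) - X h n))\<^sup>2)"
    unfolding eq using D_derivative[OF step_in_B[OF assms]] h by (simp add: divide_right_mono del: euler.simps)
  also have "\<dots> = L' * (norm (V h n))\<^sup>2 * h"
  proof -
    have "norm (X h (Suc n) - X h n) = h * norm (V h n)"
      unfolding X_Suc[OF h] using h by simp
    then show ?thesis using h by (simp only: power_mult_distrib) (simp add: power2_eq_square)
  qed
  also have "\<dots> \<le> L' * K\<^sup>2 * h"
    by (intro mult_right_mono mult_left_mono power_mono V) (use L h in auto)
  finally show ?thesis .
qed

text \<open>The common parameter \<open>l\<close> satisfies \<open>1 / l = 1 / h + 1 / m\<close>,
  hence \<open>1 - l / h = l / m\<close>. This makes the weights match, so that the terms pair up as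
  \<open>x - y'\<close> and \<open>x' - y\<close>.\<close>

lemma R_double_step:
  assumes h: "h > 0" and m: "m > 0" and x: "x' = R h (x + h *\<^sub>R p)" and y: "y' = R m (y + m *\<^sub>R q)"
  shows "norm (x' - y') \<le> m / (h + m) * norm (x - y') + h / (h + m) * norm (x' - y)
     + h * m / (h + m) * norm (p - q)"
proof -
  define l where "l = h * m / (h + m)"
  have l: "l > 0" "l / h = m / (h + m)" "l / m = h / (h + m)" "1 - m / (h + m) = h / (h + m)" "1 - h / (h + m) = m / (h + m)"
    using h m by (auto simp: l_def add_divide_distrib[symmetric] diff_eq_eq)
  have lh: "m / (h + m) * h = l" "h / (h + m) * m = l" by (auto simp: l_def)
  have "x' = R l ((m / (h + m)) *\<^sub>R (x + h *\<^sub>R p) + (h / (h + m)) *\<^sub>R x')"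
    using resolvent_identity[OF h l(1), of "x + h *\<^sub>R p"] unfolding l x[symmetric] .
  moreover have "y' = R l ((h / (h + m)) *\<^sub>R (y + m *\<^sub>R q) + (m / (h + m)) *\<^sub>R y')"
    using resolvent_identity[OF m l(1), of "y + m *\<^sub>R q"] unfolding l y[symmetric] .
  ultimately have "x' - y' = R l (((m / (h + m)) *\<^sub>R (x + h *\<^sub>R p) + (h / (h + m)) *\<^sub>R x') -
     ((h / (h + m)) *\<^sub>R (y + m *\<^sub>R q) + (m / (h + m)) *\<^sub>R y'))"
    using R_diff[OF l(1)] by metis
  also have "((m / (h + m)) *\<^sub>R (x + h *\<^sub>R p) + (h / (h + m)) *\<^sub>R x') -
     ((h / (h + m)) *\<^sub>R (y + m *\<^sub>R q) + (m / (h + m)) *\<^sub>R y')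
     = (m / (h + m)) *\<^sub>R (x - y') + (h / (h + m)) *\<^sub>R (x' - y) + l *\<^sub>R (p - q)"
    unfolding scaleR_add_right scaleR_diff_right scaleR_scaleR lh by simp
  finally have "norm (x' - y') \<le> norm ((m / (h + m)) *\<^sub>R (x - y') + (h / (h + m)) *\<^sub>R (x' - y) + l *\<^sub>R (p - q))"
    using norm_R_le[OF l(1)] by metis
  also have "\<dots> \<le> norm ((m / (h + m)) *\<^sub>R (x - y')) + norm ((h / (h + m)) *\<^sub>R (x' - y)) + norm (l *\<^sub>R (p - q))"
    by (intro order_trans[OF norm_triangle_ineq] add_right_mono norm_triangle_ineq)
  also have "\<dots> = m / (h + m) * norm (x - y') + h / (h + m) * norm (x' - y) + l * norm (p - q)"
    using h m l(1) by simp
  finally show ?thesis by (simp add: l_def)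
qed

text \<open>The recurrence for the quotients contains the distance of the iterates, through the base
  point of \<open>D\<close>; it closes only for this sum.\<close>

definition gap :: "real \<Rightarrow> real \<Rightarrow> nat \<Rightarrow> nat \<Rightarrow> real" where
  "gap h m n k = norm (X h n - X m k) + norm (V h n - V m k)"

lemma gap_sym: "gap h m n k = gap m h k n"
  by (simp add: gap_def norm_minus_commute)

text \<open>In \<open>2 * L + L' * K\<close> one \<open>L\<close> comes from \<open>G\<close>, the
  other from the linear maps \<open>D\<close>, and \<open>L' * K\<close> from the change of base
  point of \<open>D\<close> acting on a quotient of norm at most \<open>K\<close>. Using
  \<open>g_approx\<close> for both step sizes leaves
  \<open>L' * K\<^sup>2 * (h + m)\<close>.\<close>

lemma gap_Suc_Suc:
  assumes h: "h > 0" and m: "m > 0" and n: "real (Suc n) * h \<le> T" and k: "real (Suc k) * m \<le> T"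
  shows "gap h m (Suc n) (Suc k) \<le> m / (h + m) * gap h m n (Suc k) + h / (h + m) * gap h m (Suc n) k
     + h * m / (h + m) * ((2 * L + L' * K) * gap h m n k + L' * K\<^sup>2 * (h + m))"
proof -
  have nB: "X h n \<in> B" and kB: "X m k \<in> B" using step_in_B assms by blast+
  have VK: "norm (V m k) \<le> K"
    by (rule norm_V_le[OF m]) (use k m in \<open>simp add: algebra_simps\<close>)
  have "norm (D (X h n) (V h n) - D (X m k) (V m k)) \<le>
      norm (D (X h n) (V h n - V m k)) + norm (D (X h n) (V m k) - D (X m k) (V m k))"
    unfolding linear_diff[OF linear_D[OF nB]] by (rule order_trans[OF _ norm_triangle_ineq]) simp
  also have "\<dots> \<le> L * norm (V h n - V m k) + L' * norm (X h n - X m k) * norm (V m k)"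
    by (intro add_mono norm_D_le D_lipschitz nB kB)
  also have "\<dots> \<le> L * norm (V h n - V m k) + L' * norm (X h n - X m k) * K"
    using VK L by (intro add_left_mono mult_left_mono) auto
  finally have DD: "norm (D (X h n) (V h n) - D (X m k) (V m k)) \<le>
     L * norm (V h n - V m k) + L' * norm (X h n - X m k) * K" .
  have "norm (g h n - g m k) \<le> norm (g h n - D (X h n) (V h n)) + norm (D (X h n) (V h n) - D (X m k) (V m k))
      + norm (g m k - D (X m k) (V m k))"
  proof -
    have "norm (x - y) \<le> norm (x - x') + norm (x' - y') + norm (y - y')" for x y x' y' :: 'a
      using norm_triangle_ineq4[of "(x - x') + (x' - y')" "y - y'"] norm_triangle_ineq[of "x - x'" "x' - y'"] by simp
    then show ?thesis .
  qed
  also have "\<dots> \<le> L' * K\<^sup>2 * h + (L * norm (V h n - V m k) + L' * norm (X h n - X m k) * K) + L' * K\<^sup>2 * m"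
    by (intro add_mono g_approx DD h m n k)
  finally have gg: "norm (g h n - g m k) \<le> \<dots>" .
  have GG: "norm (G (X h n) - G (X m k)) \<le> L * norm (X h n - X m k)"
    by (rule G_lipschitz[OF nB kB])
  have "norm (G (X h n) - G (X m k)) + norm (g h n - g m k) \<le> (2 * L + L' * K) * gap h m n k + L' * K\<^sup>2 * (h + m)"
  proof -
    have "0 \<le> L * norm (X h n - X m k)" "0 \<le> L' * K * norm (V h n - V m k)" "0 \<le> L * norm (V h n - V m k)"
      using L K_nonneg by auto
    then show ?thesis using gg GG by (simp add: gap_def algebra_simps)
  qed
  then have *: "h * m / (h + m) * (norm (G (X h n) - G (X m k)) + norm (g h n - g m k)) \<le>
     h * m / (h + m) * ((2 * L + L' * K) * gap h m n k + L' * K\<^sup>2 * (h + m))"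
    using h m by (intro mult_left_mono) auto
  show ?thesis
    using R_double_step[OF h m euler.simps(2)[of R G x0 h n] euler.simps(2)[of R G x0 m k]]
      R_double_step[OF h m V_Suc[OF h] V_Suc[OF m], of n k] *
    unfolding gap_def distrib_left by linarith
qed

text \<open>Boundary values of the two-index recurrence. The quotients are compared with
  \<open>w = R r v0\<close>, which is within \<open>e / 2\<close> of \<open>v0\<close> and lies in
  the domain of \<open>A\<close>; from there they drift at most linearly in time. The constant
  \<open>c\<close> is the norm of \<open>A w\<close> and depends on \<open>e\<close>.\<close>

lemma gap_0:
  assumes e: "e > 0"
  obtains c where "c \<ge> 0"
    "\<And>h m n. h > 0 \<Longrightarrow> m > 0 \<Longrightarrow> real n * h \<le> T \<Longrightarrow>
      gap h m n 0 \<le> (e + c * (h + m)) + (K + L * K + c) * (real n * h)"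
proof -
  obtain r where r: "r > 0" "norm (R r v0 - v0) \<le> e / 2"
    using R_approx[of "e / 2"] e unfolding v0_def by auto
  define w where "w = R r v0"
  \<comment> \<open>This is \<open>A w\<close>, read off from
    \<open>w - r *\<^sub>R Aw = v0\<close>.\<close>
  define Aw where "Aw = (1 / r) *\<^sub>R (w - v0)"
  have w: "w = R h (w - h *\<^sub>R Aw)" if h: "h > 0" for h
  proof -
    have "w - h *\<^sub>R Aw = (h / r) *\<^sub>R v0 + (1 - h / r) *\<^sub>R R r v0"
      by (simp add: w_def Aw_def algebra_simps)
    then show ?thesis using resolvent_identity[OF r(1) h, of v0] by (simp add: w_def)
  qed
  have V0w: "norm (V h 0 - w) \<le> e / 2 + norm Aw * h" if h: "h > 0" for h
  proof -
    have "V h 0 - w = R h v0 - R h (w - h *\<^sub>R Aw)"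
      using w[OF h] V_0[OF h] by metis
    also have "\<dots> = R h (h *\<^sub>R Aw - (w - v0))"
      by (simp add: R_diff[OF h, symmetric] algebra_simps)
    finally have "norm (V h 0 - w) \<le> norm (h *\<^sub>R Aw - (w - v0))" using norm_R_le[OF h] by metis
    also have "\<dots> \<le> norm (h *\<^sub>R Aw) + norm (w - v0)" by (rule norm_triangle_ineq4)
    finally show ?thesis using r h by (simp add: w_def mult.commute)
  qed
  have Vw: "norm (V h n - w) \<le> e / 2 + norm Aw * h + (L * K + norm Aw) * (real n * h)"
    if h: "h > 0" and "real n * h \<le> T" for h n
    using that(2)
  proof (induction n)
    case 0
    then show ?case using V0w[OF h] by simp
  next
    case (Suc n)
    have n: "real n * h \<le> T" using Suc.prems h by (simp add: algebra_simps)
    have "V h (Suc n) - w = R h (V h n + h *\<^sub>R g h n) - R h (w - h *\<^sub>R Aw)"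
      using w[OF h] V_Suc[OF h] by metis
    also have "\<dots> = R h ((V h n - w) + h *\<^sub>R (g h n + Aw))"
      by (simp add: R_diff[OF h, symmetric] algebra_simps)
    finally have "norm (V h (Suc n) - w) \<le> norm ((V h n - w) + h *\<^sub>R (g h n + Aw))"
      using norm_R_le[OF h] by metis
    also have "\<dots> \<le> norm (V h n - w) + norm (h *\<^sub>R (g h n + Aw))" by (rule norm_triangle_ineq)
    also have "norm (h *\<^sub>R (g h n + Aw)) = h * norm (g h n + Aw)" using h by simp
    also have "norm (g h n + Aw) \<le> norm (g h n) + norm Aw" by (rule norm_triangle_ineq)
    also have "norm (g h n) \<le> L * K"
      using norm_g_le[OF h Suc.prems] norm_V_le[OF h n] L mult_left_mono order_trans by blast
    finally have "norm (V h (Suc n) - w) \<le> norm (V h n - w) + h * (L * K + norm Aw)"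
      using h by simp
    then show ?case using Suc.IH[OF n] by (simp add: algebra_simps)
  qed
  have X: "norm (X h n - x0) \<le> K * (real n * h)" if h: "h > 0" and "real n * h \<le> T" for h n
    using that(2)
  proof (induction n)
    case (Suc n)
    have n: "real n * h \<le> T" using Suc.prems h by (simp add: algebra_simps)
    have "norm (X h (Suc n) - x0) \<le> norm (X h n - x0) + norm (h *\<^sub>R V h n)"
      unfolding X_Suc[OF h] by (rule order_trans[OF _ norm_triangle_ineq]) (simp add: algebra_simps)
    also have "norm (h *\<^sub>R V h n) \<le> h * K" using norm_V_le[OF h n] h by simp
    finally show ?case using Suc.IH[OF n] by (simp add: algebra_simps)
  qed simp
  show thesis
  proof (rule that[of "norm Aw"])
    fix h m :: real and n :: nat
    assume h: "h > 0" and m: "m > 0" and n: "real n * h \<le> T"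
    have "norm (V h n - V m 0) \<le> norm (V h n - w) + norm (V m 0 - w)"
      using norm_triangle_ineq4[of "V h n - w" "V m 0 - w"] by simp
    then show "gap h m n 0 \<le> (e + norm Aw * (h + m)) + (K + L * K + norm Aw) * (real n * h)"
      using Vw[OF h n] V0w[OF m] X[OF h n] by (simp add: gap_def algebra_simps)
  qed simp
qed

lemma gap_small:
  assumes e: "e > 0"
  obtains \<kappa> H where "\<kappa> > 0" "H > 0"
    "\<And>h m n k. 0 < h \<Longrightarrow> h < H \<Longrightarrow> 0 < m \<Longrightarrow> m < H \<Longrightarrow> real n * h \<le> T \<Longrightarrow> real k * m \<le> T \<Longrightarrow>
       \<bar>real n * h - real k * m\<bar> \<le> \<kappa> \<Longrightarrow> gap h m n k \<le> e"
proof -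
  define M where "M = 2 * L + L' * K"
  define E where "E = exp (2 * M * T)"
  \<comment> \<open>Three contributions of size \<open>e1\<close> will occur: the initial error, the
    terms with \<open>\<delta>\<close>, and those vanishing with the step sizes. \<open>E\<close>
    bounds the growth factor \<open>(1 + 2 * m * M) ^ k\<close>.\<close>
  define e1 where "e1 = e / (4 * E)"
  have M: "M \<ge> 0" using L K_nonneg by (simp add: M_def)
  have E: "E > 0" by (simp add: E_def)
  have e1: "e1 > 0" using e E by (simp add: e1_def)
  obtain c where c: "c \<ge> 0" and left: "\<And>h m n. h > 0 \<Longrightarrow> m > 0 \<Longrightarrow> real n * h \<le> T \<Longrightarrow>
      gap h m n 0 \<le> (e1 + c * (h + m)) + (K + L * K + c) * (real n * h)"
    using gap_0[OF e1] by blast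
  define C where "C = K + L * K + c"
  have C: "C \<ge> 0" using K_nonneg L c by (simp add: C_def)
  \<comment> \<open>The same \<open>\<delta>\<close> is the free parameter of
    \<open>double_index_bound\<close> and the admissible time difference, so the quadratic term
    contributes \<open>\<delta>\<^sup>2 / \<delta> = \<delta>\<close>.\<close>
  define \<delta> where "\<delta> = e1 / (2 * (C + 1))"
  have \<delta>: "\<delta> > 0" "2 * C * \<delta> \<le> e1" using C e1 by (auto simp: \<delta>_def field_simps)
  \<comment> \<open>\<open>Q\<close> collects the coefficients of all terms that are at most linear
    in the bound \<open>H\<close> on the step sizes.\<close>
  define Q where "Q = 2 * c + C * (2 * T / \<delta>) + (2 * (L' * K\<^sup>2) + 2 * C * M / \<delta>) * T"
  have Q: "Q \<ge> 0" using c C T \<delta> L M by (simp add: Q_def)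
  define H where "H = min 1 (e1 / (Q + 1))"
  have H: "H > 0" "H \<le> 1" using e1 Q by (auto simp: H_def)
  have "H * Q \<le> H * (Q + 1)" using H by simp
  also have "\<dots> \<le> e1 / (Q + 1) * (Q + 1)" using Q by (intro mult_right_mono) (auto simp: H_def)
  also have "\<dots> = e1" using Q by simp
  finally have HQ: "H * Q \<le> e1" .
  show thesis
  proof (rule that[OF \<delta>(1) H(1)])
    fix h m :: real and n k :: nat
    assume h: "0 < h" "h < H" and m: "0 < m" "m < H" and n: "real n * h \<le> T" and k: "real k * m \<le> T"
      and d: "\<bar>real n * h - real k * m\<bar> \<le> \<delta>"
    have nh: "real i * h \<le> T" if "i \<le> n" for i
      using that n h mult_right_mono[of "real i" "real n" h] by linarith
    have km: "real j * m \<le> T" if "j \<le> k" for j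
      using that k m mult_right_mono[of "real j" "real k" m] by linarith
    have "gap h m n k \<le> (1 + 2 * m * M) ^ k * ((e1 + c * (h + m)) +
       C * (\<delta> + ((real n * h - real k * m)\<^sup>2 + (h + m) / 2 * (real n * h + real k * m)) / \<delta>)
       + (L' * K\<^sup>2 * (h + m) + 2 * C * M * h\<^sup>2 / \<delta>) * (real k * m))"
    proof (rule double_index_bound[where a = "gap h m" and N = n and M = k])
      fix i j assume "i < n" "j < k"
      then show "gap h m (Suc i) (Suc j) \<le> m / (h + m) * gap h m i (Suc j) + h / (h + m) * gap h m (Suc i) j
         + h * m / (h + m) * (M * gap h m i j + L' * K\<^sup>2 * (h + m))"
        unfolding M_def by (intro gap_Suc_Suc h m nh km) auto
    next
      fix i assume "i \<le> n"
      then show "gap h m i 0 \<le> (e1 + c * (h + m)) + C * (real i * h)"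
        unfolding C_def by (intro left h m nh)
    next
      fix j assume "j \<le> k"
      then have "gap m h j 0 \<le> (e1 + c * (m + h)) + C * (real j * m)"
        unfolding C_def by (intro left h m km)
      then show "gap h m 0 j \<le> (e1 + c * (h + m)) + C * (real j * m)"
        by (simp add: gap_sym[of h m] add.commute)
    qed (use h m \<delta> C e1 c L M in auto)
    also have "\<dots> \<le> E * (3 * e1)"
    proof (rule mult_mono)
      have "(1 + 2 * m * M) ^ k \<le> exp (2 * m * M) ^ k"
        using m M by (intro power_mono) auto
      also have "\<dots> = exp (2 * M * (real k * m))"
        by (simp add: exp_of_nat_mult[symmetric] mult_ac)
      also have "\<dots> \<le> E" using k M by (auto simp: E_def intro!: mult_left_mono)
      finally show "(1 + 2 * m * M) ^ k \<le> E" .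
    next
      have "(real n * h - real k * m)\<^sup>2 \<le> \<delta>\<^sup>2"
        using d by (metis power2_abs power_mono abs_ge_zero)
      moreover have "(h + m) / 2 * (real n * h + real k * m) \<le> H * (2 * T)"
        using h m n k H T by (intro mult_mono) auto
      ultimately have "((real n * h - real k * m)\<^sup>2 + (h + m) / 2 * (real n * h + real k * m)) / \<delta>
          \<le> (\<delta>\<^sup>2 + H * (2 * T)) / \<delta>"
        using \<delta> by (intro divide_right_mono) auto
      also have "\<dots> = \<delta> + H * (2 * T / \<delta>)"
        using \<delta> by (simp add: add_divide_distrib power2_eq_square)
      finally have "C * (\<delta> + ((real n * h - real k * m)\<^sup>2 + (h + m) / 2 * (real n * h + real k * m)) / \<delta>)
         \<le> C * (2 * \<delta> + H * (2 * T / \<delta>))"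
        using C by (intro mult_left_mono) auto
      also have "\<dots> = 2 * C * \<delta> + H * (C * (2 * T / \<delta>))"
        by (simp add: distrib_left mult_ac)
      also have "\<dots> \<le> e1 + H * (C * (2 * T / \<delta>))" using \<delta> by simp
      finally have 1: "C * (\<delta> + ((real n * h - real k * m)\<^sup>2 + (h + m) / 2 * (real n * h + real k * m)) / \<delta>) \<le> \<dots>" .
      have 2: "c * (h + m) \<le> H * (2 * c)"
        using mult_left_mono[of "h + m" "2 * H" c] h m c by (simp add: mult_ac)
      have "L' * K\<^sup>2 * (h + m) \<le> L' * K\<^sup>2 * (2 * H)"
        using h m L by (intro mult_left_mono) auto
      moreover have "2 * C * M * h\<^sup>2 / \<delta> \<le> 2 * C * M * H / \<delta>"
      proof -
        have "h * h \<le> H * 1" using h H by (intro mult_mono) auto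
        then show ?thesis using C M \<delta> by (intro divide_right_mono mult_left_mono) (auto simp: power2_eq_square)
      qed
      ultimately have "L' * K\<^sup>2 * (h + m) + 2 * C * M * h\<^sup>2 / \<delta> \<le> H * (2 * (L' * K\<^sup>2) + 2 * C * M / \<delta>)"
        by (simp add: distrib_left mult_ac)
      then have 3: "(L' * K\<^sup>2 * (h + m) + 2 * C * M * h\<^sup>2 / \<delta>) * (real k * m) \<le>
          H * (2 * (L' * K\<^sup>2) + 2 * C * M / \<delta>) * T"
        using k H L C M \<delta> m by (intro mult_mono) auto
      have "H * Q = H * (2 * c) + H * (C * (2 * T / \<delta>)) + H * (2 * (L' * K\<^sup>2) + 2 * C * M / \<delta>) * T"
        by (simp add: Q_def algebra_simps)
      then show "e1 + c * (h + m) +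
         C * (\<delta> + ((real n * h - real k * m)\<^sup>2 + (h + m) / 2 * (real n * h + real k * m)) / \<delta>)
         + (L' * K\<^sup>2 * (h + m) + 2 * C * M * h\<^sup>2 / \<delta>) * (real k * m) \<le> 3 * e1"
        using 1 2 3 HQ by linarith
    qed (use h m \<delta> C e1 c L M E in \<open>auto intro!: add_nonneg_nonneg\<close>)
    also have "\<dots> \<le> e" using e E by (simp add: e1_def)
    finally show "gap h m n k \<le> e" .
  qed
qed

section \<open>Limits along the step sizes \<open>T / (i + 1)\<close>, indexed from
  \<open>i = 0\<close>\<close>

definition stepsize :: "nat \<Rightarrow> real" where "stepsize i = T / real (Suc i)"

definition stepindex :: "nat \<Rightarrow> real \<Rightarrow> nat" where "stepindex i t = nat \<lfloor>t / stepsize i\<rfloor>"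

lemma stepsize_pos: "stepsize i > 0"
  using T by (simp add: stepsize_def)

lemma stepsize_0: "stepsize \<longlonglongrightarrow> 0"
  unfolding stepsize_def by (rule LIMSEQ_Suc[OF lim_const_over_n])

lemma stepindex_bounds:
  assumes "0 \<le> t"
  shows "real (stepindex i t) * stepsize i \<le> t" "t < real (stepindex i t) * stepsize i + stepsize i"
proof -
  have "real (stepindex i t) = of_int \<lfloor>t / stepsize i\<rfloor>"
    using assms stepsize_pos[of i] by (simp add: stepindex_def)
  then have "real (stepindex i t) \<le> t / stepsize i" "t / stepsize i < real (stepindex i t) + 1" by linarith+
  then show "real (stepindex i t) * stepsize i \<le> t" "t < real (stepindex i t) * stepsize i + stepsize i"
    using stepsize_pos[of i] by (simp_all add: field_simps)
qed

lemma stepindex_tendsto: assumes "0 \<le> t" shows "(\<lambda>i. real (stepindex i t) * stepsize i) \<longlonglongrightarrow> t"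
proof (rule tendsto_sandwich[where f = "\<lambda>i. t - stepsize i" and h = "\<lambda>_. t"])
  show "(\<lambda>i. t - stepsize i) \<longlonglongrightarrow> t" using tendsto_diff[OF tendsto_const stepsize_0, of t] by simp
qed (use stepindex_bounds[OF assms] in \<open>auto intro!: always_eventually simp: less_imp_le algebra_simps\<close>)

text \<open>Compares a grid point with an arbitrary time \<open>s\<close>, represented on the other
  grid by rounding down. Half of the tolerance from \<open>gap_small\<close> is reserved for that
  rounding.\<close>

lemma gap_grid_small:
  assumes e: "e > 0"
  obtains \<kappa> I where "\<kappa> > 0"
    "\<And>i j n s. i \<ge> I \<Longrightarrow> j \<ge> I \<Longrightarrow> real n * stepsize i \<le> T \<Longrightarrow> s \<in> {0..T} \<Longrightarrow> \<bar>real n * stepsize i - s\<bar> \<le> \<kappa> \<Longrightarrow>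
       gap (stepsize i) (stepsize j) n (stepindex j s) \<le> e"
    "\<And>i. i \<ge> I \<Longrightarrow> stepsize i \<le> \<kappa>"
proof -
  obtain \<kappa> H where \<kappa>: "\<kappa> > 0" "H > 0" and
    gs: "\<And>h m n k. 0 < h \<Longrightarrow> h < H \<Longrightarrow> 0 < m \<Longrightarrow> m < H \<Longrightarrow> real n * h \<le> T \<Longrightarrow> real k * m \<le> T \<Longrightarrow>
       \<bar>real n * h - real k * m\<bar> \<le> \<kappa> \<Longrightarrow> gap h m n k \<le> e"
    using gap_small[OF e] by blast
  have "eventually (\<lambda>i. stepsize i < min H (\<kappa> / 2)) sequentially"
    using \<kappa> by (intro order_tendstoD(2)[OF stepsize_0]) auto
  then obtain I where I: "\<And>i. i \<ge> I \<Longrightarrow> stepsize i < min H (\<kappa> / 2)"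
    by (auto simp: eventually_sequentially)
  show thesis
  proof (rule that[of "\<kappa> / 2" I])
    fix i j n s
    assume a: "i \<ge> I" "j \<ge> I" "real n * stepsize i \<le> T" "s \<in> {0..T}" "\<bar>real n * stepsize i - s\<bar> \<le> \<kappa> / 2"
    then have s: "s \<ge> 0" "s \<le> T" by auto
    have hi: "stepsize i < H" "stepsize j < H" "stepsize j < \<kappa> / 2" using I a by auto
    have "\<bar>real n * stepsize i - real (stepindex j s) * stepsize j\<bar> \<le> \<kappa>"
      unfolding abs_le_iff using a(5)[unfolded abs_le_iff] hi stepindex_bounds[OF s(1), of j] stepsize_pos[of j] by linarith
    then show "gap (stepsize i) (stepsize j) n (stepindex j s) \<le> e"
      using stepindex_bounds[OF s(1), of j] hi a(3) s by (intro gs stepsize_pos) auto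
  qed (use \<kappa> I in \<open>auto simp: less_imp_le\<close>)
qed

lemma convergent_X_V:
  assumes t: "t \<in> {0..T}"
  shows "convergent (\<lambda>i. X (stepsize i) (stepindex i t))" "convergent (\<lambda>i. V (stepsize i) (stepindex i t))"
proof -
  have "Cauchy (\<lambda>i. X (stepsize i) (stepindex i t)) \<and> Cauchy (\<lambda>i. V (stepsize i) (stepindex i t))"
    unfolding Cauchy_iff
  proof (intro conjI allI impI)
    fix e :: real assume e: "e > 0"
    obtain \<kappa> I where \<kappa>: "\<kappa> > 0" and
      g: "\<And>i j n s. i \<ge> I \<Longrightarrow> j \<ge> I \<Longrightarrow> real n * stepsize i \<le> T \<Longrightarrow> s \<in> {0..T} \<Longrightarrow> \<bar>real n * stepsize i - s\<bar> \<le> \<kappa> \<Longrightarrow>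
       gap (stepsize i) (stepsize j) n (stepindex j s) \<le> e / 2" and h: "\<And>i. i \<ge> I \<Longrightarrow> stepsize i \<le> \<kappa>"
      using gap_grid_small[of "e / 2"] e by auto
    have *: "gap (stepsize i) (stepsize j) (stepindex i t) (stepindex j t) \<le> e / 2" if "i \<ge> I" "j \<ge> I" for i j
      using stepindex_bounds[of t i] h[OF that(1)] t by (intro g that) auto
    have "norm (X (stepsize i) (stepindex i t) - X (stepsize j) (stepindex j t)) < e" "norm (V (stepsize i) (stepindex i t) - V (stepsize j) (stepindex j t)) < e"
      if "i \<ge> I" "j \<ge> I" for i j
      using *[OF that] e norm_ge_zero[of "X (stepsize i) (stepindex i t) - X (stepsize j) (stepindex j t)"]
        norm_ge_zero[of "V (stepsize i) (stepindex i t) - V (stepsize j) (stepindex j t)"] unfolding gap_def by linarith+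
    then show "\<exists>M. \<forall>m\<ge>M. \<forall>n\<ge>M. norm (X (stepsize m) (stepindex m t) - X (stepsize n) (stepindex n t)) < e"
      "\<exists>M. \<forall>m\<ge>M. \<forall>n\<ge>M. norm (V (stepsize m) (stepindex m t) - V (stepsize n) (stepindex n t)) < e" by blast+
  qed
  then show "convergent (\<lambda>i. X (stepsize i) (stepindex i t))" "convergent (\<lambda>i. V (stepsize i) (stepindex i t))"
    by (auto simp: Cauchy_convergent_iff)
qed

definition u where "u t = lim (\<lambda>i. X (stepsize i) (stepindex i t))"
definition v where "v t = lim (\<lambda>i. V (stepsize i) (stepindex i t))"

lemma u_lim: "t \<in> {0..T} \<Longrightarrow> (\<lambda>i. X (stepsize i) (stepindex i t)) \<longlonglongrightarrow> u t"
  and v_lim: "t \<in> {0..T} \<Longrightarrow> (\<lambda>i. V (stepsize i) (stepindex i t)) \<longlonglongrightarrow> v t"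
  using convergent_X_V by (auto simp: u_def v_def convergent_LIMSEQ_iff)

text \<open>Let \<open>j\<close> tend to infinity in \<open>gap_grid_small\<close>. The tolerance
  does not depend on \<open>s\<close>, so the quotients are close to \<open>v s\<close> at all
  nearby grid points.\<close>

lemma V_near_v:
  assumes e: "e > 0"
  obtains \<kappa> I where "\<kappa> > 0"
    "\<And>i n s. i \<ge> I \<Longrightarrow> real n * stepsize i \<le> T \<Longrightarrow> s \<in> {0..T} \<Longrightarrow> \<bar>real n * stepsize i - s\<bar> \<le> \<kappa> \<Longrightarrow>
       norm (V (stepsize i) n - v s) \<le> e"
proof -
  obtain \<kappa> I where \<kappa>: "\<kappa> > 0" and
    g: "\<And>i j n s. i \<ge> I \<Longrightarrow> j \<ge> I \<Longrightarrow> real n * stepsize i \<le> T \<Longrightarrow> s \<in> {0..T} \<Longrightarrow> \<bar>real n * stepsize i - s\<bar> \<le> \<kappa> \<Longrightarrow>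
       gap (stepsize i) (stepsize j) n (stepindex j s) \<le> e"
    using gap_grid_small[OF e] by metis
  show thesis
  proof (rule that[OF \<kappa>, of I])
    fix i n s
    assume a: "i \<ge> I" "real n * stepsize i \<le> T" "s \<in> {0..T}" "\<bar>real n * stepsize i - s\<bar> \<le> \<kappa>"
    have "(\<lambda>j. norm (V (stepsize i) n - V (stepsize j) (stepindex j s))) \<longlonglongrightarrow> norm (V (stepsize i) n - v s)"
      by (intro tendsto_intros v_lim a)
    moreover have "norm (V (stepsize i) n - V (stepsize j) (stepindex j s)) \<le> e" if "j \<ge> I" for j
      using g[OF a(1) that a(2,3,4)] norm_ge_zero[of "X (stepsize i) n - X (stepsize j) (stepindex j s)"]
      unfolding gap_def by linarith
    ultimately show "norm (V (stepsize i) n - v s) \<le> e"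
      by (intro LIMSEQ_le_const2[where x = "norm (V (stepsize i) n - v s)"]) auto
  qed
qed

lemma X_increment:
  assumes h: "h > 0" and mn: "m \<le> n" and V: "\<And>k. m \<le> k \<Longrightarrow> k < n \<Longrightarrow> norm (V h k - w) \<le> e"
  shows "norm (X h n - X h m - (real n * h - real m * h) *\<^sub>R w) \<le> e * (real n * h - real m * h)"
  using mn V
proof (induction n rule: dec_induct)
  case (step n)
  have eq: "X h (Suc n) - X h m - (real (Suc n) * h - real m * h) *\<^sub>R w =
      (X h n - X h m - (real n * h - real m * h) *\<^sub>R w) + h *\<^sub>R (V h n - w)"
    unfolding X_Suc[OF h] by (simp add: algebra_simps)
  have "norm (h *\<^sub>R (V h n - w)) \<le> h * e" using step h by simp
  then show ?case unfolding eq using step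
    by (intro order_trans[OF norm_triangle_ineq]) (auto simp: algebra_simps)
qed simp

text \<open>All quotients between \<open>a\<close> and \<open>b\<close> are within \<open>e\<close>
  of \<open>v p\<close>, so telescoping gives the bound on the grid, and it survives the limit. Both
  choices of \<open>p\<close> are needed to approach a point from either side.\<close>

lemma u_increment:
  assumes e: "e > 0"
  obtains \<kappa> where "\<kappa> > 0"
    "\<And>a b p. 0 \<le> a \<Longrightarrow> a \<le> b \<Longrightarrow> b \<le> T \<Longrightarrow> b - a < \<kappa> \<Longrightarrow> p \<in> {a, b} \<Longrightarrow> norm (u b - u a - (b - a) *\<^sub>R v p) \<le> e * (b - a)"
proof -
  obtain \<kappa> I where \<kappa>: "\<kappa> > 0" and
    g: "\<And>i n s. i \<ge> I \<Longrightarrow> real n * stepsize i \<le> T \<Longrightarrow> s \<in> {0..T} \<Longrightarrow> \<bar>real n * stepsize i - s\<bar> \<le> \<kappa> \<Longrightarrow>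
       norm (V (stepsize i) n - v s) \<le> e"
    using V_near_v[OF e] by metis
  show thesis
  proof (rule that[of "\<kappa> / 2"])
    fix a b p assume ab: "0 \<le> a" "a \<le> b" "b \<le> T" "b - a < \<kappa> / 2" "p \<in> {a, b}"
    have "eventually (\<lambda>i. stepsize i < \<kappa> / 2) sequentially"
      using \<kappa> by (intro order_tendstoD(2)[OF stepsize_0]) auto
    then have "eventually (\<lambda>i. norm (X (stepsize i) (stepindex i b) - X (stepsize i) (stepindex i a) -
        (real (stepindex i b) * stepsize i - real (stepindex i a) * stepsize i) *\<^sub>R v p)
        \<le> e * (real (stepindex i b) * stepsize i - real (stepindex i a) * stepsize i)) sequentially"
      using eventually_ge_at_top[of I]
    proof eventually_elim
      case (elim i)
      show ?case
      proof (rule X_increment[OF stepsize_pos])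
        show "stepindex i a \<le> stepindex i b"
          unfolding stepindex_def using ab stepsize_pos[of i] by (intro nat_mono floor_mono divide_right_mono) auto
        fix k assume k: "stepindex i a \<le> k" "k < stepindex i b"
        have "real (stepindex i a) * stepsize i \<le> real k * stepsize i" "real k * stepsize i \<le> real (stepindex i b) * stepsize i"
          using k stepsize_pos[of i] by auto
        \<comment> \<open>Rounding down may start the chain one step before \<open>a\<close>;
          halving \<open>\<kappa>\<close> leaves room for that step.\<close>
        then have "a - stepsize i \<le> real k * stepsize i" "real k * stepsize i \<le> b"
          using stepindex_bounds[of a i] stepindex_bounds[of b i] ab by linarith+
        then show "norm (V (stepsize i) k - v p) \<le> e"
          using ab elim by (intro g) auto
      qed
    qed
    moreover have "(\<lambda>i. norm (X (stepsize i) (stepindex i b) - X (stepsize i) (stepindex i a) -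
        (real (stepindex i b) * stepsize i - real (stepindex i a) * stepsize i) *\<^sub>R v p)) \<longlonglongrightarrow> norm (u b - u a - (b - a) *\<^sub>R v p)"
      using ab by (intro tendsto_intros u_lim stepindex_tendsto) auto
    moreover have "(\<lambda>i. e * (real (stepindex i b) * stepsize i - real (stepindex i a) * stepsize i)) \<longlonglongrightarrow> e * (b - a)"
      using ab by (intro tendsto_intros stepindex_tendsto) auto
    ultimately show "norm (u b - u a - (b - a) *\<^sub>R v p) \<le> e * (b - a)"
      by (intro tendsto_le[OF sequentially_bot])
  qed (use \<kappa> in simp)
qed

text \<open>The interpolation term is \<open>t\<close> minus the preceding grid time, multiplied by
  a quotient; its norm is at most \<open>stepsize i * K\<close>, so the interpolants have the same
  limit as the grid values.\<close>

theorem euler_converges: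
  assumes t: "t \<in> {0..T}"
  shows "(\<lambda>i. X (stepsize i) (stepindex i t) + (t / stepsize i - real (stepindex i t)) *\<^sub>R (X (stepsize i) (Suc (stepindex i t)) - X (stepsize i) (stepindex i t))) \<longlonglongrightarrow> u t"
    and "(u has_vector_derivative v t) (at t within {0..T})"
proof -
  have "(\<lambda>i. (t / stepsize i - real (stepindex i t)) *\<^sub>R (X (stepsize i) (Suc (stepindex i t)) - X (stepsize i) (stepindex i t))) \<longlonglongrightarrow> 0"
  proof (rule Lim_null_comparison)
    have 0: "(\<lambda>i. stepsize i * K) \<longlonglongrightarrow> 0 * K" by (intro tendsto_intros stepsize_0)
    then show "(\<lambda>i. stepsize i * K) \<longlonglongrightarrow> 0" by simp
    show "eventually (\<lambda>i. norm ((t / stepsize i - real (stepindex i t)) *\<^sub>R (X (stepsize i) (Suc (stepindex i t)) - X (stepsize i) (stepindex i t))) \<le> stepsize i * K) sequentially"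
    proof (intro always_eventually allI)
      fix i
      have b: "real (stepindex i t) * stepsize i \<le> t" "t < real (stepindex i t) * stepsize i + stepsize i" using stepindex_bounds[of t i] t by auto
      have "(t / stepsize i - real (stepindex i t)) *\<^sub>R (X (stepsize i) (Suc (stepindex i t)) - X (stepsize i) (stepindex i t)) =
         (t - real (stepindex i t) * stepsize i) *\<^sub>R V (stepsize i) (stepindex i t)"
        unfolding X_Suc[OF stepsize_pos] using stepsize_pos[of i] by (simp add: left_diff_distrib)
      also have "norm \<dots> \<le> stepsize i * K"
        unfolding norm_scaleR using b t by (intro mult_mono norm_V_le stepsize_pos) auto
      finally show "norm ((t / stepsize i - real (stepindex i t)) *\<^sub>R (X (stepsize i) (Suc (stepindex i t)) - X (stepsize i) (stepindex i t))) \<le> stepsize i * K" .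
    qed
  qed
  from tendsto_add[OF u_lim[OF t] this]
  show "(\<lambda>i. X (stepsize i) (stepindex i t) + (t / stepsize i - real (stepindex i t)) *\<^sub>R (X (stepsize i) (Suc (stepindex i t)) - X (stepsize i) (stepindex i t))) \<longlonglongrightarrow> u t"
    by simp
  show "(u has_vector_derivative v t) (at t within {0..T})"
    unfolding has_vector_derivative_def has_derivative_within_alt
  proof (intro conjI allI impI)
    show "bounded_linear (\<lambda>x. x *\<^sub>R v t)" by (rule bounded_linear_scaleR_left)
    fix e :: real assume e: "e > 0"
    obtain \<kappa> where \<kappa>: "\<kappa> > 0"
      "\<And>a b p. 0 \<le> a \<Longrightarrow> a \<le> b \<Longrightarrow> b \<le> T \<Longrightarrow> b - a < \<kappa> \<Longrightarrow> p \<in> {a, b} \<Longrightarrow> norm (u b - u a - (b - a) *\<^sub>R v p) \<le> e * (b - a)"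
      using u_increment[OF e] by metis
    show "\<exists>d>0. \<forall>y\<in>{0..T}. norm (y - t) < d \<longrightarrow> norm (u y - u t - (y - t) *\<^sub>R v t) \<le> e * norm (y - t)"
    proof (intro exI[of _ \<kappa>] conjI ballI impI \<kappa>(1))
      fix y assume y: "y \<in> {0..T}" "norm (y - t) < \<kappa>"
      show "norm (u y - u t - (y - t) *\<^sub>R v t) \<le> e * norm (y - t)"
      proof (cases "t \<le> y")
        case True
        then show ?thesis using \<kappa>(2)[of t y t] y t by auto
      next
        case False
        have "u y - u t - (y - t) *\<^sub>R v t = - (u t - u y - (t - y) *\<^sub>R v t)"
          by (simp add: algebra_simps)
        then have "norm (u y - u t - (y - t) *\<^sub>R v t) = norm (u t - u y - (t - y) *\<^sub>R v t)"
          by (metis norm_minus_cancel)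
        then show ?thesis using \<kappa>(2)[of y t t] y t False by auto
      qed
    qed
  qed
qed

end

section \<open>Convergence of the iteration\<close>

lemma AE_le_imp_le:
  fixes f :: "real \<Rightarrow> real"
  assumes f: "continuous_on UNIV f" and ae: "AE x in lborel. f x \<le> c"
  shows "f x \<le> c"
proof -
  let ?S = "{x. f x > c}"
  have op: "open ?S" using f by (intro open_Collect_less continuous_on_const) auto
  have "?S \<in> null_sets lborel"
    using ae AE_iff_null[of lborel "\<lambda>x. f x \<le> c"] op by (simp add: not_le)
  then have "negligible ?S" by (simp add: negligible_iff_null_sets null_sets_completionI)
  then have "?S = {}" using open_not_negligible[OF op] by blast
  then show ?thesis by (auto simp: not_less)
qed

lemma abs_le_Linf_norm:
  assumes f: "continuous_on UNIV f" and L: "f \<in> Linf"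
  shows "\<bar>f x\<bar> \<le> Linf_norm f"
proof -
  let ?E = "esssup lborel (\<lambda>x. ereal \<bar>f x\<bar>)"
  have ae: "AE x in lborel. ereal \<bar>f x\<bar> \<le> ?E" by (rule esssup_AE)
  have lt: "?E < \<infinity>" using L by (simp add: Linf_def)
  \<comment> \<open>As \<open>lborel\<close> is not the zero measure, the bound holds at some point.
    This excludes the essential supremum being minus infinity, where \<open>real_of_ereal\<close>
    would return 0.\<close>
  have "\<exists>x. ereal \<bar>f x\<bar> \<le> ?E"
  proof (rule ccontr)
    assume "\<not> ?thesis"
    then have "AE x in (lborel :: real measure). False" using ae by simp
    then have "ae_filter (lborel :: real measure) = bot" by (simp only: eventually_False)
    then show False by (simp add: ae_filter_eq_bot_iff)
  qed
  then obtain x0 where "ereal \<bar>f x0\<bar> \<le> ?E" by blast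
  then have "?E \<noteq> - \<infinity>" by auto
  then obtain c where c: "?E = ereal c" using lt by (cases ?E) auto
  have "AE x in lborel. \<bar>f x\<bar> \<le> c" using ae unfolding c by simp
  then have "\<bar>f x\<bar> \<le> c" by (intro AE_le_imp_le[of "\<lambda>x. \<bar>f x\<bar>"] continuous_intros f)
  then show ?thesis by (simp add: Linf_norm_def c)
qed

section \<open>Regularity of functions in \<open>W\<close>\<close>

lemma W_deriv:
  assumes "f \<in> W"
  shows "((deriv ^^ m) f has_real_derivative (deriv ^^ Suc m) f x) (at x)"
proof -
  have "(deriv ^^ m) f differentiable_on UNIV" using assms by (auto simp: W_def smooth_def)
  then have "(deriv ^^ m) f field_differentiable at x"
    by (simp add: differentiable_on_def real_differentiable_def field_differentiable_def)
  then show ?thesis by (simp add: DERIV_deriv_iff_field_differentiable)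
qed

lemma W_continuous: "f \<in> W \<Longrightarrow> continuous_on S ((deriv ^^ m) f)"
  by (rule DERIV_continuous_on[OF has_field_derivative_at_within[OF W_deriv]])

lemma W_abs_le: "f \<in> W \<Longrightarrow> \<bar>f x\<bar> \<le> Linf_norm f"
  using abs_le_Linf_norm[of f x] W_continuous[of f UNIV 0] by (simp add: W_def)

lemma W_bounded_deriv:
  assumes f: "f \<in> W"
  obtains C where "\<And>m x. m \<le> 4 \<Longrightarrow> \<bar>(deriv ^^ m) f x\<bar> \<le> C"
proof -
  have "\<exists>C. \<forall>x. \<bar>(deriv ^^ m) f x\<bar> \<le> C" if "m \<le> 4" for m
  proof (cases "m = 0")
    case True
    then show ?thesis using W_abs_le[OF f] by auto
  next
    case False
    then have "m \<in> {1..4}" using that by auto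
    then have "bounded (range ((deriv ^^ m) f))" using f unfolding W_def by blast
    then show ?thesis by (auto simp: bounded_iff)
  qed
  then obtain C where C: "\<And>m x. m \<le> 4 \<Longrightarrow> \<bar>(deriv ^^ m) f x\<bar> \<le> C m" by metis
  show thesis
  proof (rule that[of "\<Sum>m\<le>4. \<bar>C m\<bar>"])
    fix m :: nat and x assume m: "m \<le> 4"
    have "\<bar>(deriv ^^ m) f x\<bar> \<le> \<bar>C m\<bar>" using C[OF m, of x] by linarith
    also have "\<dots> \<le> (\<Sum>m\<le>4. \<bar>C m\<bar>)" using m by (intro member_le_sum) auto
    finally show "\<bar>(deriv ^^ m) f x\<bar> \<le> (\<Sum>m\<le>4. \<bar>C m\<bar>)" .
  qed
qed

lemma Linf_norm_nonneg: "f \<in> W \<Longrightarrow> 0 \<le> Linf_norm f"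
  using W_abs_le[of f 0] by linarith

lemma W_L2:
  assumes f: "f \<in> W"
  shows "f \<in> L2"
proof -
  have m [measurable]: "f \<in> borel_measurable borel"
    using W_continuous[OF f, of UNIV 0] by (intro borel_measurable_continuous_onI) simp
  have i: "integrable lborel (\<lambda>x. Linf_norm f * \<bar>f x\<bar>)"
    using f by (auto simp: W_def L1_def)
  have "integrable lborel (\<lambda>x. (f x)\<^sup>2)"
  proof (rule Bochner_Integration.integrable_bound[OF i])
    have "(f x)\<^sup>2 \<le> Linf_norm f * \<bar>f x\<bar>" for x
      using mult_right_mono[OF W_abs_le[OF f, of x], of "\<bar>f x\<bar>"] by (simp add: power2_eq_square)
    then show "AE x in lborel. norm ((f x)\<^sup>2) \<le> norm (Linf_norm f * \<bar>f x\<bar>)"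
      by (auto intro!: AE_I2 order_trans[OF _ abs_ge_self])
  qed simp
  then show ?thesis by (simp add: L2_def)
qed

text \<open>
  Integrating \<open>(f' f'' - f f''')' = f''\<^sup>2 - f f''''\<close> over \<open>[-n, n]\<close>: the boundary terms are
  merely bounded, and \<open>f f''''\<close> is integrable.
\<close>

lemma W_second_deriv_L2:
  assumes f: "f \<in> W"
  shows "(deriv ^^ 2) f \<in> L2"
proof -
  define D where "D m = (deriv ^^ m) f" for m
  have D: "(D m has_real_derivative D (Suc m) x) (at x)" for m x
    unfolding D_def by (rule W_deriv[OF f])
  have cD: "continuous_on S (D m)" for S m unfolding D_def by (rule W_continuous[OF f])
  have mD [measurable]: "D m \<in> borel_measurable borel" for m
    by (rule borel_measurable_continuous_onI[OF cD])
  obtain C where C: "\<And>m x. m \<le> 4 \<Longrightarrow> \<bar>D m x\<bar> \<le> C" using W_bounded_deriv[OF f] unfolding D_def by metis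
  have C0: "C \<ge> 0" using C[of 0 0] by simp
  have iD0: "integrable lborel (\<lambda>x. C * \<bar>D 0 x\<bar>)" using f by (auto simp: W_def L1_def D_def)
  \<comment> \<open>The boundary terms at the two ends are at most \<open>2 * C\<^sup>2\<close>
    each; the integral bounds that of \<open>f f''''\<close>.\<close>
  define K where "K = 4 * C\<^sup>2 + (LBINT x. C * \<bar>D 0 x\<bar>)"
  define F where "F n x = D 2 x * indicator {- real n..real n} x" for n x
  have F2: "(F n x)\<^sup>2 = (D 2 x)\<^sup>2 * indicator {- real n..real n} x" for n x
    by (simp add: F_def power_mult_distrib indicator_def)
  have iF: "integrable lborel (\<lambda>x. (F n x)\<^sup>2)" for n
    using borel_integrable_atLeastAtMost'[of "- real n" "real n" "\<lambda>x. (D 2 x)\<^sup>2"]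
    unfolding F2 set_integrable_def by (simp add: continuous_intros cD mult.commute)
  have FK: "(LBINT x. (F n x)\<^sup>2) \<le> K" for n
  proof -
    let ?P = "\<lambda>x. D 1 x * D 2 x - D 0 x * D 3 x"
    let ?I = "indicator {- real n..real n} :: real \<Rightarrow> real"
    have has: "has_bochner_integral lborel (\<lambda>x. ((D 2 x)\<^sup>2 - D 0 x * D 4 x) * ?I x) (?P (real n) - ?P (- real n))"
    proof (rule has_bochner_integral_FTC_Icc_real)
      fix x
      have "(?P has_real_derivative (D 1 x * D (Suc 2) x + D (Suc 1) x * D 2 x) - (D 0 x * D (Suc 3) x + D (Suc 0) x * D 3 x)) (at x)"
        by (intro DERIV_diff DERIV_mult' D)
      then show "(?P has_real_derivative ((D 2 x)\<^sup>2 - D 0 x * D 4 x)) (at x)"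
        by (simp add: power2_eq_square numeral_eq_Suc)
      have "continuous_on UNIV (\<lambda>x. (D 2 x)\<^sup>2 - D 0 x * D 4 x)" by (intro continuous_intros cD)
      then show "isCont (\<lambda>x. (D 2 x)\<^sup>2 - D 0 x * D 4 x) x" by (simp add: continuous_on_eq_continuous_at)
    qed simp
    have i04: "integrable lborel (\<lambda>x. D 0 x * D 4 x * ?I x)"
      using borel_integrable_atLeastAtMost'[of "- real n" "real n" "\<lambda>x. D 0 x * D 4 x"]
      unfolding set_integrable_def by (simp add: continuous_intros cD mult.commute)
    have le04: "D 0 x * D 4 x * ?I x \<le> C * \<bar>D 0 x\<bar>" for x
    proof -
      have "D 0 x * D 4 x \<le> \<bar>D 0 x\<bar> * \<bar>D 4 x\<bar>" by (simp flip: abs_mult)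
      also have "\<dots> \<le> \<bar>D 0 x\<bar> * C" using C[of 4 x] by (intro mult_left_mono) auto
      finally show ?thesis using C0 by (auto simp: indicator_def mult.commute)
    qed
    have P: "\<bar>?P x\<bar> \<le> 2 * C\<^sup>2" for x
    proof -
      have "\<bar>?P x\<bar> \<le> \<bar>D 1 x\<bar> * \<bar>D 2 x\<bar> + \<bar>D 0 x\<bar> * \<bar>D 3 x\<bar>" by (simp flip: abs_mult)
      also have "\<dots> \<le> C * C + C * C" using C C0 by (intro add_mono mult_mono) auto
      finally show ?thesis by (simp add: power2_eq_square)
    qed
    have "(LBINT x. (F n x)\<^sup>2) = (LBINT x. ((D 2 x)\<^sup>2 - D 0 x * D 4 x) * ?I x + D 0 x * D 4 x * ?I x)"
      unfolding F2 by (simp add: algebra_simps)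
    also have "\<dots> = (?P (real n) - ?P (- real n)) + (LBINT x. D 0 x * D 4 x * ?I x)"
      using has i04 by (subst Bochner_Integration.integral_add) (auto simp: has_bochner_integral_iff)
    also have "\<dots> \<le> 4 * C\<^sup>2 + (LBINT x. C * \<bar>D 0 x\<bar>)"
      using P[of "real n"] P[of "- real n"] integral_mono[OF i04 iD0 le04] by linarith
    finally show ?thesis by (simp add: K_def)
  qed
  have "D 2 \<in> L2"
  proof (rule L2_Fatou(1)[where f = F and C = "sqrt K"])
    have "F n \<in> borel_measurable borel" for n unfolding F_def[abs_def] by measurable
    then show "F n \<in> L2" for n using iF by (simp add: L2_def)
    show "L2_norm (F n) \<le> sqrt K" for n using FK by (simp add: L2_norm_def)
    show "(\<lambda>n. F n x) \<longlonglongrightarrow> D 2 x" for x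
    proof (rule tendsto_eventually)
      obtain N :: nat where "\<bar>x\<bar> \<le> real N" using real_arch_simple by blast
      then show "eventually (\<lambda>n. F n x = D 2 x) sequentially"
        by (intro eventually_sequentiallyI[of N]) (auto simp: F_def indicator_def)
    qed
  qed
  then show ?thesis by (simp add: D_def)
qed

text \<open>Uniform continuity alone is not preserved by products; bounded Lipschitz functions are
  closed under them, which handles the terms \<open>a k * f0 ^ k\<close>.\<close>

definition bounded_lipschitz :: "(real \<Rightarrow> real) \<Rightarrow> bool" where
  "bounded_lipschitz f \<longleftrightarrow> (\<exists>B\<ge>0. (\<forall>x. \<bar>f x\<bar> \<le> B) \<and> (\<forall>x y. \<bar>f x - f y\<bar> \<le> B * \<bar>x - y\<bar>))"

lemma bounded_lipschitz_mult:
  assumes "bounded_lipschitz f" "bounded_lipschitz g"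
  shows "bounded_lipschitz (\<lambda>x. f x * g x)"
proof -
  obtain B where B: "B \<ge> 0" "\<And>x. \<bar>f x\<bar> \<le> B" "\<And>x y. \<bar>f x - f y\<bar> \<le> B * \<bar>x - y\<bar>"
    using assms(1) by (auto simp: bounded_lipschitz_def)
  obtain C where C: "C \<ge> 0" "\<And>x. \<bar>g x\<bar> \<le> C" "\<And>x y. \<bar>g x - g y\<bar> \<le> C * \<bar>x - y\<bar>"
    using assms(2) by (auto simp: bounded_lipschitz_def)
  have 1: "\<bar>f x * g x\<bar> \<le> 2 * (B * C)" for x
  proof -
    have "\<bar>f x * g x\<bar> \<le> B * C" unfolding abs_mult using B C by (intro mult_mono) auto
    then show ?thesis using B C mult_nonneg_nonneg[of B C] by linarith
  qed
  have 2: "\<bar>f x * g x - f y * g y\<bar> \<le> 2 * (B * C) * \<bar>x - y\<bar>" for x y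
  proof -
    have "f x * g x - f y * g y = f x * (g x - g y) + (f x - f y) * g y" by (simp add: algebra_simps)
    also have "\<bar>\<dots>\<bar> \<le> \<bar>f x\<bar> * \<bar>g x - g y\<bar> + \<bar>f x - f y\<bar> * \<bar>g y\<bar>"
      by (rule order_trans[OF abs_triangle_ineq]) (simp add: abs_mult)
    also have "\<dots> \<le> B * (C * \<bar>x - y\<bar>) + (B * \<bar>x - y\<bar>) * C"
      using B C by (intro add_mono mult_mono) auto
    finally show ?thesis by (simp add: mult_ac)
  qed
  show ?thesis unfolding bounded_lipschitz_def
    by (rule exI[of _ "2 * (B * C)"]) (use 1 2 B C in simp)
qed

lemma bounded_lipschitz_power: "bounded_lipschitz f \<Longrightarrow> bounded_lipschitz (\<lambda>x. f x ^ k)"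
proof (induction k)
  case 0
  have "bounded_lipschitz (\<lambda>x. 1)" unfolding bounded_lipschitz_def by (intro exI[of _ 1]) simp
  then show ?case by simp
qed (auto intro: bounded_lipschitz_mult)

lemma bounded_lipschitz_imp_uniformly_continuous:
  assumes "bounded_lipschitz f"
  shows "uniformly_continuous_on UNIV f"
proof -
  obtain B where B: "B \<ge> 0" "\<And>x y. \<bar>f x - f y\<bar> \<le> B * \<bar>x - y\<bar>"
    using assms by (auto simp: bounded_lipschitz_def)
  then have "B-lipschitz_on UNIV f" by (intro lipschitz_onI) (auto simp: dist_real_def)
  then show ?thesis by (rule lipschitz_on_uniformly_continuous)
qed

lemma W_bounded_lipschitz:
  assumes f: "f \<in> W" and m: "m \<le> 3"
  shows "bounded_lipschitz ((deriv ^^ m) f)"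
proof -
  obtain C where C: "\<And>m x. m \<le> 4 \<Longrightarrow> \<bar>(deriv ^^ m) f x\<bar> \<le> C" using W_bounded_deriv[OF f] by metis
  have "norm ((deriv ^^ m) f x - (deriv ^^ m) f y) \<le> C * norm (x - y)" for x y
    by (rule field_differentiable_bound[where S = UNIV and f' = "(deriv ^^ Suc m) f"])
      (use C[of "Suc m"] m W_deriv[OF f] in auto)
  moreover have "C \<ge> 0" using C[of 0 0] by simp
  ultimately show ?thesis unfolding bounded_lipschitz_def using C[of m] m by (intro exI[of _ C]) simp
qed

lemma uniformly_continuous_uniform_limit:
  fixes f :: "nat \<Rightarrow> real \<Rightarrow> real"
  assumes f: "\<And>n. uniformly_continuous_on UNIV (f n)" and lim: "uniform_limit UNIV f l sequentially"
  shows "uniformly_continuous_on UNIV l"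
  unfolding uniformly_continuous_on_def
proof (intro allI impI)
  fix e :: real assume e: "e > 0"
  then have "eventually (\<lambda>n. \<forall>x\<in>UNIV. dist (f n x) (l x) < e / 3) sequentially"
    using uniform_limitD[OF lim, of "e / 3"] by simp
  then obtain n where n: "\<And>x. dist (f n x) (l x) < e / 3" by (auto simp: eventually_sequentially)
  obtain d where d: "d > 0" "\<And>x y. dist y x < d \<Longrightarrow> dist (f n y) (f n x) < e / 3"
    using f[of n] e unfolding uniformly_continuous_on_def by (metis UNIV_I divide_pos_pos zero_less_numeral)
  have "dist (l y) (l x) < e" if "dist y x < d" for x y
    using d(2)[OF that] n[of x] n[of y] unfolding dist_real_def by linarith
  then show "\<exists>d>0. \<forall>x\<in>UNIV. \<forall>x'\<in>UNIV. dist x' x < d \<longrightarrow> dist (l x') (l x) < e" using d(1) by blast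
qed

section \<open>Transfer from \<open>cl2\<close> to the concrete iteration\<close>

lemma L2_tendsto_fn:
  assumes v: "\<And>s. v s = fn (V s)" and lim: "(V \<longlongrightarrow> l) F"
  shows "L2_tendsto v (fn l) F"
proof -
  have 0: "((\<lambda>s. norm (V s - l)) \<longlongrightarrow> 0) F" using lim by (simp add: LIM_zero tendsto_norm_zero)
  have "fn (V s - l) = (\<lambda>x. v s x - fn l x)" for s using v by auto
  then have le: "L2_norm (\<lambda>x. v s x - fn l x) \<le> norm (V s - l)" for s
    by (metis L2_norm_fn_le)
  have "((\<lambda>s. L2_norm (\<lambda>x. v s x - fn l x)) \<longlongrightarrow> 0) F"
    by (rule Lim_null_comparison[OF _ 0]) (simp add: le always_eventually)
  then show ?thesis unfolding L2_tendsto_def by (simp add: v fn_L2)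
qed

lemma L2_differentiable_fn:
  assumes "(U has_vector_derivative V) (at t within S)"
  shows "L2_differentiable (\<lambda>t. fn (U t)) t S"
proof -
  let ?q = "\<lambda>s. (1 / (s - t)) *\<^sub>R (U s - U t)"
  have "((\<lambda>s. norm (U s - U t - (s - t) *\<^sub>R V) / norm (s - t)) \<longlongrightarrow> 0) (at t within S)"
    using assms by (simp add: has_vector_derivative_def has_derivative_iff_norm)
  moreover have "norm (U s - U t - (s - t) *\<^sub>R V) / norm (s - t) = norm (?q s - V)" if "s \<noteq> t" for s
  proof -
    have "?q s - V = (1 / (s - t)) *\<^sub>R (U s - U t - (s - t) *\<^sub>R V)" using that by (simp add: scaleR_diff_right)
    then show ?thesis by (simp add: divide_inverse mult.commute)
  qed
  then have "eventually (\<lambda>s. norm (U s - U t - (s - t) *\<^sub>R V) / norm (s - t) = norm (?q s - V)) (at t within S)"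
    by (simp add: eventually_at_filter)
  ultimately have "((\<lambda>s. norm (?q s - V)) \<longlongrightarrow> 0) (at t within S)" by (rule Lim_transform_eventually)
  then have "(?q \<longlongrightarrow> V) (at t within S)" by (simp add: LIM_zero_iff tendsto_norm_zero_iff)
  then have "L2_tendsto (\<lambda>s x. (fn (U s) x - fn (U t) x) / (s - t)) (fn V) (at t within S)"
    by (rule L2_tendsto_fn[rotated]) (auto simp: fun_eq_iff)
  then show ?thesis unfolding L2_differentiable_def by blast
qed

text \<open>Iterate \<open>n\<close> applies \<open>Gc\<close> only to its predecessors, so it
  suffices that iterate \<open>n - 1\<close> is in range. This covers the index after
  \<open>stepindex i T\<close>, which lies beyond time \<open>T\<close>.\<close>

lemma (in power_nonlinearity) imex_step_eq_euler:
  assumes h: "h > 0" and inB: "\<And>k. real k * h \<le> T \<Longrightarrow> euler Rc Gc x0 h k \<in> sup_ball"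
    and n: "n = 0 \<or> real (n - 1) * h \<le> T"
  shows "imex_step a h (fn x0) n = fn (euler Rc Gc x0 h n)"
  using n
proof (induction n)
  case (Suc n)
  have nT: "real n * h \<le> T" using Suc.prems by simp
  have "real (n - 1) * h \<le> real n * h" using h by (intro mult_right_mono) auto
  then have IH: "imex_step a h (fn x0) n = fn (euler Rc Gc x0 h n)" using Suc.IH nT by linarith
  have "fn (euler Rc Gc x0 h n + h *\<^sub>R Gc (euler Rc Gc x0 h n)) =
      (\<lambda>x. fn (euler Rc Gc x0 h n) x + h * G a (fn (euler Rc Gc x0 h n)) x)"
    using fn_Gc[OF inB[OF nT]] by auto
  then show ?case by (simp add: IH fn_Rc[OF h])
qed simp

text \<open>The resolvent contracts the supremum norm, so each step adds at most
  \<open>h * M\<close>.\<close>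

lemma (in power_nonlinearity) euler_in_sup_ball:
  assumes h: "h > 0" and x0: "norm (bc x0) + T * M \<le> \<rho>" and T: "T \<ge> 0"
  shows "real n * h \<le> T \<Longrightarrow> euler Rc Gc x0 h n \<in> sup_ball"
proof -
  have "real n * h \<le> T \<Longrightarrow> norm (bc (euler Rc Gc x0 h n)) \<le> norm (bc x0) + real n * h * M" for n
  proof (induction n)
    case (Suc n)
    let ?E = "euler Rc Gc x0 h n"
    have nT: "real n * h \<le> T" using Suc.prems h by (simp add: algebra_simps)
    have IH: "norm (bc ?E) \<le> norm (bc x0) + real n * h * M" by (rule Suc.IH[OF nT])
    also have "\<dots> \<le> \<rho>" using x0 mult_right_mono[OF nT M_nonneg(1)] by linarith
    finally have inB: "?E \<in> sup_ball" by (simp add: sup_ball_def)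
    have "norm (bc (euler Rc Gc x0 h (Suc n))) \<le> norm (bc (?E + h *\<^sub>R Gc ?E))"
      using norm_bc_Rc_le[OF h, of "?E + h *\<^sub>R Gc ?E"] by simp
    also have "\<dots> \<le> norm (bc ?E) + norm (h *\<^sub>R bc (Gc ?E))"
      unfolding bc_simps by (rule norm_triangle_ineq)
    also have "norm (h *\<^sub>R bc (Gc ?E)) \<le> h * M" using norm_bc_Gc_le[OF inB] h by simp
    finally show ?case using IH by (simp add: algebra_simps)
  qed simp
  moreover have "real n * h \<le> T \<Longrightarrow> real n * h * M \<le> T * M" using M_nonneg by (intro mult_right_mono)
  ultimately show "real n * h \<le> T \<Longrightarrow> euler Rc Gc x0 h n \<in> sup_ball"
    using x0 by (force simp: sup_ball_def)
qed

text \<open>Membership in \<open>X a\<close> gives convergence of the series at the norm of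
  \<open>f0\<close> itself; the larger radius \<open>r\<close> leaves room for the iterates to grow
  and for the derivative of \<open>G\<close> to stay bounded. The abstract theory is used with
  \<open>sup_ball\<close>, \<open>M1\<close>, \<open>M2\<close> and the second derivative of
  \<open>f0\<close> as \<open>Ax0\<close>.\<close>

theorem theorem16:
  fixes a :: "nat \<Rightarrow> real \<Rightarrow> real" and f0 :: "real \<Rightarrow> real"
  assumes "\<And>k. a k \<in> W"
    and "f0 \<in> X a"
    and "\<exists>r > Linf_norm f0. g_inf a r < \<infinity>"
  shows "\<forall>\<^sub>F T in at_right (0::real).
           \<exists>u :: real \<Rightarrow> real \<Rightarrow> real.
             (\<forall>t\<in>{0..T}.
                L2_tendsto (\<lambda>i. imex_iteration a (T / real (Suc i)) f0 t) (u t) sequentially) \<and>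
             L2_piecewise_differentiable_on u {0..T}"
proof -
  have f0: "f0 \<in> W" using assms(2) by (simp add: X_def)
  obtain r where r: "r > Linf_norm f0" "g_inf a r < \<infinity>" using assms(3) by blast
  define R0 where "R0 = Linf_norm f0"
  define A where "A k = Linf_norm (a k)" for k
  \<comment> \<open>The midpoint: above \<open>R0\<close>, so the iterates have room, and below
    \<open>r\<close>, so the differentiated series converge.\<close>
  define \<rho> where "\<rho> = (R0 + r) / 2"
  have R0: "R0 \<ge> 0" unfolding R0_def by (rule Linf_norm_nonneg[OF f0])
  have A0: "A k \<ge> 0" for k unfolding A_def by (rule Linf_norm_nonneg[OF assms(1)])
  have rho: "0 \<le> \<rho>" "\<rho> < r" "R0 < \<rho>" using R0 r by (auto simp: \<rho>_def R0_def)
  have "summable (\<lambda>k. A k * r ^ k)"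
    using r(2) A0 rho by (intro summable_suminf_not_top) (auto simp: g_inf_def A_def)
  then have As: "summable (\<lambda>k. A k * z ^ k)" if "\<bar>z\<bar> < r" for z
    using powser_insidea[of A r z] that \<open>summable (\<lambda>k. A k * r ^ k)\<close> rho by (auto intro: summable_norm_cancel)
  interpret power_nonlinearity a A r \<rho>
  proof
    show "continuous_on UNIV (a k)" for k using W_continuous[OF assms(1), of UNIV 0 k] by simp
    show "\<bar>a k x\<bar> \<le> A k" for k x unfolding A_def by (rule W_abs_le[OF assms(1)])
  qed (use As rho W_L2[OF assms(1)] in auto)
  obtain C where C: "\<And>m x. m \<le> 4 \<Longrightarrow> \<bar>(deriv ^^ m) f0 x\<bar> \<le> C" using W_bounded_deriv[OF f0] by metis
  have cf0: "continuous_on UNIV f0" using W_continuous[OF f0, of UNIV 0] by simp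
  obtain x0 where x0: "fn x0 = f0" "norm (bc x0) \<le> R0"
    using mk_cl2[OF cf0 W_abs_le[OF f0] W_L2[OF f0]] unfolding R0_def by metis
  obtain Ax0 where Ax0: "fn Ax0 = (deriv ^^ 2) f0"
    by (rule mk_cl2[OF W_continuous[OF f0] C W_second_deriv_L2[OF f0]]) auto
  have x0B: "x0 \<in> sup_ball" using x0 rho by (simp add: sup_ball_def)
  have bl_f0: "bounded_lipschitz f0" and bl_a: "bounded_lipschitz (a k)" for k
    using W_bounded_lipschitz[OF f0, of 0] W_bounded_lipschitz[OF assms(1), of 0 k] by simp_all
  \<comment> \<open>Needed for \<open>Rc_approx\<close> at \<open>f0'' + G(f0)\<close>. The
    Lipschitz constants of the terms are not bounded in \<open>k\<close>, so the series is treated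
    as a uniform limit of uniformly continuous partial sums.\<close>
  have "uniformly_continuous_on UNIV (G a f0)"
  proof (rule uniformly_continuous_uniform_limit)
    show "uniform_limit UNIV (\<lambda>n x. \<Sum>k<n. a k x * f0 x ^ k) (G a f0) sequentially"
      by (rule G_uniform_limit[OF a_le A rho(1,2)]) (use sup_ballD[OF x0B] x0 in simp)
    show "uniformly_continuous_on UNIV (\<lambda>x. \<Sum>k<n. a k x * f0 x ^ k)" for n
      by (intro uniformly_continuous_on_sum bounded_lipschitz_imp_uniformly_continuous
          bounded_lipschitz_mult bounded_lipschitz_power bl_f0 bl_a)
  qed
  moreover have "uniformly_continuous_on UNIV ((deriv ^^ 2) f0)"
    by (intro bounded_lipschitz_imp_uniformly_continuous W_bounded_lipschitz f0) simp
  ultimately have "uniformly_continuous_on UNIV (\<lambda>x. (deriv ^^ 2) f0 x + G a f0 x)"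
    by (intro uniformly_continuous_on_add)
  then have uc: "uniformly_continuous_on UNIV (fn (Ax0 + Gc x0))"
    by (simp add: Ax0 fn_Gc[OF x0B] x0 fn_simps(2)[abs_def])
  have dom: "x0 = Rc h (x0 - h *\<^sub>R Ax0)" if h: "h > 0" for h
  proof (rule fn_eqI)
    fix x
    have eq: "fn (x0 - h *\<^sub>R Ax0) = (\<lambda>x. f0 x - h * (deriv ^^ 2) f0 x)" by (auto simp: x0 Ax0)
    show "fn x0 x = fn (Rc h (x0 - h *\<^sub>R Ax0)) x"
      unfolding fn_Rc[OF h] eq x0
    proof (rule resolvent_inverse[OF h _ _ W_continuous[OF f0], symmetric])
      show "(f0 has_real_derivative (deriv ^^ 1) f0 x) (at x)" for x using W_deriv[OF f0, of 0 x] by simp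
      show "((deriv ^^ 1) f0 has_real_derivative (deriv ^^ 2) f0 x) (at x)" for x
        using W_deriv[OF f0, of 1 x] by (simp add: numeral_2_eq_2)
      show "\<bar>f0 x\<bar> \<le> C" for x using C[of 0] by simp
      show "\<bar>(deriv ^^ 1) f0 x\<bar> \<le> C" "\<bar>(deriv ^^ 2) f0 x\<bar> \<le> C" for x using C[of 1 x] C[of 2 x] by simp_all
    qed
  qed
  \<comment> \<open>Chosen so that \<open>R0 + T * M\<close> stays below \<open>\<rho>\<close>; the
    summand 1 avoids dividing by zero.\<close>
  define T0 where "T0 = (\<rho> - R0) / (M + 1)"
  have T0: "T0 > 0" using rho M_nonneg by (simp add: T0_def)
  show ?thesis
    unfolding eventually_at_right_field
  proof (intro exI[of _ T0] conjI allI impI T0)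
    fix T :: real assume T: "0 < T" "T < T0"
    have "T * M \<le> T0 * (M + 1)" using T M_nonneg by (intro mult_mono) auto
    then have TM: "norm (bc x0) + T * M \<le> \<rho>" using M_nonneg x0(2) by (simp add: T0_def)
    have inB: "euler Rc Gc x0 h n \<in> sup_ball" if "h > 0" "real n * h \<le> T" for h n
      using euler_in_sup_ball[OF that(1) TM _ that(2)] T by simp
    interpret semilinear Rc Gc Dc sup_ball M1 M2 x0 Ax0 T
    proof
      show "\<exists>h>0. norm (Rc h (Ax0 + Gc x0) - (Ax0 + Gc x0)) \<le> e" if "e > 0" for e
        by (rule Rc_approx[OF uc that])
    qed (rule linear_add[OF linear_Rc] linear_scale[OF linear_Rc] norm_Rc_le Rc_identity M_nonneg(2,3)
        Gc_lipschitz linear_add[OF linear_Dc] linear_scale[OF linear_Dc] norm_Dc_le Dc_lipschitz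
        Dc_derivative dom T(1) inB; assumption)+
    show "\<exists>u. (\<forall>t\<in>{0..T}. L2_tendsto (\<lambda>i. imex_iteration a (T / real (Suc i)) f0 t) (u t) sequentially) \<and>
             L2_piecewise_differentiable_on u {0..T}"
    proof (intro exI[of _ "\<lambda>t. fn (u t)"] conjI ballI)
      fix t assume t: "t \<in> {0..T}"
      show "L2_tendsto (\<lambda>i. imex_iteration a (T / real (Suc i)) f0 t) (fn (u t)) sequentially"
      proof (rule L2_tendsto_fn[OF _ euler_converges(1)[OF t]])
        fix i
        have b: "real (stepindex i t) * stepsize i \<le> T" using stepindex_bounds(1)[of t i] t by auto
        have "real (stepindex i t - 1) * stepsize i \<le> real (stepindex i t) * stepsize i"
          using stepsize_pos[of i] by (intro mult_right_mono) auto
        then have b1: "real (stepindex i t - 1) * stepsize i \<le> T" using b by linarith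
        have step: "imex_step a (stepsize i) f0 k = fn (euler Rc Gc x0 (stepsize i) k)" if "k = 0 \<or> real (k - 1) * stepsize i \<le> T" for k
          using imex_step_eq_euler[OF stepsize_pos inB[OF stepsize_pos] that] unfolding x0(1) .
        have e: "imex_step a (stepsize i) f0 (stepindex i t) = fn (euler Rc Gc x0 (stepsize i) (stepindex i t))"
          "imex_step a (stepsize i) f0 (Suc (stepindex i t)) = fn (euler Rc Gc x0 (stepsize i) (Suc (stepindex i t)))"
          using step[of "stepindex i t"] step[of "Suc (stepindex i t)"] b b1 by (simp_all del: euler.simps imex_step.simps)
        show "imex_iteration a (T / real (Suc i)) f0 t = fn (euler Rc Gc x0 (stepsize i) (stepindex i t) +
            (t / stepsize i - real (stepindex i t)) *\<^sub>R (euler Rc Gc x0 (stepsize i) (Suc (stepindex i t)) - euler Rc Gc x0 (stepsize i) (stepindex i t)))"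
          unfolding imex_iteration_def Let_def stepsize_def[symmetric] stepindex_def[symmetric] e
          by (simp add: fun_eq_iff algebra_simps del: euler.simps)
      qed
    next
      have "L2_continuous_on {0..T} (\<lambda>t. fn (u t))"
        unfolding L2_continuous_on_def
      proof
        fix t assume t: "t \<in> {0..T}"
        have "(u \<longlongrightarrow> u t) (at t within {0..T})"
          using has_vector_derivative_continuous[OF euler_converges(2)[OF t]] by (simp add: continuous_within)
        then show "L2_tendsto (\<lambda>t. fn (u t)) (fn (u t)) (at t within {0..T})"
          by (rule L2_tendsto_fn[rotated]) simp
      qed
      moreover have "L2_differentiable (\<lambda>t. fn (u t)) t {0..T}" if "t \<in> {0..T}" for t
        by (rule L2_differentiable_fn[OF euler_converges(2)[OF that]])
      ultimately show "L2_piecewise_differentiable_on (\<lambda>t. fn (u t)) {0..T}"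
        \<comment> \<open>The exceptional set is empty: \<open>u\<close> is differentiable on all of
          \<open>{0..T}\<close>, one-sidedly at the ends.\<close>
        unfolding L2_piecewise_differentiable_on_def by (intro conjI exI[of _ "{}"]) auto
    qed
  qed
qed

end
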